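(* Let $\mathcal{M}$ be any model of $\mathsf{I}\Sigma_1$ (in the language $\{0,1,+,\times,\exp,<\}$, with $\exp(x)=2^x$). Then, in $\mathcal{M}$, there exists a bi-isolated d.c.e.\ degree; i.e., there is a d.c.e.\ degree $\boldsymbol{d}$ of $\mathcal{M}$ such that (i) there is a c.e.\ degree $\boldsymbol{a}<\boldsymbol{d}$ with every c.e.\ degree $\boldsymbol{c}\le\boldsymbol{d}$ satisfying $\boldsymbol{c}\le\boldsymbol{a}$, and (ii) there is a c.e.\ degree $\boldsymbol{b}>\boldsymbol{d}$ with every c.e.\ degree $\boldsymbol{c}\ge\boldsymbol{d}$ satisfying $\boldsymbol{c}\ge\boldsymbol{b}$.
   Context: Recursion theory is carried out inside the model $\mathcal{M}$ (reverse recursion theory): c.e.\ sets are the $\Sigma_1$-definable subsets of $\mathcal{M}$, Turing reductions use $\mathcal{M}$-finite oracle information, and Turing degrees are formed accordingly. A set is d.c.e.\ if it is the difference of two c.e.\ sets; a degree is c.e.\ (resp.\ d.c.e.) if it contains a c.e.\ (resp.\ d.c.e.) set. A d.c.e.\ degree $\boldsymbol{d}$ is isolated if there exists a c.e.\ degree $\boldsymbol{a}<\boldsymbol{d}$ such that every c.e.\ degree below $\boldsymbol{d}$ is also below $\boldsymbol{a}$; it is upper isolated if there exists a c.e.\ degree $\boldsymbol{a}>\boldsymbol{d}$ such that every c.e.\ degree above $\boldsymbol{d}$ is also above $\boldsymbol{a}$; it is bi-isolated if it is both isolated and upper isolated. *)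

theory Defs
  imports Main
begin

text \<open>The domain of a structure for the language \<open>{0, 1, +, \<times>, exp, <}\<close> is the whole type
  \<open>'a\<close>.\<close>

record 'a arith_structure =
  zero_of :: 'a
  one_of :: 'a
  plus_of :: "'a \<Rightarrow> 'a \<Rightarrow> 'a"
  times_of :: "'a \<Rightarrow> 'a \<Rightarrow> 'a"
  exp_of :: "'a \<Rightarrow> 'a"
  less_of :: "'a \<Rightarrow> 'a \<Rightarrow> bool"

text \<open>Variables are de Bruijn indices.\<close>

datatype tm = Var nat | Zero | One | Plus tm tm | Times tm tm | Expo tm

datatype fm = Equal tm tm | Less tm tm | Neg fm | Conj fm fm | Exists fm

primrec lift_tm :: "tm \<Rightarrow> tm" where
  "lift_tm (Var i) = Var (Suc i)"
| "lift_tm Zero = Zero"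
| "lift_tm One = One"
| "lift_tm (Plus s t) = Plus (lift_tm s) (lift_tm t)"
| "lift_tm (Times s t) = Times (lift_tm s) (lift_tm t)"
| "lift_tm (Expo t) = Expo (lift_tm t)"

text \<open>\<open>push xs e\<close> is the assignment \<open>xs!0, \<dots>, xs!(k-1), e 0, e 1, \<dots>\<close> where
  \<open>k = length xs\<close>.\<close>

definition push :: "'a list \<Rightarrow> (nat \<Rightarrow> 'a) \<Rightarrow> nat \<Rightarrow> 'a" where
  "push xs e i = (if i < length xs then xs ! i else e (i - length xs))"

primrec tm_val :: "'a arith_structure \<Rightarrow> (nat \<Rightarrow> 'a) \<Rightarrow> tm \<Rightarrow> 'a" where
  "tm_val M e (Var i) = e i"
| "tm_val M e Zero = zero_of M"
| "tm_val M e One = one_of M"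
| "tm_val M e (Plus s t) = plus_of M (tm_val M e s) (tm_val M e t)"
| "tm_val M e (Times s t) = times_of M (tm_val M e s) (tm_val M e t)"
| "tm_val M e (Expo t) = exp_of M (tm_val M e t)"

primrec sat :: "'a arith_structure \<Rightarrow> (nat \<Rightarrow> 'a) \<Rightarrow> fm \<Rightarrow> bool" where
  "sat M e (Equal s t) \<longleftrightarrow> tm_val M e s = tm_val M e t"
| "sat M e (Less s t) \<longleftrightarrow> less_of M (tm_val M e s) (tm_val M e t)"
| "sat M e (Neg \<phi>) \<longleftrightarrow> \<not> sat M e \<phi>"
| "sat M e (Conj \<phi> \<psi>) \<longleftrightarrow> sat M e \<phi> \<and> sat M e \<psi>"
| "sat M e (Exists \<phi>) \<longleftrightarrow> (\<exists>x. sat M (push [x] e) \<phi>)"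

text \<open>In a bounded quantifier the bounding term does not contain the quantified variable, hence
  the lifting. Bounded universal quantifiers are obtained through negation.\<close>

inductive Delta0 :: "fm \<Rightarrow> bool" where
  "Delta0 (Equal s t)"
| "Delta0 (Less s t)"
| "Delta0 \<phi> \<Longrightarrow> Delta0 (Neg \<phi>)"
| "Delta0 \<phi> \<Longrightarrow> Delta0 \<psi> \<Longrightarrow> Delta0 (Conj \<phi> \<psi>)"
| "Delta0 \<phi> \<Longrightarrow> Delta0 (Exists (Conj (Less (Var 0) (lift_tm t)) \<phi>))"

inductive Sigma1 :: "fm \<Rightarrow> bool" where
  "Delta0 \<phi> \<Longrightarrow> Sigma1 \<phi>"
| "Sigma1 \<phi> \<Longrightarrow> Sigma1 (Exists \<phi>)"

text \<open>The basic axioms: \<open>PA\<^sup>-\<close> (non-negative parts of discretely ordered rings) together with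
  the recursion equations of \<open>exp x = 2\<^sup>x\<close>.\<close>

definition PA_minus_exp :: "'a arith_structure \<Rightarrow> bool" where
  "PA_minus_exp M \<longleftrightarrow>
    (\<forall>x y z. plus_of M (plus_of M x y) z = plus_of M x (plus_of M y z)) \<and>
    (\<forall>x y. plus_of M x y = plus_of M y x) \<and>
    (\<forall>x y z. times_of M (times_of M x y) z = times_of M x (times_of M y z)) \<and>
    (\<forall>x y. times_of M x y = times_of M y x) \<and>
    (\<forall>x y z. times_of M x (plus_of M y z) = plus_of M (times_of M x y) (times_of M x z)) \<and>
    (\<forall>x. plus_of M x (zero_of M) = x) \<and>
    (\<forall>x. times_of M x (zero_of M) = zero_of M) \<and>
    (\<forall>x. times_of M x (one_of M) = x) \<and>
    (\<forall>x y z. less_of M x y \<longrightarrow> less_of M y z \<longrightarrow> less_of M x z) \<and>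
    (\<forall>x. \<not> less_of M x x) \<and>
    (\<forall>x y. less_of M x y \<or> x = y \<or> less_of M y x) \<and>
    (\<forall>x y z. less_of M x y \<longrightarrow> less_of M (plus_of M x z) (plus_of M y z)) \<and>
    (\<forall>x y z. less_of M (zero_of M) z \<longrightarrow> less_of M x y \<longrightarrow>
       less_of M (times_of M x z) (times_of M y z)) \<and>
    (\<forall>x y. less_of M x y \<longrightarrow> (\<exists>z. plus_of M x z = y)) \<and>
    less_of M (zero_of M) (one_of M) \<and>
    (\<forall>x. less_of M (zero_of M) x \<longrightarrow> \<not> less_of M x (one_of M)) \<and>
    (\<forall>x. \<not> less_of M x (zero_of M)) \<and>
    exp_of M (zero_of M) = one_of M \<and>
    (\<forall>x. exp_of M (plus_of M x (one_of M)) = plus_of M (exp_of M x) (exp_of M x))"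

text \<open>Induction on the variable with index 0; the other free variables are parameters.\<close>

definition model_ISigma1 :: "'a arith_structure \<Rightarrow> bool" where
  "model_ISigma1 M \<longleftrightarrow> PA_minus_exp M \<and>
    (\<forall>\<phi> e. Sigma1 \<phi> \<longrightarrow> sat M (push [zero_of M] e) \<phi> \<longrightarrow>
       (\<forall>x. sat M (push [x] e) \<phi> \<longrightarrow> sat M (push [plus_of M x (one_of M)] e) \<phi>) \<longrightarrow>
       (\<forall>x. sat M (push [x] e) \<phi>))"

text \<open>\<open>k\<close>-ary relations (as sets of lists of length \<open>k\<close>) that are \<open>\<Sigma>\<^sub>1\<close>-definable in \<open>M\<close> with
  parameters from \<open>M\<close>; the parameters are the values of \<open>e\<close>.\<close>

definition Sigma1_definable :: "'a arith_structure \<Rightarrow> nat \<Rightarrow> 'a list set \<Rightarrow> bool" where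
  "Sigma1_definable M k R \<longleftrightarrow>
    (\<exists>\<phi> e. Sigma1 \<phi> \<and> R = {xs. length xs = k \<and> sat M (push xs e) \<phi>})"

definition ce :: "'a arith_structure \<Rightarrow> 'a set \<Rightarrow> bool" where
  "ce M A \<longleftrightarrow> Sigma1_definable M 1 {[x] | x. x \<in> A}"

definition dce :: "'a arith_structure \<Rightarrow> 'a set \<Rightarrow> bool" where
  "dce M D \<longleftrightarrow> (\<exists>A B. ce M A \<and> ce M B \<and> D = A - B)"

text \<open>The \<open>M\<close>-finite set with code \<open>c\<close>: all \<open>i\<close> such that the digit of \<open>c\<close> at position \<open>i\<close> in
  binary notation is 1, that is, \<open>c = (2q + 1) 2\<^sup>i + r\<close> with \<open>r < 2\<^sup>i\<close>.\<close>

definition coded_set :: "'a arith_structure \<Rightarrow> 'a \<Rightarrow> 'a set" where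
  "coded_set M c = {i. \<exists>q r. less_of M r (exp_of M i) \<and>
     c = plus_of M (times_of M (plus_of M (plus_of M q q) (one_of M)) (exp_of M i)) r}"

text \<open>The pair of \<open>M\<close>-finite sets with codes \<open>p\<close>, \<open>n\<close> is correct positive and negative
  information about \<open>X\<close>.\<close>

definition info_about :: "'a arith_structure \<Rightarrow> 'a set \<Rightarrow> 'a \<Rightarrow> 'a \<Rightarrow> bool" where
  "info_about M X p n \<longleftrightarrow> coded_set M p \<subseteq> X \<and> coded_set M n \<subseteq> - X"

text \<open>Turing reducibility is setwise: \<open>M\<close>-finite information about \<open>X\<close>, and not just single
  membership queries, is computed from \<open>M\<close>-finite information about \<open>Y\<close>. The pointwise version
  need not be transitive in models of \<open>I\<Sigma>\<^sub>1\<close>.\<close>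

definition turing_le :: "'a arith_structure \<Rightarrow> 'a set \<Rightarrow> 'a set \<Rightarrow> bool" where
  "turing_le M X Y \<longleftrightarrow> (\<exists>\<Phi>. Sigma1_definable M 4 \<Phi> \<and>
    (\<forall>p n. info_about M X p n \<longleftrightarrow>
       (\<exists>p' n'. [p, n, p', n'] \<in> \<Phi> \<and> info_about M Y p' n')))"

definition turing_eq :: "'a arith_structure \<Rightarrow> ('a set \<times> 'a set) set" where
  "turing_eq M = {(X, Y). turing_le M X Y \<and> turing_le M Y X}"

definition degrees :: "'a arith_structure \<Rightarrow> 'a set set set" where
  "degrees M = UNIV // turing_eq M"

definition deg_le :: "'a arith_structure \<Rightarrow> 'a set set \<Rightarrow> 'a set set \<Rightarrow> bool" where
  "deg_le M a b \<longleftrightarrow> (\<exists>X\<in>a. \<exists>Y\<in>b. turing_le M X Y)"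

definition deg_less :: "'a arith_structure \<Rightarrow> 'a set set \<Rightarrow> 'a set set \<Rightarrow> bool" where
  "deg_less M a b \<longleftrightarrow> deg_le M a b \<and> a \<noteq> b"

definition ce_degree :: "'a arith_structure \<Rightarrow> 'a set set \<Rightarrow> bool" where
  "ce_degree M a \<longleftrightarrow> a \<in> degrees M \<and> (\<exists>A\<in>a. ce M A)"

definition dce_degree :: "'a arith_structure \<Rightarrow> 'a set set \<Rightarrow> bool" where
  "dce_degree M d \<longleftrightarrow> d \<in> degrees M \<and> (\<exists>D\<in>d. dce M D)"

definition isolated :: "'a arith_structure \<Rightarrow> 'a set set \<Rightarrow> bool" where
  "isolated M d \<longleftrightarrow> dce_degree M d \<and>
    (\<exists>a. ce_degree M a \<and> deg_less M a d \<and>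
      (\<forall>c. ce_degree M c \<and> deg_le M c d \<longrightarrow> deg_le M c a))"

definition upper_isolated :: "'a arith_structure \<Rightarrow> 'a set set \<Rightarrow> bool" where
  "upper_isolated M d \<longleftrightarrow> dce_degree M d \<and>
    (\<exists>b. ce_degree M b \<and> deg_less M d b \<and>
      (\<forall>c. ce_degree M c \<and> deg_le M d c \<longrightarrow> deg_le M b c))"

definition bi_isolated :: "'a arith_structure \<Rightarrow> 'a set set \<Rightarrow> bool" where
  "bi_isolated M d \<longleftrightarrow> isolated M d \<and> upper_isolated M d"

end

theory Submission imports Defs begin

text \<open>
  \<open>D\<close> is built by a finite injury construction with recursively bounded injuries. The set \<open>A\<close>
  consists of the pairs \<open>(d, u)\<close> such that \<open>d\<close> is in \<open>D\<close> at stage \<open>u\<close> and is removed later, and \<open>B\<close> of the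
  pairs \<open>(d, u)\<close> such that membership of \<open>d\<close> in \<open>D\<close> changes after stage \<open>u\<close>; thus \<open>A \<le> D \<le> B\<close>. Elements
  enter \<open>D\<close> only as witnesses for the requirements \<open>D \<noteq> \<Phi>(A)\<close>. If a computation \<open>\<Phi>(D)\<close> says that
  some numbers are not in the c.e. set \<open>W\<close> and one of them enters \<open>W\<close> without a change of \<open>A\<close> below
  the computation, then the witnesses that entered \<open>D\<close> in between can be removed again, which restores
  the computation and makes it wrong for good; hence \<open>W \<le> D\<close> implies \<open>W \<le> A\<close>. A witness is removed only
  after every set \<open>W\<close> of higher priority that looks like computing \<open>D\<close> has changed since the
  witness entered, so a \<open>W\<close> computing \<open>D\<close> recognises all changes of \<open>D\<close> and computes \<open>B\<close>. If the
  permission of \<open>W\<close> never comes then \<open>W\<close> does not compute \<open>D\<close>, and a later attempt of the same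
  isolation requirement is no longer stopped by this \<open>W\<close>; so \<open>2\<^sup>q\<close> attempts suffice at level \<open>q\<close>.

  Turing incomparabilities reduce to \<open>D \<not>\<le> A\<close>: if \<open>B \<le> D\<close> then \<open>D \<le> B \<le> A\<close> by isolation.
\<close>

section \<open>Definability with parameters\<close>

text \<open>The obstacle is that only Sigma_1 induction is available. "Level q acts only finitely
  often" is a Sigma_2 statement, so it cannot be proved by induction on q. Instead,
  \<open>finite_acts\<close> reads the positions that acted without a later action of higher
  priority as the digits of a binary number; it grows with every action and stays below a fixed
  power of two. This requires a recursive bound on the positions of a level, hence on the attempts.
  By the pigeonhole principle q + 1 attempts would do; 2^q is taken because the set of the i < q
  that block the first k attempts has a code u with k \<le> u < 2^q, which turns the principle into
  an induction on k. No restraints are imposed. A removal hits only elements that entered after the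
  last action of higher priority, so every action protects the elements of \<open>D\<close> at that
  time from all larger levels. A computation from \<open>D\<close> is checked against
  \<open>A\<close> on its positive use only: the elements that violate the negative use are exactly
  those that a removal can take out.\<close>

primrec ren_tm :: "(nat \<Rightarrow> nat) \<Rightarrow> tm \<Rightarrow> tm" where
  "ren_tm f (Var i) = Var (f i)"
| "ren_tm f Zero = Zero"
| "ren_tm f One = One"
| "ren_tm f (Plus s t) = Plus (ren_tm f s) (ren_tm f t)"
| "ren_tm f (Times s t) = Times (ren_tm f s) (ren_tm f t)"
| "ren_tm f (Expo t) = Expo (ren_tm f t)"

definition ren_up :: "(nat \<Rightarrow> nat) \<Rightarrow> nat \<Rightarrow> nat" where
  "ren_up f i = (case i of 0 \<Rightarrow> 0 | Suc j \<Rightarrow> Suc (f j))"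

primrec ren_fm :: "(nat \<Rightarrow> nat) \<Rightarrow> fm \<Rightarrow> fm" where
  "ren_fm f (Equal s t) = Equal (ren_tm f s) (ren_tm f t)"
| "ren_fm f (Less s t) = Less (ren_tm f s) (ren_tm f t)"
| "ren_fm f (Neg p) = Neg (ren_fm f p)"
| "ren_fm f (Conj p q) = Conj (ren_fm f p) (ren_fm f q)"
| "ren_fm f (Exists p) = Exists (ren_fm (ren_up f) p)"

lemma push_one: "push [x] e i = (case i of 0 \<Rightarrow> x | Suc j \<Rightarrow> e j)"
  by (cases i) (auto simp: push_def)

lemma push_Cons: "push (x # xs) e = push [x] (push xs e)"
  by (rule ext) (auto simp: push_def nth_Cons split: nat.split)

lemma push_Nil [simp]: "push [] e = e"
  by (rule ext) (simp add: push_def)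

lemma ren_up_push: "(\<lambda>i. push [x] v (ren_up f i)) = push [x] (\<lambda>i. v (f i))"
  by (rule ext) (auto simp: push_one ren_up_def split: nat.split)

lemma tm_val_ren: "tm_val M v (ren_tm f t) = tm_val M (\<lambda>i. v (f i)) t"
  by (induction t) auto

lemma sat_ren: "sat M v (ren_fm f p) = sat M (\<lambda>i. v (f i)) p"
  by (induction p arbitrary: f v) (auto simp: tm_val_ren ren_up_push)

lemma ren_lift_tm: "ren_tm (ren_up f) (lift_tm t) = lift_tm (ren_tm f t)"
  by (induction t) (auto simp: ren_up_def)

lemma tm_val_lift: "tm_val M (push [x] v) (lift_tm t) = tm_val M v t"
  by (induction t) (auto simp: push_one)

lemma Delta0_ren: "Delta0 p \<Longrightarrow> Delta0 (ren_fm f p)"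
proof (induction arbitrary: f rule: Delta0.induct)
  case (5 p t)
  show ?case using 5
    by (simp add: ren_lift_tm Delta0.intros) (simp add: ren_up_def Delta0.intros)
qed (auto intro: Delta0.intros)

text \<open>Interleaving keeps infinitely many free slots for variables next to the parameters.\<close>

definition mrg :: "(nat \<Rightarrow> 'a) \<Rightarrow> (nat \<Rightarrow> 'a) \<Rightarrow> nat \<Rightarrow> 'a" where
  "mrg v e i = (if even i then v (i div 2) else e (i div 2))"

text \<open>Semantic counterparts of terms and bounded formulas with parameters \<open>e\<close>.
  Definability is derived by resolution along the shape of a HOL expression, so later formulas never
  have to be written out.\<close>

definition def_tm :: "'a arith_structure \<Rightarrow> ((nat \<Rightarrow> 'a) \<Rightarrow> 'a) \<Rightarrow> bool" where
  "def_tm M f \<longleftrightarrow> (\<exists>t e. \<forall>v. tm_val M (mrg v e) t = f v)"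

definition def_D0 :: "'a arith_structure \<Rightarrow> ((nat \<Rightarrow> 'a) \<Rightarrow> bool) \<Rightarrow> bool" where
  "def_D0 M P \<longleftrightarrow> (\<exists>p e. Delta0 p \<and> (\<forall>v. sat M (mrg v e) p = P v))"

text \<open>Two formulas come with parameter lists \<open>e1\<close> and \<open>e2\<close> of their
  own. Both lists fit into the single list \<open>mrg e1 e2\<close>; these renamings move the
  parameter slots to the right places and leave the variables alone.\<close>

definition ren_left :: "nat \<Rightarrow> nat" where
  "ren_left i = (if even i then i else 2 * (2 * (i div 2)) + 1)"

definition ren_right :: "nat \<Rightarrow> nat" where
  "ren_right i = (if even i then i else 2 * (2 * (i div 2) + 1) + 1)"

lemma mrg_left: "(\<lambda>i. mrg v (mrg e1 e2) (ren_left i)) = mrg v e1"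
  and mrg_right: "(\<lambda>i. mrg v (mrg e1 e2) (ren_right i)) = mrg v e2"
  by (rule ext, auto simp: mrg_def ren_left_def ren_right_def elim!: oddE)+

lemma def_tm_leftE:
  assumes "def_tm M f"
  obtains t e1 where "\<And>v e2. tm_val M (mrg v (mrg e1 e2)) t = f v"
proof -
  from assms obtain t e where "\<And>v. tm_val M (mrg v e) t = f v" unfolding def_tm_def by blast
  then have "tm_val M (mrg v (mrg e e')) (ren_tm ren_left t) = f v" for v e'
    by (simp add: tm_val_ren mrg_left)
  with that show ?thesis by blast
qed

lemma def_tm_rightE:
  assumes "def_tm M f"
  obtains t e2 where "\<And>v e1. tm_val M (mrg v (mrg e1 e2)) t = f v"
proof -
  from assms obtain t e where "\<And>v. tm_val M (mrg v e) t = f v" unfolding def_tm_def by blast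
  then have "tm_val M (mrg v (mrg e' e)) (ren_tm ren_right t) = f v" for v e'
    by (simp add: tm_val_ren mrg_right)
  with that show ?thesis by blast
qed

lemma def_D0_leftE:
  assumes "def_D0 M P"
  obtains p e1 where "Delta0 p" "\<And>v e2. sat M (mrg v (mrg e1 e2)) p = P v"
proof -
  from assms obtain p e where p: "Delta0 p" "\<And>v. sat M (mrg v e) p = P v" unfolding def_D0_def by blast
  then have "sat M (mrg v (mrg e e')) (ren_fm ren_left p) = P v" for v e'
    by (simp add: sat_ren mrg_left)
  with that Delta0_ren[OF p(1)] show ?thesis by blast
qed

lemma def_D0_rightE:
  assumes "def_D0 M P"
  obtains p e2 where "Delta0 p" "\<And>v e1. sat M (mrg v (mrg e1 e2)) p = P v"
proof -
  from assms obtain p e where p: "Delta0 p" "\<And>v. sat M (mrg v e) p = P v" unfolding def_D0_def by blast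
  then have "sat M (mrg v (mrg e' e)) (ren_fm ren_right p) = P v" for v e'
    by (simp add: sat_ren mrg_right)
  with that Delta0_ren[OF p(1)] show ?thesis by blast
qed

lemma def_tm_var: "def_tm M (\<lambda>v. v i)"
  unfolding def_tm_def by (rule exI[of _ "Var (2 * i)"]) (simp add: mrg_def)

lemma def_tm_const: "def_tm M (\<lambda>v. c)"
  unfolding def_tm_def
  by (rule exI[of _ "Var 1"], rule exI[of _ "\<lambda>_. c"]) (simp add: mrg_def)

lemma def_tm_plus:
  assumes "def_tm M f" "def_tm M g"
  shows "def_tm M (\<lambda>v. plus_of M (f v) (g v))"
proof -
  from assms(1) obtain s e1 where s: "\<And>v e2. tm_val M (mrg v (mrg e1 e2)) s = f v"
    by (rule def_tm_leftE) blast
  from assms(2) obtain t e2 where t: "\<And>v e1. tm_val M (mrg v (mrg e1 e2)) t = g v"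
    by (rule def_tm_rightE) blast
  have "\<forall>v. tm_val M (mrg v (mrg e1 e2)) (Plus s t) = plus_of M (f v) (g v)" by (simp add: s t Delta0.intros)
  then show ?thesis unfolding def_tm_def by blast
qed

lemma def_tm_times:
  assumes "def_tm M f" "def_tm M g"
  shows "def_tm M (\<lambda>v. times_of M (f v) (g v))"
proof -
  from assms(1) obtain s e1 where s: "\<And>v e2. tm_val M (mrg v (mrg e1 e2)) s = f v"
    by (rule def_tm_leftE) blast
  from assms(2) obtain t e2 where t: "\<And>v e1. tm_val M (mrg v (mrg e1 e2)) t = g v"
    by (rule def_tm_rightE) blast
  have "\<forall>v. tm_val M (mrg v (mrg e1 e2)) (Times s t) = times_of M (f v) (g v)" by (simp add: s t Delta0.intros)
  then show ?thesis unfolding def_tm_def by blast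
qed

lemma def_tm_exp:
  assumes "def_tm M f"
  shows "def_tm M (\<lambda>v. exp_of M (f v))"
proof -
  from assms obtain t e where "\<And>v. tm_val M (mrg v e) t = f v" unfolding def_tm_def by blast
  then have "\<forall>v. tm_val M (mrg v e) (Expo t) = exp_of M (f v)" by simp
  then show ?thesis unfolding def_tm_def by blast
qed

lemma def_D0_eq:
  assumes "def_tm M f" "def_tm M g"
  shows "def_D0 M (\<lambda>v. f v = g v)"
proof -
  from assms(1) obtain s e1 where s: "\<And>v e2. tm_val M (mrg v (mrg e1 e2)) s = f v"
    by (rule def_tm_leftE) blast
  from assms(2) obtain t e2 where t: "\<And>v e1. tm_val M (mrg v (mrg e1 e2)) t = g v"
    by (rule def_tm_rightE) blast
  have "Delta0 (Equal s t) \<and> (\<forall>v. sat M (mrg v (mrg e1 e2)) (Equal s t) = (f v = g v))" by (simp add: s t Delta0.intros)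
  then show ?thesis unfolding def_D0_def by blast
qed

lemma def_D0_less:
  assumes "def_tm M f" "def_tm M g"
  shows "def_D0 M (\<lambda>v. less_of M (f v) (g v))"
proof -
  from assms(1) obtain s e1 where s: "\<And>v e2. tm_val M (mrg v (mrg e1 e2)) s = f v"
    by (rule def_tm_leftE) blast
  from assms(2) obtain t e2 where t: "\<And>v e1. tm_val M (mrg v (mrg e1 e2)) t = g v"
    by (rule def_tm_rightE) blast
  have "Delta0 (Less s t) \<and> (\<forall>v. sat M (mrg v (mrg e1 e2)) (Less s t) = (less_of M (f v) (g v)))" by (simp add: s t Delta0.intros)
  then show ?thesis unfolding def_D0_def by blast
qed

lemma def_D0_not:
  assumes "def_D0 M P"
  shows "def_D0 M (\<lambda>v. \<not> P v)"
proof -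
  from assms obtain p e where "Delta0 p" "\<And>v. sat M (mrg v e) p = P v" unfolding def_D0_def by blast
  then have "Delta0 (Neg p) \<and> (\<forall>v. sat M (mrg v e) (Neg p) = (\<not> P v))" by (simp add: Delta0.intros)
  then show ?thesis unfolding def_D0_def by blast
qed

lemma def_D0_conj:
  assumes "def_D0 M P" "def_D0 M Q"
  shows "def_D0 M (\<lambda>v. P v \<and> Q v)"
proof -
  from assms(1) obtain p e1 where p: "Delta0 p" "\<And>v e2. sat M (mrg v (mrg e1 e2)) p = P v"
    by (rule def_D0_leftE) blast
  from assms(2) obtain q e2 where q: "Delta0 q" "\<And>v e1. sat M (mrg v (mrg e1 e2)) q = Q v"
    by (rule def_D0_rightE) blast
  have "Delta0 (Conj p q) \<and> (\<forall>v. sat M (mrg v (mrg e1 e2)) (Conj p q) = (P v \<and> Q v))"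
    by (simp add: p q Delta0.intros)
  then show ?thesis unfolding def_D0_def by blast
qed

lemma def_D0_disj:
  assumes "def_D0 M P" "def_D0 M Q"
  shows "def_D0 M (\<lambda>v. P v \<or> Q v)"
  using def_D0_not[OF def_D0_conj[OF def_D0_not[OF assms(1)] def_D0_not[OF assms(2)]]] by simp

text \<open>A quantifier puts its value in front of the interleaved assignment and thereby swaps the
  parity of all other slots. This renaming restores the interleaving, with the new value as variable
  0.\<close>

definition ren_bind :: "nat \<Rightarrow> nat" where
  "ren_bind i = (if i = 0 then 0 else if even i then i - 1 else i + 1)"

lemma mrg_bind: "(\<lambda>i. push [x] (mrg v e) (ren_bind i)) = mrg (push [x] v) e"
proof
  fix i
  show "push [x] (mrg v e) (ren_bind i) = mrg (push [x] v) e i"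
  proof (cases "even i")
    case True
    then obtain k where "i = 2 * k" by (auto elim: evenE)
    then show ?thesis by (cases k) (auto simp: mrg_def push_one ren_bind_def)
  next
    case False
    then obtain k where "i = 2 * k + 1" by (auto elim: oddE)
    then show ?thesis by (auto simp: mrg_def push_one ren_bind_def)
  qed
qed

lemma def_D0_bex:
  assumes P: "def_D0 M (\<lambda>v. P (v 0) (\<lambda>i. v (Suc i)))" and t: "def_tm M t"
  shows "def_D0 M (\<lambda>v. \<exists>x. less_of M x (t v) \<and> P x v)"
proof -
  from t obtain t' e1 where t': "\<And>v e2. tm_val M (mrg v (mrg e1 e2)) t' = t v"
    by (rule def_tm_leftE) blast
  from P obtain p e2 where p: "Delta0 p"
    "\<And>v e1. sat M (mrg v (mrg e1 e2)) p = P (v 0) (\<lambda>i. v (Suc i))"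
    by (rule def_D0_rightE) blast
  let ?q = "Exists (Conj (Less (Var 0) (lift_tm t')) (ren_fm ren_bind p))"
  have "Delta0 ?q" by (intro Delta0.intros Delta0_ren p)
  moreover have "sat M (mrg v (mrg e1 e2)) ?q = (\<exists>x. less_of M x (t v) \<and> P x v)" for v
    by (simp add: tm_val_lift t' sat_ren mrg_bind p(2)) (simp add: push_one)
  ultimately show ?thesis unfolding def_D0_def by blast
qed

lemma def_D0_ball:
  assumes "def_D0 M (\<lambda>v. P (v 0) (\<lambda>i. v (Suc i)))" "def_tm M t"
  shows "def_D0 M (\<lambda>v. \<forall>x. less_of M x (t v) \<longrightarrow> P x v)"
  using def_D0_not[OF def_D0_bex[of M "\<lambda>x v. \<not> P x v", OF def_D0_not[OF assms(1)] assms(2)]]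
  by simp

lemma def_D0_rename:
  assumes "def_D0 M P"
  shows "def_D0 M (\<lambda>v. P (\<lambda>i. v (f i)))"
proof -
  from assms obtain p e where p: "Delta0 p" "\<And>v. sat M (mrg v e) p = P v"
    unfolding def_D0_def by blast
  let ?g = "\<lambda>i. if even i then 2 * f (i div 2) else i"
  have "(\<lambda>i. mrg v e (?g i)) = mrg (\<lambda>i. v (f i)) e" for v
    by (rule ext) (auto simp: mrg_def)
  then have "sat M (mrg v e) (ren_fm ?g p) = P (\<lambda>i. v (f i))" for v
    by (simp add: sat_ren p(2))
  with Delta0_ren[OF p(1)] show ?thesis unfolding def_D0_def by blast
qed

lemma def_D0_formula:
  assumes "Delta0 p"
  shows "def_D0 M (\<lambda>v. sat M (push [v 0, v 1] e) p)"
proof -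
  let ?g = "\<lambda>i. if i = 0 then 0 else if i = 1 then 2 else 2 * (i - Suc (Suc 0)) + 1"
  have "(\<lambda>i. mrg v e (?g i)) = push [v 0, v 1] e" for v
    by (rule ext) (auto simp: mrg_def push_def nth_Cons split: nat.split)
  then have "sat M (mrg v e) (ren_fm ?g p) = sat M (push [v 0, v 1] e) p" for v
    by (simp add: sat_ren)
  with Delta0_ren[OF assms] show ?thesis unfolding def_D0_def by blast
qed

lemma def_D0_to_formula:
  assumes "def_D0 M (\<lambda>v. Q (v 0) (v 1))"
  obtains p e where "Delta0 p" "\<And>x y. sat M (push [x, y] e) p = Q x y"
proof -
  from assms obtain p e where p: "Delta0 p" "\<And>v. sat M (mrg v e) p = Q (v 0) (v 1)"
    unfolding def_D0_def by blast
  let ?g = "\<lambda>i. if even i then (if i = 2 then 1 else 0) else Suc (Suc (i div 2))"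
  let ?v = "\<lambda>x y i. if i = Suc 0 then y else x"
  have "(\<lambda>i. push [x, y] e (?g i)) = mrg (?v x y) e" for x y
    by (rule ext) (auto simp: mrg_def push_def nth_Cons elim!: evenE oddE split: nat.split)
  then have "sat M (push [x, y] e) (ren_fm ?g p) = Q x y" for x y
    by (simp add: sat_ren p(2))
  with Delta0_ren[OF p(1)] that show ?thesis by blast
qed

section \<open>Arithmetic in a model\<close>

locale isigma1 =
  fixes M :: "'a arith_structure"
  assumes model: "model_ISigma1 M"
begin

abbreviation zer ("\<zero>") where "\<zero> \<equiv> zero_of M"
abbreviation uni ("\<one>") where "\<one> \<equiv> one_of M"
abbreviation pls (infixl "\<oplus>" 65) where "x \<oplus> y \<equiv> plus_of M x y"
abbreviation tms (infixl "\<otimes>" 70) where "x \<otimes> y \<equiv> times_of M x y"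
abbreviation two_pow ("\<e>") where "\<e> x \<equiv> exp_of M x"
abbreviation lt (infix "\<sqsubset>" 50) where "x \<sqsubset> y \<equiv> less_of M x y"

definition le (infix "\<sqsubseteq>" 50) where "x \<sqsubseteq> y \<longleftrightarrow> x \<sqsubset> y \<or> x = y"
text \<open>Truncated subtraction is not in the language; it is what turns the model into a
  \<open>linordered_semidom\<close>, whose library then applies.\<close>

definition mns (infixl "\<ominus>" 65) where
  "x \<ominus> y = (if y \<sqsubseteq> x then THE z. z \<oplus> y = x else \<zero>)"

lemma basic: "PA_minus_exp M"
  using model by (simp add: model_ISigma1_def)

lemmas axs = basic[unfolded PA_minus_exp_def]

lemma add_assoc: "(x \<oplus> y) \<oplus> z = x \<oplus> (y \<oplus> z)"
  by (rule axs[THEN conjunct1, rule_format])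
lemma add_commute: "x \<oplus> y = y \<oplus> x"
  by (rule axs[THEN conjunct2, THEN conjunct1, rule_format])
lemma mult_assoc: "(x \<otimes> y) \<otimes> z = x \<otimes> (y \<otimes> z)"
  by (rule axs[THEN conjunct2, THEN conjunct2, THEN conjunct1, rule_format])
lemma mult_commute: "x \<otimes> y = y \<otimes> x"
  by (rule axs[THEN conjunct2, THEN conjunct2, THEN conjunct2, THEN conjunct1, rule_format])
lemma distrib_left: "x \<otimes> (y \<oplus> z) = x \<otimes> y \<oplus> x \<otimes> z"
  by (rule axs[THEN conjunct2, THEN conjunct2, THEN conjunct2, THEN conjunct2, THEN conjunct1, rule_format])
lemma add_0: "x \<oplus> \<zero> = x"
  by (rule axs[THEN conjunct2, THEN conjunct2, THEN conjunct2, THEN conjunct2, THEN conjunct2, THEN conjunct1, rule_format])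
lemma mult_0: "x \<otimes> \<zero> = \<zero>"
  by (rule axs[THEN conjunct2, THEN conjunct2, THEN conjunct2, THEN conjunct2, THEN conjunct2, THEN conjunct2, THEN conjunct1, rule_format])
lemma mult_1: "x \<otimes> \<one> = x"
  by (rule axs[THEN conjunct2, THEN conjunct2, THEN conjunct2, THEN conjunct2, THEN conjunct2, THEN conjunct2, THEN conjunct2, THEN conjunct1, rule_format])
lemma lt_trans: "x \<sqsubset> y \<Longrightarrow> y \<sqsubset> z \<Longrightarrow> x \<sqsubset> z"
  by (rule axs[THEN conjunct2, THEN conjunct2, THEN conjunct2, THEN conjunct2, THEN conjunct2, THEN conjunct2, THEN conjunct2, THEN conjunct2, THEN conjunct1, rule_format])
lemma lt_irrefl: "\<not> x \<sqsubset> x"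
  by (rule axs[THEN conjunct2, THEN conjunct2, THEN conjunct2, THEN conjunct2, THEN conjunct2, THEN conjunct2, THEN conjunct2, THEN conjunct2, THEN conjunct2, THEN conjunct1, rule_format])
lemma lt_linear: "x \<sqsubset> y \<or> x = y \<or> y \<sqsubset> x"
  by (rule axs[THEN conjunct2, THEN conjunct2, THEN conjunct2, THEN conjunct2, THEN conjunct2, THEN conjunct2, THEN conjunct2, THEN conjunct2, THEN conjunct2, THEN conjunct2, THEN conjunct1, rule_format])
lemma add_lt_mono: "x \<sqsubset> y \<Longrightarrow> x \<oplus> z \<sqsubset> y \<oplus> z"
  by (rule axs[THEN conjunct2, THEN conjunct2, THEN conjunct2, THEN conjunct2, THEN conjunct2, THEN conjunct2, THEN conjunct2, THEN conjunct2, THEN conjunct2, THEN conjunct2, THEN conjunct2, THEN conjunct1, rule_format])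
lemma mult_lt_mono: "\<zero> \<sqsubset> z \<Longrightarrow> x \<sqsubset> y \<Longrightarrow> x \<otimes> z \<sqsubset> y \<otimes> z"
  by (rule axs[THEN conjunct2, THEN conjunct2, THEN conjunct2, THEN conjunct2, THEN conjunct2, THEN conjunct2, THEN conjunct2, THEN conjunct2, THEN conjunct2, THEN conjunct2, THEN conjunct2, THEN conjunct2, THEN conjunct1, rule_format])
lemma lt_diff: "x \<sqsubset> y \<Longrightarrow> \<exists>z. x \<oplus> z = y"
  by (rule axs[THEN conjunct2, THEN conjunct2, THEN conjunct2, THEN conjunct2, THEN conjunct2, THEN conjunct2, THEN conjunct2, THEN conjunct2, THEN conjunct2, THEN conjunct2, THEN conjunct2, THEN conjunct2, THEN conjunct2, THEN conjunct1, rule_format])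
lemma zero_lt_one: "\<zero> \<sqsubset> \<one>"
  by (rule axs[THEN conjunct2, THEN conjunct2, THEN conjunct2, THEN conjunct2, THEN conjunct2, THEN conjunct2, THEN conjunct2, THEN conjunct2, THEN conjunct2, THEN conjunct2, THEN conjunct2, THEN conjunct2, THEN conjunct2, THEN conjunct2, THEN conjunct1, rule_format])
lemma discrete: "\<zero> \<sqsubset> x \<Longrightarrow> \<not> x \<sqsubset> \<one>"
  by (rule axs[THEN conjunct2, THEN conjunct2, THEN conjunct2, THEN conjunct2, THEN conjunct2, THEN conjunct2, THEN conjunct2, THEN conjunct2, THEN conjunct2, THEN conjunct2, THEN conjunct2, THEN conjunct2, THEN conjunct2, THEN conjunct2, THEN conjunct2, THEN conjunct1, rule_format])
lemma not_lt_zero: "\<not> x \<sqsubset> \<zero>"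
  by (rule axs[THEN conjunct2, THEN conjunct2, THEN conjunct2, THEN conjunct2, THEN conjunct2, THEN conjunct2, THEN conjunct2, THEN conjunct2, THEN conjunct2, THEN conjunct2, THEN conjunct2, THEN conjunct2, THEN conjunct2, THEN conjunct2, THEN conjunct2, THEN conjunct2, THEN conjunct1, rule_format])
lemma exp_zero: "\<e> \<zero> = \<one>"
  by (rule axs[THEN conjunct2, THEN conjunct2, THEN conjunct2, THEN conjunct2, THEN conjunct2, THEN conjunct2, THEN conjunct2, THEN conjunct2, THEN conjunct2, THEN conjunct2, THEN conjunct2, THEN conjunct2, THEN conjunct2, THEN conjunct2, THEN conjunct2, THEN conjunct2, THEN conjunct2, THEN conjunct1, rule_format])
lemma exp_suc: "\<e> (x \<oplus> \<one>) = \<e> x \<oplus> \<e> x"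
  by (rule axs[THEN conjunct2, THEN conjunct2, THEN conjunct2, THEN conjunct2, THEN conjunct2, THEN conjunct2, THEN conjunct2, THEN conjunct2, THEN conjunct2, THEN conjunct2, THEN conjunct2, THEN conjunct2, THEN conjunct2, THEN conjunct2, THEN conjunct2, THEN conjunct2, THEN conjunct2, THEN conjunct2, rule_format])

sublocale ord: linorder le lt
  by unfold_locales (use lt_linear lt_irrefl lt_trans in \<open>unfold le_def, blast+\<close>)

lemma add_cancel: "x \<oplus> z = y \<oplus> z \<longleftrightarrow> x = y"
  by (metis add_lt_mono lt_irrefl lt_linear)

lemma add_cancel': "z \<oplus> x = z \<oplus> y \<longleftrightarrow> x = y"
  by (metis add_cancel add_commute)

lemma zero_le: "\<zero> \<sqsubseteq> x"
  by (meson not_lt_zero ord.not_less)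

lemma le_ex: "x \<sqsubseteq> y \<longleftrightarrow> (\<exists>z. x \<oplus> z = y)"
proof
  show "x \<sqsubseteq> y \<Longrightarrow> \<exists>z. x \<oplus> z = y" by (metis le_def lt_diff add_0)
  assume "\<exists>z. x \<oplus> z = y"
  then obtain z where z: "x \<oplus> z = y" by blast
  show "x \<sqsubseteq> y"
  proof (cases "z = \<zero>")
    case False
    then have "\<zero> \<sqsubset> z" using zero_le le_def by metis
    then show ?thesis using z add_lt_mono[of \<zero> z x] by (metis add_0 add_commute le_def)
  qed (use z add_0 in auto)
qed

lemma mns_add: "(x \<oplus> y) \<ominus> y = x"
proof -
  have "y \<sqsubseteq> x \<oplus> y" using le_ex add_commute by metis
  moreover have "(THE z. z \<oplus> y = x \<oplus> y) = x" by (rule the_equality) (auto simp: add_cancel)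
  ultimately show ?thesis by (simp add: mns_def)
qed

lemma mns_zero: "\<not> y \<sqsubseteq> x \<Longrightarrow> x \<ominus> y = \<zero>"
  by (simp add: mns_def)

lemma mns_mns: "x \<ominus> y \<ominus> z = x \<ominus> (y \<oplus> z)"
proof (cases "y \<oplus> z \<sqsubseteq> x")
  case True
  then obtain w where "x = (w \<oplus> z) \<oplus> y" by (metis le_ex add_assoc add_commute)
  then show ?thesis by (metis mns_add add_assoc add_commute)
next
  case False
  show ?thesis
  proof (cases "y \<sqsubseteq> x")
    case True
    then obtain w where w: "x = w \<oplus> y" by (metis le_ex add_commute)
    have "\<not> z \<sqsubseteq> w" using False w by (metis le_ex add_assoc add_commute)
    then show ?thesis using False w by (simp add: mns_add mns_zero)
  next
    case F: False
    then show ?thesis using False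
      by (metis mns_zero le_ex add_commute add_0 mns_add not_lt_zero le_def)
  qed
qed

lemma mult_mns: "x \<otimes> (y \<ominus> z) = x \<otimes> y \<ominus> x \<otimes> z"
proof (cases "z \<sqsubseteq> y")
  case True
  then obtain w where "y = w \<oplus> z" by (metis le_ex add_commute)
  then show ?thesis by (simp add: mns_add distrib_left)
next
  case False
  then have "y \<sqsubset> z" by (simp add: ord.not_le)
  then have "x = \<zero> \<or> x \<otimes> y \<sqsubset> x \<otimes> z"
    using mult_lt_mono[of x y z] zero_le[of x] by (auto simp: le_def mult_commute)
  then show ?thesis using False
    by (metis mns_zero mult_0 mult_commute ord.not_le add_0 mns_add)
qed

sublocale ar: linordered_semidom pls mns le lt \<zero> tms \<one>
proof unfold_locales
  fix a b c
  show "a \<oplus> b \<oplus> c = a \<oplus> (b \<oplus> c)" "a \<otimes> b \<otimes> c = a \<otimes> (b \<otimes> c)" by (simp_all add: add_assoc mult_assoc)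
  show "a \<oplus> b = b \<oplus> a" "a \<otimes> b = b \<otimes> a" by (simp_all add: add_commute mult_commute)
  show "a \<sqsubseteq> b \<Longrightarrow> c \<oplus> a \<sqsubseteq> c \<oplus> b" by (metis le_def add_lt_mono add_commute)
  show "\<zero> \<oplus> a = a" by (metis add_0 add_commute)
  show "\<zero> \<otimes> a = \<zero>" by (metis mult_0 mult_commute)
  show "a \<otimes> \<zero> = \<zero>" by (rule mult_0)
  show "\<one> \<otimes> a = a" by (metis mult_1 mult_commute)
  show "(a \<oplus> b) \<otimes> c = a \<otimes> c \<oplus> b \<otimes> c" by (metis distrib_left mult_commute)
  show "a \<otimes> (b \<oplus> c) = a \<otimes> b \<oplus> a \<otimes> c" by (rule distrib_left)
  show "\<zero> \<noteq> \<one>" using zero_lt_one lt_irrefl by metis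
  show "\<zero> \<sqsubset> \<one>" by (rule zero_lt_one)
  show "(a \<oplus> b) \<ominus> a = b" by (metis mns_add add_commute)
  show "a \<ominus> b \<ominus> c = a \<ominus> (b \<oplus> c)" by (rule mns_mns)
  show "a \<otimes> (b \<ominus> c) = a \<otimes> b \<ominus> a \<otimes> c" by (rule mult_mns)
  show "a \<sqsubset> b \<Longrightarrow> \<zero> \<sqsubset> c \<Longrightarrow> c \<otimes> a \<sqsubset> c \<otimes> b" by (metis mult_lt_mono mult_commute)
  show "a \<noteq> \<zero> \<Longrightarrow> b \<noteq> \<zero> \<Longrightarrow> a \<otimes> b \<noteq> \<zero>"
    by (metis mult_lt_mono mult_0 mult_commute zero_le le_def lt_irrefl)
  show "b \<sqsubseteq> a \<Longrightarrow> a \<ominus> b \<oplus> b = a" by (metis le_ex add_commute mns_add)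
qed

declare ar.one_add_one [simp del]

lemma le_suc_iff: "x \<sqsubseteq> y \<longleftrightarrow> x \<sqsubset> y \<oplus> \<one>"
proof
  show "x \<sqsubseteq> y \<Longrightarrow> x \<sqsubset> y \<oplus> \<one>"
    using ar.less_add_one ord.order.strict_trans1 by metis
  assume "x \<sqsubset> y \<oplus> \<one>"
  show "x \<sqsubseteq> y"
  proof (rule ccontr)
    assume "\<not> x \<sqsubseteq> y"
    then obtain z where z: "y \<oplus> z = x" "z \<noteq> \<zero>" by (metis lt_diff ord.not_le add_0 lt_irrefl)
    then have "\<zero> \<sqsubset> z" using zero_le by (metis le_def)
    then have "\<one> \<sqsubseteq> z" using discrete ord.not_less by blast
    then have "y \<oplus> \<one> \<sqsubseteq> x" using z(1) ar.add_left_mono by metis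
    with \<open>x \<sqsubset> y \<oplus> \<one>\<close> show False by order
  qed
qed

lemma lt_suc_iff: "x \<sqsubset> y \<oplus> \<one> \<longleftrightarrow> x \<sqsubset> y \<or> x = y"
  by (metis le_suc_iff le_def)

lemma suc_le_iff: "x \<oplus> \<one> \<sqsubseteq> y \<longleftrightarrow> x \<sqsubset> y"
  by (metis le_suc_iff ord.not_le)

lemma suc_not_zero [simp]: "x \<oplus> \<one> \<noteq> \<zero>"
  by (metis lt_suc_iff not_lt_zero)

lemma lt_suc [simp]: "x \<sqsubset> x \<oplus> \<one>"
  by (simp add: lt_suc_iff)

declare zero_le [simp] not_lt_zero [simp]

lemma le_add1 [simp]: "x \<sqsubseteq> x \<oplus> y" and le_add2 [simp]: "y \<sqsubseteq> x \<oplus> y"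
  by (metis le_ex add_commute)+

lemmas def_intros = def_tm_var def_tm_const def_tm_plus def_tm_times def_tm_exp def_D0_eq
  def_D0_less def_D0_not def_D0_conj def_D0_disj def_D0_bex def_D0_ball

lemma ind_Sigma1:
  assumes Q: "def_D0 M (\<lambda>v. Q (v 0) (v 1))"
    and zero: "\<exists>y. Q \<zero> y" and suc: "\<And>x y. Q x y \<Longrightarrow> \<exists>y. Q (x \<oplus> \<one>) y"
  shows "\<exists>y. Q x y"
proof -
  have "def_D0 M (\<lambda>v. Q (v 1) (v 0))"
    using def_D0_rename[OF Q, of "\<lambda>i. if i = 0 then 1 else 0"] by simp
  then obtain p e where p: "Delta0 p" "\<And>x y. sat M (push [x, y] e) p = Q y x"
    by (rule def_D0_to_formula[of M "\<lambda>x y. Q y x"]) blast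
  have *: "sat M (push [x] e) (Exists p) \<longleftrightarrow> (\<exists>y. Q x y)" for x
    by (simp add: p(2)[symmetric] push_Cons[of _ "[x]"])
  have "Sigma1 (Exists p)" by (intro Sigma1.intros p)
  then have "\<forall>x. sat M (push [x] e) (Exists p)"
    using model zero suc unfolding model_ISigma1_def * by (metis *)
  then show ?thesis unfolding * by blast
qed

lemma ind_D0:
  assumes "def_D0 M (\<lambda>v. P (v 0))" and "P \<zero>" and "\<And>x. P x \<Longrightarrow> P (x \<oplus> \<one>)"
  shows "P x"
  using ind_Sigma1[of "\<lambda>x y. P x"] assms by auto

lemma exp_add: "\<e> (x \<oplus> y) = \<e> x \<otimes> \<e> y"
proof (induction y rule: ind_D0)
  case 1 show ?case by (intro def_intros)
qed (auto simp: exp_zero exp_suc ar.add.assoc[symmetric] ar.distrib_left)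

lemma exp_gt: "x \<sqsubset> \<e> x"
proof (induction x rule: ind_D0)
  case 1 show ?case by (intro def_intros)
next
  case (3 x)
  then have "x \<oplus> \<one> \<sqsubseteq> \<e> x" by (simp add: suc_le_iff)
  moreover have "\<e> x \<sqsubset> \<e> x \<oplus> \<e> x" using 3 zero_le[of x]
    by (metis ar.less_add_same_cancel1 ord.order.strict_trans1)
  ultimately show ?case by (metis exp_suc ord.order.strict_trans1)
qed (simp add: exp_zero)

lemma exp_pos [simp]: "\<zero> \<sqsubset> \<e> x"
  using exp_gt[of x] zero_le[of x] by order

lemma exp_nonzero [simp]: "\<e> x \<noteq> \<zero>"
  using exp_pos lt_irrefl by metis

lemma exp_lt_suc: "\<e> x \<sqsubset> \<e> (x \<oplus> \<one>)"
  using exp_pos[of x] by (simp add: exp_suc)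

lemma exp_mono: "x \<sqsubseteq> y \<Longrightarrow> \<e> x \<sqsubseteq> \<e> y"
proof -
  assume "x \<sqsubseteq> y"
  then obtain z where "y = x \<oplus> z" by (metis le_ex)
  moreover have "\<one> \<sqsubseteq> \<e> z" using exp_pos[of z] discrete ord.not_less by blast
  ultimately show ?thesis by (metis exp_add ar.mult_left_mono mult_1 zero_le)
qed

lemma division:
  assumes "b \<noteq> \<zero>"
  obtains q r where "x = q \<otimes> b \<oplus> r" "r \<sqsubset> b"
proof -
  \<comment> \<open>The bound on the quotient keeps the induction formula bounded.\<close>
  have "\<exists>q. q \<sqsubset> x \<oplus> \<one> \<and> (\<exists>r. r \<sqsubset> b \<and> x = q \<otimes> b \<oplus> r)"
  proof (induction x rule: ind_D0)
    case 1 show ?case by (intro def_intros)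
  next
    case 2 then show ?case using assms zero_le[of b] by (auto simp: le_def intro!: exI[of _ \<zero>])
  next
    case (3 x)
    then obtain q r where qr: "q \<sqsubset> x \<oplus> \<one>" "r \<sqsubset> b" "x = q \<otimes> b \<oplus> r" by blast
    show ?case
    proof (cases "r \<oplus> \<one> \<sqsubset> b")
      case True
      then show ?thesis using qr by (metis add_assoc lt_suc lt_trans)
    next
      case False
      then have "r \<oplus> \<one> = b" using qr(2) by (metis suc_le_iff le_def)
      then have "x \<oplus> \<one> = (q \<oplus> \<one>) \<otimes> b \<oplus> \<zero>" using qr(3) by (simp add: add_assoc ar.distrib_right)
      moreover have "q \<oplus> \<one> \<sqsubset> x \<oplus> \<one> \<oplus> \<one>" using qr(1) by simp
      ultimately show ?thesis using assms zero_le[of b] by (metis le_def)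
    qed
  qed
  with that show ?thesis by blast
qed

lemma division_unique_aux:
  assumes "q \<otimes> b \<oplus> r = q' \<otimes> b \<oplus> r'" "r \<sqsubset> b"
  shows "q' \<sqsubseteq> q"
proof (rule ccontr)
  assume "\<not> q' \<sqsubseteq> q"
  then have "q \<oplus> \<one> \<sqsubseteq> q'" by (simp add: suc_le_iff ord.not_le)
  then have "(q \<oplus> \<one>) \<otimes> b \<sqsubseteq> q' \<otimes> b" by (simp add: ar.mult_right_mono)
  also have "\<dots> \<sqsubseteq> q \<otimes> b \<oplus> r" by (simp add: assms)
  finally have "b \<sqsubseteq> r" by (simp add: ar.distrib_right)
  with assms(2) show False by order
qed

lemma division_unique:
  assumes "q \<otimes> b \<oplus> r = q' \<otimes> b \<oplus> r'" "r \<sqsubset> b" "r' \<sqsubset> b"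
  shows "q = q' \<and> r = r'"
  using division_unique_aux[OF assms(1,2)] division_unique_aux[OF assms(1)[symmetric] assms(3)] assms
  by (metis add_cancel' ord.order.antisym)

lemma even_odd: obtains k where "q = k \<oplus> k" | k where "q = k \<oplus> k \<oplus> \<one>"
proof -
  have two: "\<e> \<one> = \<one> \<oplus> \<one>" by (metis exp_suc exp_zero ar.add_0_left)
  have "\<e> \<one> \<noteq> \<zero>" by simp
  then obtain k r where "q = k \<otimes> (\<one> \<oplus> \<one>) \<oplus> r" "r \<sqsubset> \<one> \<oplus> \<one>"
    using division[of "\<e> \<one>" q] two by metis
  moreover from this have "r = \<zero> \<or> r = \<one>"
    using discrete zero_le[of r] by (auto simp: lt_suc_iff le_def)
  ultimately show ?thesis using that by (auto simp: distrib_left)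
qed

lemma even_not_odd: "k \<oplus> k \<noteq> l \<oplus> l \<oplus> \<one>"
proof
  assume "k \<oplus> k = l \<oplus> l \<oplus> \<one>"
  then have "k \<otimes> (\<one> \<oplus> \<one>) \<oplus> \<zero> = l \<otimes> (\<one> \<oplus> \<one>) \<oplus> \<one>" by (simp add: distrib_left)
  then have "\<zero> = \<one>" using division_unique[of k "\<one> \<oplus> \<one>" \<zero> l \<one>]
    by (metis lt_suc le_suc_iff zero_le lt_suc_iff)
  then show False by simp
qed

section \<open>Coded sets and pairs\<close>

abbreviation mem (infix "\<epsilon>" 50) where "i \<epsilon> c \<equiv> i \<in> coded_set M c"

lemma mem_iff_odd:
  assumes "c = q \<otimes> \<e> i \<oplus> r" "r \<sqsubset> \<e> i"
  shows "i \<epsilon> c \<longleftrightarrow> (\<exists>k. q = k \<oplus> k \<oplus> \<one>)"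
proof
  assume "i \<epsilon> c"
  then obtain k r' where "r' \<sqsubset> \<e> i" "c = (k \<oplus> k \<oplus> \<one>) \<otimes> \<e> i \<oplus> r'" unfolding coded_set_def by blast
  then have "q = k \<oplus> k \<oplus> \<one>" using assms division_unique[of q "\<e> i" r _ r'] by metis
  then show "\<exists>k. q = k \<oplus> k \<oplus> \<one>" by blast
qed (use assms in \<open>auto simp: coded_set_def\<close>)

text \<open>The summand is a multiple of 2^(j+1); by \<open>exp_split\<close> every 2^i with j < i
  has this form.\<close>

lemma bit_add_even: "j \<epsilon> (c \<oplus> (k \<oplus> k) \<otimes> \<e> j) \<longleftrightarrow> j \<epsilon> c"
proof -
  obtain q r where qr: "c = q \<otimes> \<e> j \<oplus> r" "r \<sqsubset> \<e> j" by (rule division[of "\<e> j" c]) auto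
  have c': "c \<oplus> (k \<oplus> k) \<otimes> \<e> j = (q \<oplus> (k \<oplus> k)) \<otimes> \<e> j \<oplus> r"
    using qr(1) by (simp add: ar.distrib_right ar.add.assoc ar.add.commute ar.add.left_commute)
  show ?thesis
  proof (cases q rule: even_odd)
    case (1 l)
    then have "q \<oplus> (k \<oplus> k) = (l \<oplus> k) \<oplus> (l \<oplus> k)"
      by (simp add: ar.add.assoc ar.add.commute ar.add.left_commute)
    then show ?thesis using mem_iff_odd[OF qr] mem_iff_odd[OF c' qr(2)] 1 even_not_odd by metis
  next
    case (2 l)
    then have "q \<oplus> (k \<oplus> k) = (l \<oplus> k) \<oplus> (l \<oplus> k) \<oplus> \<one>"
      by (simp add: ar.add.assoc ar.add.commute ar.add.left_commute)
    then show ?thesis using mem_iff_odd[OF qr] mem_iff_odd[OF c' qr(2)] 2 by metis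
  qed
qed

lemma exp_le_of_mem: "i \<epsilon> c \<Longrightarrow> \<e> i \<sqsubseteq> c"
proof -
  assume "i \<epsilon> c"
  then obtain q r where "c = (q \<oplus> q \<oplus> \<one>) \<otimes> \<e> i \<oplus> r" unfolding coded_set_def by blast
  then have "c = \<e> i \<oplus> ((q \<oplus> q) \<otimes> \<e> i \<oplus> r)"
    by (simp add: ar.distrib_right ar.add.assoc ar.add.commute ar.add.left_commute)
  then show ?thesis by simp
qed

lemma mem_lt: "i \<epsilon> c \<Longrightarrow> i \<sqsubset> c"
  using exp_le_of_mem exp_gt ord.order.strict_trans2 by metis

lemma zero_lt_suc [simp]: "\<zero> \<sqsubset> x \<oplus> \<one>"
  by (simp add: le_suc_iff[symmetric])

lemma not_mem_zero [simp]: "\<not> i \<epsilon> \<zero>"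
  using mem_lt by fastforce

lemma mem_lt_exp: "i \<epsilon> c \<Longrightarrow> c \<sqsubset> \<e> a \<Longrightarrow> i \<sqsubset> a"
  using exp_le_of_mem[of i c] exp_mono[of a i] ord.not_less by (metis ord.order.strict_trans2 ord.leD)

lemma exp_split: "i \<sqsubset> j \<Longrightarrow> \<exists>k. \<e> j = (k \<oplus> k) \<otimes> \<e> i"
proof -
  assume "i \<sqsubset> j"
  then obtain z where "j = z \<oplus> \<one> \<oplus> i" by (metis suc_le_iff le_ex add_assoc add_commute)
  then have "\<e> j = (\<e> z \<oplus> \<e> z) \<otimes> \<e> i" by (metis exp_add exp_suc)
  then show ?thesis by blast
qed

text \<open>With bit i equal to 0, r is 2k * 2^i + s and 2^j is 2K * 2^i. From k < K follows 2k + 2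
  \<le> 2K, which leaves room for both s and 2^i.\<close>

lemma insert_room:
  assumes "\<not> i \<epsilon> r" "r \<sqsubset> \<e> j" "i \<sqsubset> j"
  shows "r \<oplus> \<e> i \<sqsubset> \<e> j"
proof -
  obtain q s where qs: "r = q \<otimes> \<e> i \<oplus> s" "s \<sqsubset> \<e> i" by (rule division[of "\<e> i" r]) auto
  obtain k where k: "q = k \<oplus> k" using mem_iff_odd[OF qs] assms(1) by (metis even_odd)
  obtain K where K: "\<e> j = (K \<oplus> K) \<otimes> \<e> i" using exp_split[OF assms(3)] by blast
  have "k \<sqsubset> K"
  proof (rule ccontr)
    assume "\<not> k \<sqsubset> K"
    then have "K \<oplus> K \<sqsubseteq> k \<oplus> k" by (simp add: ar.add_mono)
    then have "\<e> j \<sqsubseteq> q \<otimes> \<e> i" unfolding K k by (simp add: ar.mult_right_mono)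
    also have "\<dots> \<sqsubseteq> r" using qs(1) by simp
    finally show False using assms(2) by order
  qed
  then have "(k \<oplus> \<one>) \<oplus> (k \<oplus> \<one>) \<sqsubseteq> K \<oplus> K" by (simp add: suc_le_iff ar.add_mono)
  then have *: "((k \<oplus> \<one>) \<oplus> (k \<oplus> \<one>)) \<otimes> \<e> i \<sqsubseteq> \<e> j" unfolding K by (simp add: ar.mult_right_mono)
  have "r \<oplus> \<e> i = (q \<otimes> \<e> i \<oplus> \<e> i) \<oplus> s"
    using qs(1) by (simp add: ar.add.assoc ar.add.commute ar.add.left_commute)
  also have "\<dots> \<sqsubset> (q \<otimes> \<e> i \<oplus> \<e> i) \<oplus> \<e> i" using qs(2) by simp
  also have "\<dots> = ((k \<oplus> \<one>) \<oplus> (k \<oplus> \<one>)) \<otimes> \<e> i"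
    unfolding k by (simp add: ar.distrib_right ar.add.assoc ar.add.commute ar.add.left_commute)
  finally show ?thesis using * by order
qed

text \<open>Setting a bit that is 0 causes no carry. Below i the summand is an even multiple; above
  i the remainder modulo 2^j absorbs it by \<open>insert_room\<close>.\<close>

lemma mem_insert:
  assumes "\<not> i \<epsilon> c"
  shows "j \<epsilon> (c \<oplus> \<e> i) \<longleftrightarrow> j \<epsilon> c \<or> j = i"
proof (rule ord.linorder_cases[of j i])
  assume "j \<sqsubset> i"
  then show ?thesis using exp_split[of j i] bit_add_even lt_irrefl by metis
next
  assume j: "j = i"
  obtain q r where qr: "c = q \<otimes> \<e> i \<oplus> r" "r \<sqsubset> \<e> i" by (rule division[of "\<e> i" c]) auto
  obtain k where k: "q = k \<oplus> k" using mem_iff_odd[OF qr] assms by (metis even_odd)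
  have "c \<oplus> \<e> i = (k \<oplus> k \<oplus> \<one>) \<otimes> \<e> i \<oplus> r"
    using qr(1) k by (simp add: ar.distrib_right ar.add.assoc ar.add.commute ar.add.left_commute)
  then show ?thesis using mem_iff_odd qr(2) j by blast
next
  assume j: "i \<sqsubset> j"
  obtain q r where qr: "c = q \<otimes> \<e> j \<oplus> r" "r \<sqsubset> \<e> j" by (rule division[of "\<e> j" c]) auto
  obtain k where k: "\<e> j = (k \<oplus> k) \<otimes> \<e> i" using exp_split[OF j] by blast
  have "c = r \<oplus> (q \<otimes> k \<oplus> q \<otimes> k) \<otimes> \<e> i"
    using qr(1) by (simp add: k ar.distrib_left ar.distrib_right ar.mult.assoc add_commute)
  then have "\<not> i \<epsilon> r" using assms bit_add_even by metis
  then have "r \<oplus> \<e> i \<sqsubset> \<e> j" using insert_room qr(2) j by blast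
  moreover have "c \<oplus> \<e> i = q \<otimes> \<e> j \<oplus> (r \<oplus> \<e> i)" using qr(1) by (simp add: add_assoc)
  ultimately have "j \<epsilon> (c \<oplus> \<e> i) \<longleftrightarrow> j \<epsilon> c" using mem_iff_odd[OF qr] mem_iff_odd by metis
  then show ?thesis using j lt_irrefl by metis
qed

definition ins where "ins i c = (if i \<epsilon> c then c else c \<oplus> \<e> i)"

lemma mem_ins [simp]: "j \<epsilon> ins i c \<longleftrightarrow> j = i \<or> j \<epsilon> c"
  using mem_insert[of i c j] by (auto simp: ins_def)

lemma ins_lt_exp: "c \<sqsubset> \<e> a \<Longrightarrow> i \<sqsubset> a \<Longrightarrow> ins i c \<sqsubset> \<e> a"
  by (simp add: ins_def insert_room)

lemma lt_ins: "\<not> i \<epsilon> c \<Longrightarrow> c \<sqsubset> ins i c"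
  by (simp add: ins_def)

lemma mem_singleton [simp]: "j \<epsilon> \<e> i \<longleftrightarrow> j = i"
  using mem_insert[of i \<zero> j] by simp

lemma mem_shift:
  assumes "c = q \<otimes> \<e> b \<oplus> r" "r \<sqsubset> \<e> b"
  shows "(i \<oplus> b) \<epsilon> c \<longleftrightarrow> i \<epsilon> q"
proof -
  obtain Q R where Q: "q = Q \<otimes> \<e> i \<oplus> R" "R \<sqsubset> \<e> i" by (rule division[of "\<e> i" q]) auto
  have c: "c = Q \<otimes> \<e> (i \<oplus> b) \<oplus> (R \<otimes> \<e> b \<oplus> r)"
    using assms(1) Q(1) by (simp add: exp_add ar.distrib_right ar.mult.assoc add_assoc)
  have "R \<otimes> \<e> b \<oplus> r \<sqsubset> R \<otimes> \<e> b \<oplus> \<e> b" using assms(2) by simp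
  also have "\<dots> = (R \<oplus> \<one>) \<otimes> \<e> b" by (simp add: ar.distrib_right)
  also have "\<dots> \<sqsubseteq> \<e> i \<otimes> \<e> b" using Q(2) by (simp add: ar.mult_right_mono suc_le_iff)
  finally have "R \<otimes> \<e> b \<oplus> r \<sqsubset> \<e> (i \<oplus> b)" by (simp add: exp_add)
  then show ?thesis using mem_iff_odd[OF c] mem_iff_odd[OF Q] by simp
qed

text \<open>Induction on a shows that both codes have the same remainder modulo 2^a, since equal
  bits give quotients of equal parity. For a = c + d the remainders are the codes
  themselves.\<close>

lemma code_eqI:
  assumes "\<And>i. i \<epsilon> c \<longleftrightarrow> i \<epsilon> d"
  shows "c = d"
proof -
  have "\<exists>r. r \<sqsubset> \<e> a \<and> (\<exists>q. q \<sqsubset> c \<oplus> \<one> \<and> c = q \<otimes> \<e> a \<oplus> r) \<and> (\<exists>q. q \<sqsubset> d \<oplus> \<one> \<and> d = q \<otimes> \<e> a \<oplus> r)" for a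
  proof (induction a rule: ind_D0)
    case 1 show ?case by (intro def_intros)
  next
    case 2 show ?case by (rule exI[of _ \<zero>]) (auto simp: exp_zero)
  next
    case (3 a)
    then obtain r q q' where r: "r \<sqsubset> \<e> a" "c = q \<otimes> \<e> a \<oplus> r" "d = q' \<otimes> \<e> a \<oplus> r" by blast
    have par: "(\<exists>k. q = k \<oplus> k \<oplus> \<one>) \<longleftrightarrow> (\<exists>k. q' = k \<oplus> k \<oplus> \<one>)"
      using assms[of a] mem_iff_odd[OF r(2,1)] mem_iff_odd[OF r(3,1)] by simp
    have le: "k \<sqsubset> x \<oplus> \<one>" if "x = k \<otimes> \<e> b \<oplus> s" for k x b s
    proof -
      have "\<one> \<sqsubseteq> \<e> b" using exp_pos[of b] discrete ord.not_less by blast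
      then have "k \<otimes> \<one> \<sqsubseteq> k \<otimes> \<e> b" by (intro ar.mult_left_mono) auto
      then have "k \<sqsubseteq> k \<otimes> \<e> b \<oplus> s" using le_add1[of "k \<otimes> \<e> b" s]
        by (metis mult_1 ord.order.trans)
      then show ?thesis using that by (metis le_suc_iff)
    qed
    show ?case
    proof (cases q rule: even_odd)
      case (1 k)
      then obtain k' where k': "q' = k' \<oplus> k'" using par even_not_odd by (metis even_odd)
      have "c = k \<otimes> \<e> (a \<oplus> \<one>) \<oplus> r" "d = k' \<otimes> \<e> (a \<oplus> \<one>) \<oplus> r"
        using r 1 k' by (simp_all add: exp_suc ar.distrib_left ar.distrib_right)
      moreover have "r \<sqsubset> \<e> (a \<oplus> \<one>)" using r(1) exp_lt_suc[of a] by order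
      ultimately show ?thesis using le by blast
    next
      case (2 k)
      then obtain k' where k': "q' = k' \<oplus> k' \<oplus> \<one>" using par by blast
      have "c = k \<otimes> \<e> (a \<oplus> \<one>) \<oplus> (\<e> a \<oplus> r)" "d = k' \<otimes> \<e> (a \<oplus> \<one>) \<oplus> (\<e> a \<oplus> r)"
        using r 2 k' by (simp_all add: exp_suc ar.distrib_left ar.distrib_right add_assoc)
      moreover have "\<e> a \<oplus> r \<sqsubset> \<e> (a \<oplus> \<one>)" using r(1) by (simp add: exp_suc)
      ultimately show ?thesis using le by blast
    qed
  qed
  from this[of "c \<oplus> d"] obtain r q q' where *: "r \<sqsubset> \<e> (c \<oplus> d)"
    "c = q \<otimes> \<e> (c \<oplus> d) \<oplus> r" "d = q' \<otimes> \<e> (c \<oplus> d) \<oplus> r" by blast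
  have "c \<sqsubset> \<e> (c \<oplus> d)" "d \<sqsubset> \<e> (c \<oplus> d)"
    using exp_gt[of "c \<oplus> d"] le_add1[of c d] le_add2[of d c] by order+
  then have "c = r" "d = r"
    using division_unique[of q "\<e> (c \<oplus> d)" r \<zero> c] division_unique[of q' "\<e> (c \<oplus> d)" r \<zero> d] *
    by simp_all
  then show ?thesis by simp
qed

text \<open>Codes compare like binary numbers: the highest differing digit w decides, because the
  quotients by 2^(w+1) agree by \<open>code_eqI\<close>. The growth argument in
  \<open>finite_acts\<close> rests on this.\<close>

lemma code_lessI:
  assumes "\<not> w \<epsilon> c" "w \<epsilon> d" "\<And>i. w \<sqsubset> i \<Longrightarrow> i \<epsilon> c \<longleftrightarrow> i \<epsilon> d"
  shows "c \<sqsubset> d"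
proof -
  obtain q r where qr: "c = q \<otimes> \<e> w \<oplus> r" "r \<sqsubset> \<e> w" by (rule division[of "\<e> w" c]) auto
  obtain q' r' where qr': "d = q' \<otimes> \<e> w \<oplus> r'" "r' \<sqsubset> \<e> w" by (rule division[of "\<e> w" d]) auto
  obtain k where k: "q = k \<oplus> k" using mem_iff_odd[OF qr] assms(1) by (metis even_odd)
  obtain k' where k': "q' = k' \<oplus> k' \<oplus> \<one>" using mem_iff_odd[OF qr'] assms(2) by blast
  have e1: "\<e> \<one> = \<one> \<oplus> \<one>" by (metis exp_suc exp_zero ar.add_0_left)
  have q: "q = k \<otimes> \<e> \<one> \<oplus> \<zero>" "q' = k' \<otimes> \<e> \<one> \<oplus> \<one>" using k k' by (simp_all add: e1 ar.distrib_left)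
  have s: "\<zero> \<sqsubset> \<e> \<one>" "\<one> \<sqsubset> \<e> \<one>" by (simp_all add: e1)
  have "i \<epsilon> k \<longleftrightarrow> i \<epsilon> k'" for i
  proof -
    have "i \<epsilon> k \<longleftrightarrow> (i \<oplus> \<one> \<oplus> w) \<epsilon> c" using mem_shift[OF qr] mem_shift[OF q(1) s(1)] by simp
    moreover have "i \<epsilon> k' \<longleftrightarrow> (i \<oplus> \<one> \<oplus> w) \<epsilon> d" using mem_shift[OF qr'] mem_shift[OF q(2) s(2)] by simp
    moreover have "w \<sqsubset> i \<oplus> \<one> \<oplus> w" by (metis le_add2 le_suc_iff add_assoc add_commute)
    ultimately show ?thesis using assms(3) by blast
  qed
  then have "k = k'" by (rule code_eqI)
  have "c \<sqsubset> q \<otimes> \<e> w \<oplus> \<e> w" using qr by simp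
  also have "\<dots> \<sqsubseteq> d" unfolding qr'(1) k' k \<open>k = k'\<close> by (simp add: ar.distrib_right)
  finally show ?thesis .
qed

text \<open>A pairing that avoids division by two: squares of consecutive sums are far enough apart
  to make it injective. It is not onto, which is why being a pair is sometimes demanded as x =
  \<open>pr (fs x) (sn x)\<close>.\<close>

definition pr where "pr x y = (x \<oplus> y) \<otimes> (x \<oplus> y) \<oplus> x"

lemma le_square: "x \<sqsubseteq> x \<otimes> x"
proof (cases "x = \<zero>")
  case False
  then have "\<one> \<sqsubseteq> x" using discrete zero_le[of x] ord.not_less by (metis le_def)
  then have "x \<otimes> \<one> \<sqsubseteq> x \<otimes> x" by (intro ar.mult_left_mono) auto
  then show ?thesis by simp
qed simp

lemma le_pr [simp]: "x \<sqsubseteq> pr x y" "y \<sqsubseteq> pr x y"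
proof -
  have "y \<sqsubseteq> (x \<oplus> y) \<otimes> (x \<oplus> y)" using le_square[of "x \<oplus> y"] le_add2[of y x] by order
  moreover have "(x \<oplus> y) \<otimes> (x \<oplus> y) \<sqsubseteq> pr x y" by (simp add: pr_def)
  ultimately show "y \<sqsubseteq> pr x y" by order
  show "x \<sqsubseteq> pr x y" by (simp add: pr_def)
qed

lemma pr_mono: "x \<sqsubseteq> x' \<Longrightarrow> y \<sqsubseteq> y' \<Longrightarrow> pr x y \<sqsubseteq> pr x' y'"
  by (simp add: pr_def ar.add_mono ar.mult_mono)

lemma pr_lt_aux:
  assumes "x \<oplus> y \<sqsubset> x' \<oplus> y'"
  shows "pr x y \<sqsubset> pr x' y'"
proof -
  let ?s = "x \<oplus> y"
  have "pr x y \<sqsubseteq> ?s \<otimes> ?s \<oplus> ?s" by (simp add: pr_def)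
  also have "\<dots> \<sqsubset> (?s \<otimes> ?s \<oplus> ?s) \<oplus> (?s \<oplus> \<one>)"
    by (subst ar.less_add_same_cancel1) simp
  also have "\<dots> = (?s \<oplus> \<one>) \<otimes> (?s \<oplus> \<one>)"
    by (simp add: ar.distrib_left ar.distrib_right ar.add.assoc ar.add.commute ar.add.left_commute)
  also have "\<dots> \<sqsubseteq> (x' \<oplus> y') \<otimes> (x' \<oplus> y')" using assms by (intro ar.mult_mono) (simp_all add: suc_le_iff)
  also have "\<dots> \<sqsubseteq> pr x' y'" by (simp add: pr_def)
  finally show ?thesis .
qed

lemma pr_inject [simp]: "pr x y = pr x' y' \<longleftrightarrow> x = x' \<and> y = y'"
proof
  assume eq: "pr x y = pr x' y'"
  then have s: "x \<oplus> y = x' \<oplus> y'" using pr_lt_aux lt_linear lt_irrefl by metis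
  then have "x = x'" using eq by (simp add: pr_def)
  then show "x = x' \<and> y = y'" using s by simp
qed simp

definition fs where "fs w = (if \<exists>x y. w = pr x y then THE x. \<exists>y. w = pr x y else \<zero>)"
definition sn where "sn w = (if \<exists>x y. w = pr x y then THE y. \<exists>x. w = pr x y else \<zero>)"

lemma fs_pr [simp]: "fs (pr x y) = x" and sn_pr [simp]: "sn (pr x y) = y"
  by (auto simp: fs_def sn_def)

lemma pr_cases: obtains x y where "w = pr x y" | "\<And>x y. w \<noteq> pr x y" "fs w = \<zero>" "sn w = \<zero>"
  by (cases "\<exists>x y. w = pr x y") (auto simp: fs_def sn_def)

lemma fs_iff: "y = fs w \<longleftrightarrow> (\<exists>z. z \<sqsubset> w \<oplus> \<one> \<and> w = pr y z) \<or>
    (\<not> (\<exists>x. x \<sqsubset> w \<oplus> \<one> \<and> (\<exists>z. z \<sqsubset> w \<oplus> \<one> \<and> w = pr x z)) \<and> y = \<zero>)"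
  using le_pr by (cases w rule: pr_cases) (auto simp: le_suc_iff[symmetric])

lemma sn_iff: "y = sn w \<longleftrightarrow> (\<exists>z. z \<sqsubset> w \<oplus> \<one> \<and> w = pr z y) \<or>
    (\<not> (\<exists>x. x \<sqsubset> w \<oplus> \<one> \<and> (\<exists>z. z \<sqsubset> w \<oplus> \<one> \<and> w = pr x z)) \<and> y = \<zero>)"
  using le_pr by (cases w rule: pr_cases) (auto simp: le_suc_iff[symmetric])

lemma fs_le [simp]: "fs w \<sqsubseteq> w" and sn_le [simp]: "sn w \<sqsubseteq> w"
  by (cases w rule: pr_cases, auto)+

section \<open>Sigma-1 predicates, total Sigma-1 functions and Delta-1 predicates\<close>

lemma def_D0_imp:
  assumes "def_D0 M P" "def_D0 M Q"
  shows "def_D0 M (\<lambda>v. P v \<longrightarrow> Q v)"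
  using def_D0_disj[OF def_D0_not[OF assms(1)] assms(2)] by simp

text \<open>One unbounded witness over a bounded matrix, and only unary predicates. Relations are
  packed as \<open>P (fs w) (sn w)\<close>, a shape that higher-order unification recovers in the
  closure lemmas.\<close>

definition S1 where
  "S1 P \<longleftrightarrow> (\<exists>Q. def_D0 M (\<lambda>v. Q (v 0) (v 1)) \<and> (\<forall>x. P x \<longleftrightarrow> (\<exists>y. Q x y)))"

text \<open>Terms are not substituted into the opaque relation; instead bounded quantifiers range up
  to their values and equations pin the quantified variables. The shifted hypotheses serve below
  these quantifiers.\<close>

lemma def_D0_subst2:
  assumes Q: "def_D0 M (\<lambda>v. Q (v 0) (v 1))" and f: "def_tm M f" and g: "def_tm M g"
    and f': "def_tm M (\<lambda>v. f (\<lambda>i. v (Suc i)))" and g': "def_tm M (\<lambda>v. g (\<lambda>i. v (Suc i)))"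
    and f'': "def_tm M (\<lambda>v. f (\<lambda>i. v (Suc (Suc i))))" and g'': "def_tm M (\<lambda>v. g (\<lambda>i. v (Suc (Suc i))))"
  shows "def_D0 M (\<lambda>v. Q (f v) (g v))"
proof -
  have "def_D0 M (\<lambda>v. Q (v 1) (v 0))"
    using def_D0_rename[OF Q, of "\<lambda>i. if i = 0 then 1 else 0"] by simp
  then have "def_D0 M (\<lambda>v. \<exists>a. a \<sqsubset> f v \<oplus> \<one> \<and> (\<exists>b. b \<sqsubset> g v \<oplus> \<one> \<and> Q a b \<and> a = f v \<and> b = g v))"
    by (intro def_intros f g f' g' f'' g'') simp
  moreover have "(\<exists>a. a \<sqsubset> f v \<oplus> \<one> \<and> (\<exists>b. b \<sqsubset> g v \<oplus> \<one> \<and> Q a b \<and> a = f v \<and> b = g v)) \<longleftrightarrow> Q (f v) (g v)" for v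
    by auto
  ultimately show ?thesis by simp
qed

lemma S1_D0: "def_D0 M (\<lambda>v. P (v 0)) \<Longrightarrow> S1 P"
  unfolding S1_def by (rule exI[of _ "\<lambda>x y. P x"]) auto

lemma bound_two: "\<exists>z. x \<sqsubset> z \<and> y \<sqsubset> z"
  by (rule exI[of _ "x \<oplus> y \<oplus> \<one>"]) (simp add: le_suc_iff[symmetric])

text \<open>A common strict upper bound replaces the two witnesses, which become bounded.\<close>

lemma S1_I2:
  assumes Q: "def_D0 M (\<lambda>v. Q (v 0) (v 1) (v 2))" and P: "\<And>x. P x \<longleftrightarrow> (\<exists>a b. Q x a b)"
  shows "S1 P"
proof -
  have "def_D0 M (\<lambda>v. \<exists>a. a \<sqsubset> v 1 \<and> (\<exists>b. b \<sqsubset> v 1 \<and> Q (v 0) a b))"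
    using def_D0_rename[OF Q, of "\<lambda>i. if i = 0 then 2 else if i = 1 then 1 else 0"]
    by (intro def_intros) (simp add: numeral_2_eq_2)
  moreover have "P x \<longleftrightarrow> (\<exists>z. \<exists>a. a \<sqsubset> z \<and> (\<exists>b. b \<sqsubset> z \<and> Q x a b))" for x
    unfolding P using bound_two by blast
  ultimately show ?thesis unfolding S1_def
    by (intro exI[of _ "\<lambda>x z. \<exists>a. a \<sqsubset> z \<and> (\<exists>b. b \<sqsubset> z \<and> Q x a b)"]) auto
qed

lemma S1_conj:
  assumes "S1 P" "S1 P'"
  shows "S1 (\<lambda>x. P x \<and> P' x)"
proof -
  obtain Q Q' where Q: "def_D0 M (\<lambda>v. Q (v 0) (v 1))" "\<And>x. P x \<longleftrightarrow> (\<exists>y. Q x y)"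
    and Q': "def_D0 M (\<lambda>v. Q' (v 0) (v 1))" "\<And>x. P' x \<longleftrightarrow> (\<exists>y. Q' x y)"
    using assms unfolding S1_def by blast
  have "def_D0 M (\<lambda>v. Q (v 0) (v 1) \<and> Q' (v 0) (v 2))"
    using def_D0_rename[OF Q'(1), of "\<lambda>i. if i = 0 then 0 else 2"] Q(1) by (intro def_intros) auto
  then show ?thesis by (rule S1_I2[where Q = "\<lambda>x a b. Q x a \<and> Q' x b"]) (simp add: Q(2) Q'(2))
qed

lemma S1_disj:
  assumes "S1 P" "S1 P'"
  shows "S1 (\<lambda>x. P x \<or> P' x)"
proof -
  obtain Q Q' where Q: "def_D0 M (\<lambda>v. Q (v 0) (v 1))" "\<And>x. P x \<longleftrightarrow> (\<exists>y. Q x y)"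
    and Q': "def_D0 M (\<lambda>v. Q' (v 0) (v 1))" "\<And>x. P' x \<longleftrightarrow> (\<exists>y. Q' x y)"
    using assms unfolding S1_def by blast
  have "def_D0 M (\<lambda>v. Q (v 0) (v 1) \<or> Q' (v 0) (v 2))"
    using def_D0_rename[OF Q'(1), of "\<lambda>i. if i = 0 then 0 else 2"] Q(1) by (intro def_intros) auto
  then show ?thesis by (rule S1_I2[where Q = "\<lambda>x a b. Q x a \<or> Q' x b"]) (simp add: Q(2) Q'(2))
qed

lemma def_tm_pr: "def_tm M f \<Longrightarrow> def_tm M g \<Longrightarrow> def_tm M (\<lambda>v. pr (f v) (g v))"
  unfolding pr_def by (intro def_intros)

lemma S1_ex:
  assumes "S1 (\<lambda>w. P (fs w) (sn w))"
  shows "S1 (\<lambda>x. \<exists>y. P x y)"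
proof -
  obtain Q where Q: "def_D0 M (\<lambda>v. Q (v 0) (v 1))" "\<And>w. P (fs w) (sn w) \<longleftrightarrow> (\<exists>y. Q w y)"
    using assms unfolding S1_def by blast
  have "def_D0 M (\<lambda>v. Q (pr (v 0) (v 1)) (v 2))"
    by (rule def_D0_subst2[OF Q(1)]) (intro def_tm_pr def_intros)+
  moreover have "P x y \<longleftrightarrow> (\<exists>z. Q (pr x y) z)" for x y using Q(2)[of "pr x y"] by simp
  ultimately show ?thesis by (intro S1_I2[where Q = "\<lambda>x y. Q (pr x y)"]) auto
qed

lemma ind_S1:
  assumes "S1 P" "P \<zero>" "\<And>x. P x \<Longrightarrow> P (x \<oplus> \<one>)"
  shows "P x"
proof -
  obtain Q where Q: "def_D0 M (\<lambda>v. Q (v 0) (v 1))" "\<And>x. P x \<longleftrightarrow> (\<exists>y. Q x y)"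
    using assms(1) unfolding S1_def by blast
  show ?thesis using ind_Sigma1[OF Q(1)] assms(2,3) unfolding Q(2) by blast
qed

text \<open>A bound z that works for all x < a has a bounded description, so its existence is a
  Sigma_1 statement about a. It passes from a to a + 1 by enlarging z beyond one further
  witness.\<close>

lemma collection:
  assumes "def_D0 M (\<lambda>v. Q (v 0) (v 1))" "\<And>x. x \<sqsubset> b \<Longrightarrow> \<exists>y. Q x y"
  shows "\<exists>z. \<forall>x. x \<sqsubset> b \<longrightarrow> (\<exists>y. y \<sqsubset> z \<and> Q x y)"
proof -
  have "\<exists>z. \<forall>x. x \<sqsubset> a \<longrightarrow> x \<sqsubset> b \<longrightarrow> (\<exists>y. y \<sqsubset> z \<and> Q x y)" for a
  proof (induction a rule: ind_Sigma1)
    case 1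
    have "def_D0 M (\<lambda>v. Q (v 1) (v 0))"
      using def_D0_rename[OF assms(1), of "\<lambda>i. if i = 0 then 1 else 0"] by simp
    then show ?case by (intro def_intros def_D0_imp) simp
  next
    case (3 a z)
    obtain y where y: "a \<sqsubset> b \<longrightarrow> Q a y" using assms(2) by blast
    obtain z' where "z \<sqsubset> z'" "y \<sqsubset> z'" using bound_two by blast
    then show ?case using 3 y unfolding lt_suc_iff by (intro exI[of _ z']) (blast intro: lt_trans)
  qed auto
  from this[of b] show ?thesis by blast
qed

text \<open>Collection pulls the unbounded witness out of the bounded universal quantifier.\<close>

lemma S1_ball_aux:
  assumes "S1 (\<lambda>w. P (fs w) (sn w))"
  shows "S1 (\<lambda>w. \<forall>x. x \<sqsubset> sn w \<longrightarrow> P (fs w) x)"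
proof -
  obtain Q where Q: "def_D0 M (\<lambda>v. Q (v 0) (v 1))" "\<And>w. P (fs w) (sn w) \<longleftrightarrow> (\<exists>y. Q w y)"
    using assms unfolding S1_def by blast
  have P: "P x y \<longleftrightarrow> (\<exists>z. Q (pr x y) z)" for x y using Q(2)[of "pr x y"] by simp
  have *: "(\<forall>x. x \<sqsubset> b \<longrightarrow> P a x) \<longleftrightarrow> (\<exists>z. \<forall>x. x \<sqsubset> b \<longrightarrow> (\<exists>y. y \<sqsubset> z \<and> Q (pr a x) y))" for a b
  proof -
    have "def_D0 M (\<lambda>v. Q (pr a (v 0)) (v 1))"
      by (rule def_D0_subst2[OF Q(1)]) (intro def_tm_pr def_intros)+
    then show ?thesis unfolding P using collection[of "\<lambda>x. Q (pr a x)" b] by blast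
  qed
  let ?R = "\<lambda>w z. \<exists>a. a \<sqsubset> w \<oplus> \<one> \<and> (\<exists>b. b \<sqsubset> w \<oplus> \<one> \<and> a = fs w \<and> b = sn w \<and>
      (\<forall>x. x \<sqsubset> b \<longrightarrow> (\<exists>y. y \<sqsubset> z \<and> Q (pr a x) y)))"
  have "(\<forall>x. x \<sqsubset> sn w \<longrightarrow> P (fs w) x) \<longleftrightarrow> (\<exists>z. ?R w z)" for w
    unfolding * by (simp add: le_suc_iff[symmetric])
  moreover have "def_D0 M (\<lambda>v. ?R (v 0) (v 1))"
  proof -
    have "def_D0 M (\<lambda>v. Q (pr (v 3) (v 1)) (v 0))"
      by (rule def_D0_subst2[OF Q(1)]) (intro def_tm_pr def_intros)+
    then show ?thesis unfolding fs_iff sn_iff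
      by (intro def_intros def_tm_pr) (simp add: numeral_3_eq_3)
  qed
  ultimately show ?thesis unfolding S1_def by (intro exI[of _ ?R]) blast
qed

text \<open>Recursive functions of the model. Totality is built in because f is a HOL function, so
  P(f x) can be written with "some y = f x" and stays Sigma_1.\<close>

definition Fn where "Fn f \<longleftrightarrow> S1 (\<lambda>w. sn w = f (fs w))"

lemma S1_sn: "S1 P \<Longrightarrow> S1 (\<lambda>w. P (sn w))"
proof -
  assume "S1 P"
  then obtain Q where Q: "def_D0 M (\<lambda>v. Q (v 0) (v 1))" "\<And>x. P x \<longleftrightarrow> (\<exists>y. Q x y)"
    unfolding S1_def by blast
  have "def_D0 M (\<lambda>v. Q (v 2) (v 1))"
    using def_D0_rename[OF Q(1), of "\<lambda>i. if i = 0 then 2 else 1"] by simp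
  then have "def_D0 M (\<lambda>v. v 2 = sn (v 0) \<and> Q (v 2) (v 1))"
    unfolding sn_iff by (intro def_intros def_tm_pr)
  then show ?thesis
    by (rule S1_I2[where Q = "\<lambda>w y x. x = sn w \<and> Q x y"]) (auto simp: Q(2))
qed

lemma S1_comp:
  assumes "S1 P" "Fn f"
  shows "S1 (\<lambda>x. P (f x))"
proof -
  have "S1 (\<lambda>w. sn w = f (fs w) \<and> P (sn w))"
    using assms S1_conj S1_sn unfolding Fn_def by blast
  then have "S1 (\<lambda>x. \<exists>y. y = f x \<and> P y)" by (rule S1_ex[where P = "\<lambda>x y. y = f x \<and> P y"])
  then show ?thesis by simp
qed

lemma Fn_D0:
  assumes "def_D0 M (\<lambda>v. v 1 = f (v 0))"
  shows "Fn f"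
proof -
  define G where "G = (\<lambda>x y. y = f x)"
  have "def_D0 M (\<lambda>v. G (v 1) (v 2))"
    using def_D0_rename[OF assms, of Suc] by (simp add: numeral_2_eq_2 G_def)
  then have "def_D0 M (\<lambda>v. v 1 = fs (v 0) \<and> v 2 = sn (v 0) \<and> G (v 1) (v 2))"
    unfolding sn_iff fs_iff by (intro def_intros def_tm_pr)
  then show ?thesis unfolding Fn_def
    by (rule S1_I2[where Q = "\<lambda>w x y. x = fs w \<and> y = sn w \<and> G x y"]) (auto simp: G_def)
qed

lemma Fn_id: "Fn (\<lambda>x. x)"
  by (rule Fn_D0) (intro def_intros)

lemma Fn_const: "Fn (\<lambda>x. c)"
  by (rule Fn_D0) (intro def_intros)

lemma Fn_fs_base: "Fn fs" and Fn_sn_base: "Fn sn"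
  unfolding fs_iff sn_iff by (rule Fn_D0, unfold fs_iff sn_iff, intro def_intros def_tm_pr)+

lemma Fn_exp_base: "Fn two_pow"
  by (rule Fn_D0) (intro def_intros)

lemma Fn_comp:
  assumes "Fn f" "Fn g"
  shows "Fn (\<lambda>x. f (g x))"
proof -
  have "S1 (\<lambda>w. sn w = f (fs w))" using assms(1) by (simp add: Fn_def)
  have "S1 (\<lambda>w. \<exists>z. z = g (fs w) \<and> sn w = f z)"
  proof (rule S1_ex, rule S1_conj)
    have "def_D0 M (\<lambda>v. v 1 = pr (fs (fs (v 0))) (sn (v 0)))"
    proof -
      have *: "y = pr (fs (fs w)) (sn w) \<longleftrightarrow> (\<exists>a. a \<sqsubset> w \<oplus> \<one> \<and> a = fs w \<and>
         (\<exists>b. b \<sqsubset> w \<oplus> \<one> \<and> b = fs a \<and> (\<exists>c. c \<sqsubset> w \<oplus> \<one> \<and> c = sn w \<and> y = pr b c)))" for y w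
        using ord.order.trans[OF fs_le fs_le, of w] by (auto simp: le_suc_iff[symmetric])
      show ?thesis unfolding * unfolding fs_iff sn_iff by (intro def_intros def_tm_pr)
    qed
    then have "Fn (\<lambda>w. pr (fs (fs w)) (sn w))" by (rule Fn_D0)
    from S1_comp[OF assms(2)[unfolded Fn_def] this] show "S1 (\<lambda>w. sn w = g (fs (fs w)))" by simp
    have "def_D0 M (\<lambda>v. v 1 = pr (sn (v 0)) (sn (fs (v 0))))"
    proof -
      have *: "y = pr (sn w) (sn (fs w)) \<longleftrightarrow> (\<exists>a. a \<sqsubset> w \<oplus> \<one> \<and> a = fs w \<and>
         (\<exists>b. b \<sqsubset> w \<oplus> \<one> \<and> b = sn a \<and> (\<exists>c. c \<sqsubset> w \<oplus> \<one> \<and> c = sn w \<and> y = pr c b)))" for y w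
        using ord.order.trans[OF sn_le fs_le, of w] by (auto simp: le_suc_iff[symmetric])
      show ?thesis unfolding * unfolding fs_iff sn_iff by (intro def_intros def_tm_pr)
    qed
    then have "Fn (\<lambda>w. pr (sn w) (sn (fs w)))" by (rule Fn_D0)
    from S1_comp[OF assms(1)[unfolded Fn_def] this] show "S1 (\<lambda>w. sn (fs w) = f (sn w))" by simp
  qed
  then show ?thesis by (simp add: Fn_def)
qed

lemma Fn_fs: "Fn f \<Longrightarrow> Fn (\<lambda>w. fs (f w))" and Fn_sn: "Fn f \<Longrightarrow> Fn (\<lambda>w. sn (f w))"
  and Fn_exp: "Fn f \<Longrightarrow> Fn (\<lambda>w. \<e> (f w))"
  using Fn_comp[OF Fn_fs_base] Fn_comp[OF Fn_sn_base] Fn_comp[OF Fn_exp_base] by blast+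

lemma S1_eq_aux: "Fn f \<Longrightarrow> Fn g \<Longrightarrow> S1 (\<lambda>w. g w = f w)"
proof -
  assume f: "Fn f" and g: "Fn g"
  have "S1 (\<lambda>w. \<exists>y. y = f w \<and> y = g w)"
    by (rule S1_ex, rule S1_conj) (use f g in \<open>simp_all add: Fn_def\<close>)
  then show ?thesis by (simp add: eq_commute)
qed

lemma Fn_pr:
  assumes "Fn f" "Fn g"
  shows "Fn (\<lambda>w. pr (f w) (g w))"
proof -
  have *: "sn w = pr (f (fs w)) (g (fs w)) \<longleftrightarrow>
    (fs (sn w) = f (fs w) \<and> sn (sn w) = g (fs w) \<and> pr (fs (sn w)) (sn (sn w)) = sn w)" for w
    by (metis fs_pr sn_pr)
  have "def_D0 M (\<lambda>v. pr (fs (v 0)) (sn (v 0)) = v 0)"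
  proof -
    have *: "pr (fs w) (sn w) = w \<longleftrightarrow> (\<exists>a. a \<sqsubset> w \<oplus> \<one> \<and> a = fs w \<and>
         (\<exists>b. b \<sqsubset> w \<oplus> \<one> \<and> b = sn w \<and> pr a b = w))" for w
      by (auto simp: le_suc_iff[symmetric])
    show ?thesis unfolding * unfolding fs_iff sn_iff by (intro def_intros def_tm_pr)
  qed
  then have "S1 (\<lambda>w. pr (fs (sn w)) (sn (sn w)) = sn w)"
    using S1_comp[OF S1_D0[of "\<lambda>w. pr (fs w) (sn w) = w"] Fn_sn_base] by simp
  then show ?thesis unfolding Fn_def *
    by (intro S1_conj) (assumption |
        intro S1_eq_aux Fn_comp[OF assms(1)] Fn_comp[OF assms(2)] Fn_fs Fn_sn Fn_id)+
qed

lemma S1_comp2: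
  assumes "S1 (\<lambda>w. R (fs w) (sn w))" "Fn f" "Fn g"
  shows "S1 (\<lambda>w. R (f w) (g w))"
  using S1_comp[OF assms(1) Fn_pr[OF assms(2,3)]] by simp

lemma Fn_comp2:
  assumes "Fn (\<lambda>w. F (fs w) (sn w))" "Fn f" "Fn g"
  shows "Fn (\<lambda>w. F (f w) (g w))"
  using Fn_comp[OF assms(1) Fn_pr[OF assms(2,3)]] by simp

lemma D0_bin:
  assumes "def_D0 M (\<lambda>v. R (v 0) (v 1))"
  shows "S1 (\<lambda>w. R (fs w) (sn w))"
proof -
  have "def_D0 M (\<lambda>v. R (v 1) (v 2))"
    using def_D0_rename[OF assms, of Suc] by (simp add: numeral_2_eq_2)
  then have "def_D0 M (\<lambda>v. v 1 = fs (v 0) \<and> v 2 = sn (v 0) \<and> R (v 1) (v 2))"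
    unfolding sn_iff fs_iff by (intro def_intros def_tm_pr)
  then show ?thesis
    by (rule S1_I2[where Q = "\<lambda>w x y. x = fs w \<and> y = sn w \<and> R x y"]) auto
qed

lemma Fn_bin:
  assumes "def_D0 M (\<lambda>v. v 2 = F (v 0) (v 1))"
  shows "Fn (\<lambda>w. F (fs w) (sn w))"
proof -
  define G where "G = (\<lambda>a b c. c = F a b)"
  have "def_D0 M (\<lambda>v. G (v 1) (v 0) (v 3))"
    using def_D0_rename[OF assms, of "\<lambda>i. if i = 0 then 1 else if i = 1 then 0 else 3"]
    by (simp add: G_def)
  then have "def_D0 M (\<lambda>v. \<exists>a. a \<sqsubset> v 0 \<oplus> \<one> \<and> (\<exists>b. b \<sqsubset> v 0 \<oplus> \<one> \<and> a = fs (v 0) \<and> b = sn (v 0) \<and> G a b (v 1)))"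
    unfolding sn_iff fs_iff by (intro def_intros def_tm_pr) (simp add: numeral_3_eq_3)
  moreover have "(\<exists>a. a \<sqsubset> x \<oplus> \<one> \<and> (\<exists>b. b \<sqsubset> x \<oplus> \<one> \<and> a = fs x \<and> b = sn x \<and> G a b y)) \<longleftrightarrow> y = F (fs x) (sn x)" for x y
    by (auto simp: le_suc_iff[symmetric] G_def)
  ultimately show ?thesis by (intro Fn_D0) simp
qed

lemma Fn_plus: "Fn f \<Longrightarrow> Fn g \<Longrightarrow> Fn (\<lambda>w. f w \<oplus> g w)"
  and Fn_times: "Fn f \<Longrightarrow> Fn g \<Longrightarrow> Fn (\<lambda>w. f w \<otimes> g w)"
  by (rule Fn_comp2[OF Fn_bin, of pls] Fn_comp2[OF Fn_bin, of tms], intro def_intros, assumption+)+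

definition D1 where "D1 P \<longleftrightarrow> S1 P \<and> S1 (\<lambda>x. \<not> P x)"

lemma D1_S1: "D1 P \<Longrightarrow> S1 P" by (simp add: D1_def)

lemma D1_not: "D1 P \<Longrightarrow> D1 (\<lambda>w. \<not> P w)" by (simp add: D1_def)

lemma D1_conj: "D1 P \<Longrightarrow> D1 Q \<Longrightarrow> D1 (\<lambda>w. P w \<and> Q w)"
  by (simp add: D1_def S1_conj S1_disj del: disj_not1)

lemma D1_disj: "D1 P \<Longrightarrow> D1 Q \<Longrightarrow> D1 (\<lambda>w. P w \<or> Q w)"
  by (simp add: D1_def S1_conj S1_disj del: disj_not1)

lemma D1_imp: "D1 P \<Longrightarrow> D1 Q \<Longrightarrow> D1 (\<lambda>w. P w \<longrightarrow> Q w)"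
  using D1_disj[OF D1_not[of P], of Q] by simp

lemma D1_iff: "D1 P \<Longrightarrow> D1 Q \<Longrightarrow> D1 (\<lambda>w. P w \<longleftrightarrow> Q w)"
  unfolding iff_conv_conj_imp by (intro D1_conj D1_imp)

lemma D1_comp2:
  assumes "D1 (\<lambda>w. R (fs w) (sn w))" "Fn f" "Fn g"
  shows "D1 (\<lambda>w. R (f w) (g w))"
  using assms S1_comp2[of R] S1_comp2[of "\<lambda>x y. \<not> R x y"] by (simp add: D1_def)

lemma D1_comp: "D1 P \<Longrightarrow> Fn f \<Longrightarrow> D1 (\<lambda>w. P (f w))"
  using S1_comp[of P f] S1_comp[of "\<lambda>x. \<not> P x" f] by (simp add: D1_def)

lemma D1_bin: "def_D0 M (\<lambda>v. R (v 0) (v 1)) \<Longrightarrow> D1 (\<lambda>w. R (fs w) (sn w))"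
  using D0_bin[of R] D0_bin[of "\<lambda>x y. \<not> R x y"] def_D0_not by (auto simp: D1_def)

lemma D1_eq: "Fn f \<Longrightarrow> Fn g \<Longrightarrow> D1 (\<lambda>w. f w = g w)"
  and D1_lt: "Fn f \<Longrightarrow> Fn g \<Longrightarrow> D1 (\<lambda>w. f w \<sqsubset> g w)"
  and D1_mem: "Fn f \<Longrightarrow> Fn g \<Longrightarrow> D1 (\<lambda>w. f w \<epsilon> g w)"
proof -
  have m: "i \<epsilon> c \<longleftrightarrow> (\<exists>q. q \<sqsubset> c \<and> (\<exists>r. r \<sqsubset> \<e> i \<and> c = (q \<oplus> q \<oplus> \<one>) \<otimes> \<e> i \<oplus> r))" for i c
  proof
    assume "i \<epsilon> c"
    then obtain q r where *: "r \<sqsubset> \<e> i" "c = (q \<oplus> q \<oplus> \<one>) \<otimes> \<e> i \<oplus> r" unfolding coded_set_def by blast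
    have "\<one> \<sqsubseteq> \<e> i" using exp_pos[of i] discrete ord.not_less by blast
    then have "(q \<oplus> q \<oplus> \<one>) \<otimes> \<one> \<sqsubseteq> (q \<oplus> q \<oplus> \<one>) \<otimes> \<e> i" by (intro ar.mult_left_mono) auto
    then have "q \<oplus> q \<oplus> \<one> \<sqsubseteq> c" using *(2) by (metis mult_1 le_add1 ord.order.trans)
    then have "q \<sqsubset> c" by (metis le_add1 suc_le_iff ord.order.strict_trans1)
    then show "\<exists>q. q \<sqsubset> c \<and> (\<exists>r. r \<sqsubset> \<e> i \<and> c = (q \<oplus> q \<oplus> \<one>) \<otimes> \<e> i \<oplus> r)" using * by blast
  qed (auto simp: coded_set_def)
  have "def_D0 M (\<lambda>v. v 0 \<epsilon> v 1)" unfolding m by (intro def_intros)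
  then show "Fn f \<Longrightarrow> Fn g \<Longrightarrow> D1 (\<lambda>w. f w \<epsilon> g w)"
    using D1_comp2[OF D1_bin[of mem], of f g] by blast
  have "def_D0 M (\<lambda>v. v 0 = v 1)" by (intro def_intros)
  then show "Fn f \<Longrightarrow> Fn g \<Longrightarrow> D1 (\<lambda>w. f w = g w)"
    using D1_comp2[OF D1_bin[of "(=)"], of f g] by blast
  have "def_D0 M (\<lambda>v. v 0 \<sqsubset> v 1)" by (intro def_intros)
  then show "Fn f \<Longrightarrow> Fn g \<Longrightarrow> D1 (\<lambda>w. f w \<sqsubset> g w)"
    using D1_comp2[OF D1_bin[of lt], of f g] by blast
qed

lemma D1_le: "Fn f \<Longrightarrow> Fn g \<Longrightarrow> D1 (\<lambda>w. f w \<sqsubseteq> g w)"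
  unfolding le_def by (intro D1_disj D1_lt D1_eq)

lemma D1_const: "D1 (\<lambda>w. B)"
  using D1_eq[OF Fn_const[of \<zero>] Fn_const[of \<zero>]] D1_not[OF D1_eq[OF Fn_const[of \<zero>] Fn_const[of \<zero>]]]
  by (cases B) simp_all

lemma S1_ball:
  assumes "S1 (\<lambda>w. P (fs w) (sn w))" "Fn b"
  shows "S1 (\<lambda>w. \<forall>x. x \<sqsubset> b w \<longrightarrow> P w x)"
  using S1_comp2[OF S1_ball_aux[OF assms(1)] Fn_id assms(2)] .

lemma S1_bex:
  assumes "S1 (\<lambda>w. P (fs w) (sn w))" "Fn b"
  shows "S1 (\<lambda>w. \<exists>x. x \<sqsubset> b w \<and> P w x)"
  by (rule S1_ex, rule S1_conj) (intro D1_S1[OF D1_lt] Fn_sn Fn_id Fn_comp[OF assms(2)] Fn_fs assms(1))+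

lemma D1_ball:
  assumes "D1 (\<lambda>w. P (fs w) (sn w))" "Fn b"
  shows "D1 (\<lambda>w. \<forall>x. x \<sqsubset> b w \<longrightarrow> P w x)"
  using assms S1_ball[of P b] S1_bex[of "\<lambda>x y. \<not> P x y" b] by (simp add: D1_def)

lemma D1_bex:
  assumes "D1 (\<lambda>w. P (fs w) (sn w))" "Fn b"
  shows "D1 (\<lambda>w. \<exists>x. x \<sqsubset> b w \<and> P w x)"
  using assms S1_bex[of P b] S1_ball[of "\<lambda>x y. \<not> P x y" b] by (simp add: D1_def)

lemma D1_ball_mem:
  assumes "D1 (\<lambda>w. P (fs w) (sn w))" "Fn b"
  shows "D1 (\<lambda>w. \<forall>x. x \<epsilon> b w \<longrightarrow> P w x)"
proof -
  have "D1 (\<lambda>w. \<forall>x. x \<sqsubset> b w \<longrightarrow> x \<epsilon> b w \<longrightarrow> P w x)"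
    by (intro D1_ball D1_imp assms D1_mem Fn_sn Fn_id Fn_comp[OF assms(2)] Fn_fs)
  moreover have "(\<forall>x. x \<sqsubset> b w \<longrightarrow> x \<epsilon> b w \<longrightarrow> P w x) \<longleftrightarrow> (\<forall>x. x \<epsilon> b w \<longrightarrow> P w x)" for w
    using mem_lt by blast
  ultimately show ?thesis by simp
qed

lemma S1_ball_mem:
  assumes "S1 (\<lambda>w. P (fs w) (sn w))" "Fn b"
  shows "S1 (\<lambda>w. \<forall>x. x \<epsilon> b w \<longrightarrow> P w x)"
proof -
  have "S1 (\<lambda>w. \<forall>x. x \<sqsubset> b w \<longrightarrow> \<not> x \<epsilon> b w \<or> P w x)"
    by (intro S1_ball S1_disj assms D1_S1[OF D1_not] D1_mem Fn_sn Fn_id Fn_comp[OF assms(2)] Fn_fs)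
  moreover have "(\<forall>x. x \<sqsubset> b w \<longrightarrow> \<not> x \<epsilon> b w \<or> P w x) \<longleftrightarrow> (\<forall>x. x \<epsilon> b w \<longrightarrow> P w x)" for w
    using mem_lt by blast
  ultimately show ?thesis by simp
qed

lemma D1_bex_mem:
  assumes "D1 (\<lambda>w. P (fs w) (sn w))" "Fn b"
  shows "D1 (\<lambda>w. \<exists>x. x \<epsilon> b w \<and> P w x)"
  using D1_not[OF D1_ball_mem[of "\<lambda>w x. \<not> P w x" b]] D1_not[OF assms(1)] assms(2) by simp

lemma Fn_graph: "S1 (\<lambda>w. sn w = f (fs w)) \<Longrightarrow> Fn f"
  by (simp add: Fn_def)

lemma Fn_if:
  assumes "D1 P" "Fn f" "Fn g"
  shows "Fn (\<lambda>w. if P w then f w else g w)"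
proof (rule Fn_graph)
  have *: "sn w = (if P (fs w) then f (fs w) else g (fs w)) \<longleftrightarrow>
    (P (fs w) \<and> sn w = f (fs w)) \<or> (\<not> P (fs w) \<and> sn w = g (fs w))" for w by auto
  show "S1 (\<lambda>w. sn w = (if P (fs w) then f (fs w) else g (fs w)))"
    unfolding * by (intro D1_S1 D1_disj D1_conj D1_not D1_eq D1_comp[OF assms(1)] Fn_comp[OF assms(2)]
        Fn_comp[OF assms(3)] Fn_fs Fn_sn Fn_id)
qed

lemmas Fn_intros = Fn_id Fn_const Fn_fs Fn_sn Fn_exp Fn_pr Fn_plus Fn_times Fn_if
lemmas D1_intros = D1_not D1_conj D1_disj D1_imp D1_iff D1_eq D1_lt D1_le D1_mem D1_const D1_ball D1_bex
  D1_ball_mem D1_bex_mem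

lemma Fn_ins: "Fn f \<Longrightarrow> Fn g \<Longrightarrow> Fn (\<lambda>w. ins (f w) (g w))"
  unfolding ins_def by (intro Fn_intros D1_intros)

section \<open>Consequences of Sigma-1 induction\<close>

text \<open>If every element had a larger one, then "some element is at least i" would be a Sigma_1
  statement that passes from i to i + 1, and the elements would exceed the bound b.\<close>

lemma max_S1:
  assumes "S1 P" "P x" "\<And>x. P x \<Longrightarrow> x \<sqsubset> b"
  shows "\<exists>m. P m \<and> (\<forall>x. P x \<longrightarrow> x \<sqsubseteq> m)"
proof (rule ccontr)
  assume no: "\<not> ?thesis"
  have "\<exists>x. i \<sqsubseteq> x \<and> P x" for i
  proof (induction i rule: ind_S1)
    case 1
    show ?case by (intro S1_ex S1_conj D1_S1[OF D1_le] S1_comp[OF assms(1)] Fn_intros)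
  next
    case (3 i)
    then obtain x where x: "i \<sqsubseteq> x" "P x" by blast
    then obtain y where "P y" "x \<sqsubset> y" using no ord.not_le by blast
    then show ?case using x(1) by (auto simp: suc_le_iff intro!: exI[of _ y])
  qed (use assms(2) in auto)
  from this[of b] assms(3) show False using ord.not_le by blast
qed

text \<open>The least element below a is the one with the greatest distance i from a; this turns the
  least number principle into \<open>max_S1\<close>.\<close>

lemma least_S1:
  assumes "S1 P" "P a"
  shows "\<exists>m. P m \<and> (\<forall>x. P x \<longrightarrow> m \<sqsubseteq> x)"
proof -
  let ?Q = "\<lambda>i. \<exists>x. P x \<and> x \<oplus> i \<sqsubseteq> a"
  have "S1 ?Q" by (intro S1_ex S1_conj D1_S1[OF D1_le] S1_comp[OF assms(1)] Fn_intros)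
  moreover have "?Q \<zero>" using assms(2) by auto
  moreover have "i \<sqsubset> a \<oplus> \<one>" if "?Q i" for i
  proof -
    from that obtain x where "x \<oplus> i \<sqsubseteq> a" by blast
    then have "i \<sqsubseteq> a" using le_add2[of i x] by order
    then show ?thesis by (simp add: le_suc_iff[symmetric])
  qed
  ultimately obtain i x where i: "P x" "x \<oplus> i \<sqsubseteq> a" "\<And>j. ?Q j \<Longrightarrow> j \<sqsubseteq> i" using max_S1[of ?Q \<zero>] by blast
  have "x \<sqsubseteq> y" if "P y" for y
  proof (rule ccontr)
    assume "\<not> x \<sqsubseteq> y"
    then have "y \<oplus> \<one> \<sqsubseteq> x" by (simp add: suc_le_iff ord.not_le)
    from ar.add_right_mono[OF this, of i] have "y \<oplus> \<one> \<oplus> i \<sqsubseteq> a" using i(2) by order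
    then have "y \<oplus> (i \<oplus> \<one>) \<sqsubseteq> a" by (simp add: ar.add.assoc ar.add.commute ar.add.left_commute)
    then show False using i(3)[of "i \<oplus> \<one>"] that by (metis suc_le_iff lt_irrefl)
  qed
  with i(1) show ?thesis by blast
qed

text \<open>Take the largest code below 2^a all of whose elements satisfy P. It misses no element of
  P below a, since inserting one would give a larger code with the same property.\<close>

lemma comprehension:
  assumes "S1 P"
  obtains c where "\<And>x. x \<epsilon> c \<longleftrightarrow> x \<sqsubset> a \<and> P x" "c \<sqsubset> \<e> a"
proof -
  let ?Q = "\<lambda>c. c \<sqsubset> \<e> a \<and> (\<forall>x. x \<epsilon> c \<longrightarrow> P x)"
  have "S1 ?Q" by (intro S1_conj D1_S1[OF D1_lt] S1_ball_mem S1_comp[OF assms(1)] Fn_intros)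
  moreover have "?Q \<zero>" by auto
  ultimately obtain c where c: "?Q c" "\<And>d. ?Q d \<Longrightarrow> d \<sqsubseteq> c" using max_S1[of ?Q \<zero> "\<e> a"] by blast
  have "x \<epsilon> c" if "x \<sqsubset> a" "P x" for x
  proof (rule ccontr)
    assume "\<not> x \<epsilon> c"
    then have "c \<sqsubset> ins x c" by (rule lt_ins)
    moreover have "?Q (ins x c)" using c(1) that by (auto simp: ins_lt_exp)
    ultimately show False using c(2) ord.not_le by blast
  qed
  with c(1) that show ?thesis using mem_lt_exp by blast
qed

lemma collection_S1:
  assumes "S1 (\<lambda>w. P (fs w) (sn w))" "\<And>x. x \<sqsubset> b \<Longrightarrow> \<exists>y. P x y"
  shows "\<exists>z. \<forall>x. x \<sqsubset> b \<longrightarrow> (\<exists>y. y \<sqsubset> z \<and> P x y)"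
proof -
  obtain Q where Q: "def_D0 M (\<lambda>v. Q (v 0) (v 1))" "\<And>w. P (fs w) (sn w) \<longleftrightarrow> (\<exists>y. Q w y)"
    using assms(1) unfolding S1_def by blast
  have P: "P x y \<longleftrightarrow> (\<exists>z. Q (pr x y) z)" for x y using Q(2)[of "pr x y"] by simp
  let ?R = "\<lambda>x z. \<exists>y. y \<sqsubset> z \<and> (\<exists>u. u \<sqsubset> z \<and> Q (pr x y) u)"
  have "def_D0 M (\<lambda>v. Q (pr (v 2) (v 1)) (v 0))"
    by (rule def_D0_subst2[OF Q(1)]) (intro def_tm_pr def_intros)+
  then have "def_D0 M (\<lambda>v. ?R (v 0) (v 1))" by (intro def_intros) (simp add: numeral_2_eq_2)
  moreover have "\<exists>z. ?R x z" if "x \<sqsubset> b" for x using assms(2)[OF that] bound_two unfolding P by blast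
  ultimately obtain z where "\<forall>x. x \<sqsubset> b \<longrightarrow> (\<exists>y. y \<sqsubset> z \<and> ?R x y)" using collection[of ?R b] by blast
  then show ?thesis unfolding P by (blast intro: lt_trans)
qed

lemma Fn_least:
  assumes P: "D1 (\<lambda>w. P (fs w) (sn w))" and b: "Fn b"
  shows "Fn (\<lambda>w. if \<exists>y. y \<sqsubset> b w \<and> P w y then ord.Least (P w) else \<zero>)"
proof (rule Fn_graph)
  have *: "(y = ord.Least Q) \<longleftrightarrow> Q y \<and> (\<forall>z. z \<sqsubset> y \<longrightarrow> \<not> Q z)" if "Q x" "S1 Q" for Q y x
  proof -
    from least_S1[OF that(2,1)] obtain m where "Q m" "\<And>x. Q x \<Longrightarrow> m \<sqsubseteq> x" by blast
    then show ?thesis using ord.Least_equality[of Q] ord.not_le ord.order.antisym by metis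
  qed
  have S: "S1 (P w)" for w using S1_comp2[OF P[THEN D1_S1] Fn_const[of w] Fn_id] .
  have **: "sn w = (if \<exists>y. y \<sqsubset> b (fs w) \<and> P (fs w) y then ord.Least (P (fs w)) else \<zero>) \<longleftrightarrow>
    ((\<exists>y. y \<sqsubset> b (fs w) \<and> P (fs w) y) \<and> P (fs w) (sn w) \<and> (\<forall>z. z \<sqsubset> sn w \<longrightarrow> \<not> P (fs w) z)) \<or>
    (\<not> (\<exists>y. y \<sqsubset> b (fs w) \<and> P (fs w) y) \<and> sn w = \<zero>)" for w
    using *[of "P (fs w)" _ "sn w"] S[of "fs w"] by auto
  show "S1 (\<lambda>w. sn w = (if \<exists>y. y \<sqsubset> b (fs w) \<and> P (fs w) y then ord.Least (P (fs w)) else \<zero>))"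
    unfolding ** by (intro D1_S1) (intro D1_disj D1_conj D1_not D1_bex D1_ball D1_comp2[OF P]
        D1_eq Fn_comp[OF b] Fn_intros)
qed

lemma least_holds:
  assumes "S1 P" "P a"
  shows "P (ord.Least P)"
  using least_S1[OF assms] ord.Least_equality by metis

section \<open>Primitive recursion\<close>

context
  fixes G :: "'a \<Rightarrow> 'a \<Rightarrow> 'a" and c0 :: 'a
begin

text \<open>A computation is an M-finite set of pairs (t, y), each of which is the initial pair or
  follows from another pair in the set. Neither functionality nor closure under initial segments is
  demanded; both come from induction.\<close>

definition rec_ok where
  "rec_ok c \<longleftrightarrow> (\<forall>z. z \<epsilon> c \<longrightarrow> z = pr \<zero> c0 \<or>
     (\<exists>t. t \<sqsubset> c \<and> (\<exists>y. y \<sqsubset> c \<and> pr t y \<epsilon> c \<and> z = pr (t \<oplus> \<one>) (G t y))))"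

definition rec_rel where "rec_rel t y \<longleftrightarrow> (\<exists>c. rec_ok c \<and> pr t y \<epsilon> c)"

definition rec where "rec t = (THE y. rec_rel t y)"

context
  assumes G: "Fn (\<lambda>w. G (fs w) (sn w))"
begin

lemma rec_ok_D1: "D1 rec_ok"
  unfolding rec_ok_def by (intro D1_intros Fn_intros Fn_comp2[OF G])

lemma rec_rel_S1: "S1 (\<lambda>w. rec_rel (fs w) (sn w))"
  unfolding rec_rel_def by (intro S1_ex S1_conj D1_S1[OF D1_mem] D1_S1[OF D1_comp[OF rec_ok_D1]] Fn_intros)

lemma rec_rel_zero: "rec_rel \<zero> c0"
  unfolding rec_rel_def rec_ok_def by (rule exI[of _ "\<e> (pr \<zero> c0)"]) simp

lemma rec_rel_suc:
  assumes "rec_rel t y"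
  shows "rec_rel (t \<oplus> \<one>) (G t y)"
proof -
  from assms obtain c where c: "rec_ok c" "pr t y \<epsilon> c" unfolding rec_rel_def by blast
  let ?d = "ins (pr (t \<oplus> \<one>) (G t y)) c"
  have lt: "c \<sqsubseteq> ?d" by (auto simp: ins_def)
  have "t \<sqsubset> ?d" "y \<sqsubset> ?d" using mem_lt[OF c(2)] le_pr[of t y] le_pr(2)[of y t] lt by order+
  moreover have lt': "u \<sqsubset> ?d" if "u \<sqsubset> c" for u using lt that by order
  ultimately have "rec_ok ?d" unfolding rec_ok_def
  proof (intro allI impI)
    fix z assume "z \<epsilon> ?d"
    then consider "z = pr (t \<oplus> \<one>) (G t y)" | "z = pr \<zero> c0" |
      u x where "u \<sqsubset> c" "x \<sqsubset> c" "pr u x \<epsilon> c" "z = pr (u \<oplus> \<one>) (G u x)"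
      using c(1) unfolding rec_ok_def by (metis mem_ins)
    then show "z = pr \<zero> c0 \<or> (\<exists>t. t \<sqsubset> ?d \<and> (\<exists>y. y \<sqsubset> ?d \<and> pr t y \<epsilon> ?d \<and> z = pr (t \<oplus> \<one>) (G t y)))"
    proof cases
      case 1 then show ?thesis using \<open>t \<sqsubset> ?d\<close> \<open>y \<sqsubset> ?d\<close> c(2) by (metis mem_ins)
    next
      case 3 then show ?thesis using lt' by (metis mem_ins)
    qed simp
  qed
  then show ?thesis unfolding rec_rel_def by (auto intro!: exI[of _ ?d])
qed

lemma rec_rel_inv:
  assumes "rec_rel t y"
  shows "(t = \<zero> \<and> y = c0) \<or> (\<exists>u z. t = u \<oplus> \<one> \<and> y = G u z \<and> rec_rel u z)"
proof -
  from assms obtain c where c: "rec_ok c" "pr t y \<epsilon> c" unfolding rec_rel_def by blast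
  then have "pr t y = pr \<zero> c0 \<or> (\<exists>u z. pr u z \<epsilon> c \<and> pr t y = pr (u \<oplus> \<one>) (G u z))"
    unfolding rec_ok_def by blast
  then show ?thesis using c(1) unfolding pr_inject rec_rel_def by blast
qed

text \<open>Having two values is a Sigma_1 property of t, so there is a least such t; its
  predecessor would have two values as well.\<close>

lemma rec_rel_unique: "rec_rel t y \<Longrightarrow> rec_rel t y' \<Longrightarrow> y = y'"
proof (rule ccontr)
  let ?P = "\<lambda>t. \<exists>y y'. rec_rel t y \<and> rec_rel t y' \<and> \<not> y = y'"
  assume "rec_rel t y" "rec_rel t y'" "\<not> y = y'"
  moreover have "S1 ?P"
    by (intro S1_ex S1_conj S1_comp2[OF rec_rel_S1] D1_S1[OF D1_not[OF D1_eq]] Fn_intros)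
  ultimately obtain m where m: "?P m" "\<And>x. ?P x \<Longrightarrow> m \<sqsubseteq> x" using least_S1[of ?P t] by blast
  then obtain y y' where y: "rec_rel m y" "rec_rel m y'" "y \<noteq> y'" by blast
  obtain u where u: "m = u \<oplus> \<one>" using rec_rel_inv[OF y(1)] rec_rel_inv[OF y(2)] y(3) by blast
  obtain z where z: "y = G u z" "rec_rel u z" using rec_rel_inv[OF y(1)] u by auto
  obtain z' where z': "y' = G u z'" "rec_rel u z'" using rec_rel_inv[OF y(2)] u by auto
  have "?P u" using z z' y(3) by blast
  then show False using m(2) u by (metis suc_le_iff lt_irrefl)
qed

lemma rec_rel_total: "\<exists>y. rec_rel t y"
proof (induction t rule: ind_S1)
  case 1 show ?case by (intro S1_ex rec_rel_S1)
qed (use rec_rel_zero rec_rel_suc in blast)+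

lemma rec_iff: "rec t = y \<longleftrightarrow> rec_rel t y"
  unfolding rec_def by (metis rec_rel_total rec_rel_unique the_equality)

lemma rec_zero: "rec \<zero> = c0" using rec_iff rec_rel_zero by blast

lemma rec_suc: "rec (t \<oplus> \<one>) = G t (rec t)"
  using rec_iff rec_rel_suc by blast

lemma Fn_rec: "Fn rec"
proof (rule Fn_graph)
  have "sn w = rec (fs w) \<longleftrightarrow> rec_rel (fs w) (sn w)" for w using rec_iff by metis
  then show "S1 (\<lambda>w. sn w = rec (fs w))" using rec_rel_S1 by simp
qed

end
end

lemma recursion:
  assumes "Fn (\<lambda>w. G (fs w) (sn w))"
  obtains f where "Fn f" "f \<zero> = c" "\<And>t. f (t \<oplus> \<one>) = G t (f t)"
  using that Fn_rec[OF assms] rec_zero[OF assms] rec_suc[OF assms] by blast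

section \<open>Translation to definable relations\<close>

text \<open>A block of existential quantifiers collapses to one, by a common bound b for the
  witnesses. The renaming skips the slot that b occupies.\<close>

lemma S1_of_formula:
  assumes "Sigma1 p"
  shows "\<exists>q. Delta0 q \<and> (\<forall>v. sat M v p \<longleftrightarrow> (\<exists>y. sat M (push [y] v) q))"
  using assms
proof (induction rule: Sigma1.induct)
  case (1 p)
  have "sat M (push [y] v) (ren_fm Suc p) = sat M v p" for y v by (simp add: sat_ren push_one)
  then show ?case using Delta0_ren[OF 1] by blast
next
  case (2 p)
  then obtain q where q: "Delta0 q" "\<And>v. sat M v p \<longleftrightarrow> (\<exists>y. sat M (push [y] v) q)" by blast
  let ?r = "Exists (Conj (Less (Var 0) (lift_tm (Var 0)))
    (Exists (Conj (Less (Var 0) (lift_tm (Var 1))) (ren_fm (\<lambda>i. if i \<le> 1 then i else Suc i) q))))"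
  have "Delta0 ?r" by (intro Delta0.intros Delta0_ren q(1))
  moreover have "sat M v (Exists p) \<longleftrightarrow> (\<exists>b. sat M (push [b] v) ?r)" for v
  proof -
    have e: "(\<lambda>i. push [y] (push [x] (push [b] v)) (if i \<le> 1 then i else Suc i)) = push [y] (push [x] v)" for x y b
      by (rule ext) (auto simp: push_one split: nat.split)
    have "sat M (push [b] v) ?r \<longleftrightarrow> (\<exists>x. x \<sqsubset> b \<and> (\<exists>y. y \<sqsubset> b \<and> sat M (push [y] (push [x] v)) q))" for b
      by (simp add: sat_ren e[simplified]) (simp add: push_one)
    then show ?thesis using bound_two by (simp add: q(2)) blast
  qed
  ultimately show ?case by blast
qed

lemma ce_iff: "ce M A \<longleftrightarrow> S1 (\<lambda>x. x \<in> A)"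
proof
  assume "ce M A"
  then obtain p e where p: "Sigma1 p" "{[x] |x. x \<in> A} = {xs. length xs = 1 \<and> sat M (push xs e) p}"
    unfolding ce_def Sigma1_definable_def by blast
  have A: "x \<in> A \<longleftrightarrow> sat M (push [x] e) p" for x
    using p(2) by (auto simp: set_eq_iff dest: spec[of _ "[x]"])
  obtain q where q: "Delta0 q" "\<And>v. sat M v p \<longleftrightarrow> (\<exists>y. sat M (push [y] v) q)"
    using S1_of_formula[OF p(1)] by blast
  have "def_D0 M (\<lambda>v. sat M (push [v 1, v 0] e) q)"
    using def_D0_rename[OF def_D0_formula[OF q(1)], of _ "\<lambda>i. if i = 0 then 1 else 0"] by simp
  then show "S1 (\<lambda>x. x \<in> A)" unfolding S1_def A q(2)
    by (intro exI[of _ "\<lambda>x y. sat M (push [y, x] e) q"]) (simp add: push_Cons[of _ "[_]"])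
next
  assume "S1 (\<lambda>x. x \<in> A)"
  then obtain Q where Q: "def_D0 M (\<lambda>v. Q (v 0) (v 1))" "\<And>x. x \<in> A \<longleftrightarrow> (\<exists>y. Q x y)"
    unfolding S1_def by blast
  have "def_D0 M (\<lambda>v. Q (v 1) (v 0))"
    using def_D0_rename[OF Q(1), of "\<lambda>i. if i = 0 then 1 else 0"] by simp
  then obtain p e where p: "Delta0 p" "\<And>x y. sat M (push [x, y] e) p = Q y x"
    by (rule def_D0_to_formula[of M "\<lambda>x y. Q y x"]) blast
  have "sat M (push [x] e) (Exists p) \<longleftrightarrow> x \<in> A" for x
    by (simp add: Q(2) p(2)[symmetric] push_Cons[of _ "[x]"])
  then have "{[x] |x. x \<in> A} = {xs. length xs = 1 \<and> sat M (push xs e) (Exists p)}"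
    by (auto simp: length_Suc_conv)
  moreover have "Sigma1 (Exists p)" by (intro Sigma1.intros p)
  ultimately show "ce M A" unfolding ce_def Sigma1_definable_def by blast
qed

text \<open>The four-place relations of the reducibilities become unary through nested pairs.\<close>

definition quad where "quad p n p' n' = pr (pr p n) (pr p' n')"

lemma quad_inject [simp]: "quad p n p' n' = quad a b c d \<longleftrightarrow> p = a \<and> n = b \<and> p' = c \<and> n' = d"
  by (auto simp: quad_def)

lemma Sigma1_definable_4I:
  assumes "S1 P"
  shows "Sigma1_definable M 4 {[p, n, p', n'] | p n p' n'. P (quad p n p' n')}"
proof -
  obtain Q where Q: "def_D0 M (\<lambda>v. Q (v 0) (v 1))" "\<And>x. P x \<longleftrightarrow> (\<exists>y. Q x y)"
    using assms unfolding S1_def by blast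
  have "def_D0 M (\<lambda>v. Q (quad (v 1) (v 2) (v 3) (v 4)) (v 0))"
    unfolding quad_def by (rule def_D0_subst2[OF Q(1)]) (intro def_tm_pr def_intros)+
  then obtain p e where p: "Delta0 p"
    "\<And>v. sat M (mrg v e) p = Q (quad (v 1) (v 2) (v 3) (v 4)) (v 0)" unfolding def_D0_def by blast
  let ?g = "\<lambda>i::nat. if even i then (if i div 2 \<le> 4 then i div 2 else 0) else i div 2 + 5"
  have e: "(\<lambda>i. push [y] (push [a, b, c, d] e) (?g i)) =
      mrg (\<lambda>i. if i \<le> 4 then [y, a, b, c, d] ! i else y) e" for y a b c d
  proof
    fix i
    have "push [y] (push [a, b, c, d] e) = push [y, a, b, c, d] e" by (rule push_Cons[symmetric])
    then show "push [y] (push [a, b, c, d] e) (?g i) = mrg (\<lambda>i. if i \<le> 4 then [y, a, b, c, d] ! i else y) e i"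
      by (auto simp: mrg_def push_def)
  qed
  define r where "r = Exists (ren_fm ?g p)"
  have "sat M (push [a, b, c, d] e) r \<longleftrightarrow> P (quad a b c d)" for a b c d
    by (simp add: r_def sat_ren e[simplified] p(2) Q(2))
  then have "{[p, n, p', n'] | p n p' n'. P (quad p n p' n')} =
      {xs. length xs = 4 \<and> sat M (push xs e) r}"
    by (auto simp: length_Suc_conv numeral_eq_Suc)
  moreover have "Sigma1 r" unfolding r_def by (intro Sigma1.intros Delta0_ren p)
  ultimately show ?thesis unfolding Sigma1_definable_def by blast
qed

lemma Sigma1_definable_4D:
  assumes "Sigma1_definable M 4 R"
  obtains P where "S1 P" "\<And>p n p' n'. [p, n, p', n'] \<in> R \<longleftrightarrow> P (quad p n p' n')"
proof -
  from assms obtain p e where p: "Sigma1 p" "R = {xs. length xs = 4 \<and> sat M (push xs e) p}"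
    unfolding Sigma1_definable_def by blast
  obtain q where q: "Delta0 q" "\<And>v. sat M v p \<longleftrightarrow> (\<exists>y. sat M (push [y] v) q)"
    using S1_of_formula[OF p(1)] by blast
  let ?g = "\<lambda>i::nat. if i < 5 then 2 * i else 2 * (i - Suc (Suc (Suc (Suc (Suc 0))))) + 1"
  let ?Q = "\<lambda>a b c d y. sat M (push [y, a, b, c, d] e) q"
  have "(\<lambda>i. mrg v e (?g i)) = push [v 0, v 1, v 2, v 3, v 4] e" for v
  proof
    fix i :: nat
    have "i = 0 \<or> i = 1 \<or> i = 2 \<or> i = 3 \<or> i = 4 \<or> \<not> i < 5" by linarith
    then show "mrg v e (?g i) = push [v 0, v 1, v 2, v 3, v 4] e i" by (auto simp: mrg_def push_def)
  qed
  then have "sat M (mrg v e) (ren_fm ?g q) = ?Q (v 1) (v 2) (v 3) (v 4) (v 0)" for v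
    by (simp add: sat_ren)
  then have D: "def_D0 M (\<lambda>v. ?Q (v 1) (v 2) (v 3) (v 4) (v 0))"
    using Delta0_ren[OF q(1)] unfolding def_D0_def by blast
  let ?P = "\<lambda>w y. \<exists>d. d \<sqsubset> w \<oplus> \<one> \<and> (\<exists>c. c \<sqsubset> w \<oplus> \<one> \<and> (\<exists>b. b \<sqsubset> w \<oplus> \<one> \<and> (\<exists>a. a \<sqsubset> w \<oplus> \<one> \<and>
      w = quad a b c d \<and> ?Q a b c d y)))"
  have "def_D0 M (\<lambda>v. ?P (v 0) (v 1))"
    using def_D0_rename[OF D, of "\<lambda>i. if i = 0 then 5 else i - 1"] unfolding quad_def
    by (intro def_intros def_tm_pr) (simp add: numeral_eq_Suc)
  then have "S1 (\<lambda>w. \<exists>y. ?P w y)" unfolding S1_def by (intro exI[of _ ?P]) auto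
  moreover have "[a, b, c, d] \<in> R \<longleftrightarrow> (\<exists>y. ?P (quad a b c d) y)" for a b c d
  proof -
    have "a \<sqsubseteq> pr a b" "b \<sqsubseteq> pr a b" "pr a b \<sqsubseteq> quad a b c d" "c \<sqsubseteq> pr c d" "d \<sqsubseteq> pr c d" "pr c d \<sqsubseteq> quad a b c d"
      unfolding quad_def by (rule le_pr)+
    then have "a \<sqsubset> quad a b c d \<oplus> \<one>" "b \<sqsubset> quad a b c d \<oplus> \<one>" "c \<sqsubset> quad a b c d \<oplus> \<one>" "d \<sqsubset> quad a b c d \<oplus> \<one>"
      unfolding le_suc_iff[symmetric] by order+
    then show ?thesis unfolding p(2) by (auto simp: q(2) push_Cons[of _ "[a, b, c, d]"])
  qed
  ultimately show ?thesis using that by blast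
qed

end

section \<open>A universal Sigma-1 set\<close>

text \<open>A programming language rich enough for characteristic functions of bounded formulas:
  parameters of the model are constants, and bounded search is the only loop. Programs have standard
  length, while their codes live in the model.\<close>

datatype 'a prog = PFst | PSnd | PCst 'a | PPair "'a prog" "'a prog" | PComp "'a prog" "'a prog"
  | PAdd | PMul | PExp | PLt | PBex "'a prog" "'a prog"

context isigma1
begin

primrec run :: "'a prog \<Rightarrow> 'a \<Rightarrow> 'a" where
  "run PFst x = fs x"
| "run PSnd x = sn x"
| "run (PCst c) x = c"
| "run (PPair p q) x = pr (run p x) (run q x)"
| "run (PComp p q) x = run p (run q x)"
| "run PAdd x = fs x \<oplus> sn x"
| "run PMul x = fs x \<otimes> sn x"
| "run PExp x = \<e> (fs x)"
| "run PLt x = (if fs x \<sqsubset> sn x then \<one> else \<zero>)"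
| "run (PBex p q) x = (if \<exists>y. y \<sqsubset> run p x \<and> run q (pr x y) = \<one> then \<one> else \<zero>)"

primrec num :: "nat \<Rightarrow> 'a" where
  "num 0 = \<zero>"
| "num (Suc n) = num n \<oplus> \<one>"

lemma num_inject [simp]: "num m = num n \<longleftrightarrow> m = n"
proof (induction m arbitrary: n)
  case 0 show ?case by (cases n) (auto dest: sym)
next
  case (Suc m) then show ?case by (cases n) auto
qed

declare num.simps [simp del]

primrec code :: "'a prog \<Rightarrow> 'a" where
  "code PFst = pr (num 0) \<zero>"
| "code PSnd = pr (num 1) \<zero>"
| "code (PCst c) = pr (num 2) c"
| "code (PPair p q) = pr (num 3) (pr (code p) (code q))"
| "code (PComp p q) = pr (num 4) (pr (code p) (code q))"
| "code PAdd = pr (num 5) \<zero>"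
| "code PMul = pr (num 6) \<zero>"
| "code PExp = pr (num 7) \<zero>"
| "code PLt = pr (num 8) \<zero>"
| "code (PBex p q) = pr (num 9) (pr (code p) (code q))"

definition val_in where "val_in c e x y \<longleftrightarrow> pr e (pr x y) \<epsilon> c"

text \<open>Coded sets all of whose values are justified by other values in the set replace a recursion on
  codes inside the model; only codes of actual programs matter, so that correctness is an induction
  on programs outside the model.\<close>

definition justified where
  "justified c e x y \<longleftrightarrow>
    fs e = num 0 \<and> y = fs x \<or> fs e = num 1 \<and> y = sn x \<or> fs e = num 2 \<and> y = sn e \<or>
    fs e = num 3 \<and> (\<exists>a. a \<sqsubset> c \<and> (\<exists>b. b \<sqsubset> c \<and>
      val_in c (fs (sn e)) x a \<and> val_in c (sn (sn e)) x b \<and> y = pr a b)) \<or>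
    fs e = num 4 \<and> (\<exists>a. a \<sqsubset> c \<and> val_in c (sn (sn e)) x a \<and> val_in c (fs (sn e)) a y) \<or>
    fs e = num 5 \<and> y = fs x \<oplus> sn x \<or> fs e = num 6 \<and> y = fs x \<otimes> sn x \<or>
    fs e = num 7 \<and> y = \<e> (fs x) \<or> fs e = num 8 \<and> y = (if fs x \<sqsubset> sn x then \<one> else \<zero>) \<or>
    fs e = num 9 \<and> (\<exists>a. a \<sqsubset> c \<and> val_in c (fs (sn e)) x a \<and>
      (y = \<one> \<and> (\<exists>z. z \<sqsubset> a \<and> val_in c (sn (sn e)) (pr x z) \<one>) \<or>
       y = \<zero> \<and> (\<forall>z. z \<sqsubset> a \<longrightarrow> (\<exists>v. v \<sqsubset> c \<and> v \<noteq> \<one> \<and> val_in c (sn (sn e)) (pr x z) v))))"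

definition evaluation where
  "evaluation c \<longleftrightarrow> (\<forall>z. z \<epsilon> c \<longrightarrow> justified c (fs z) (fs (sn z)) (sn (sn z)))"

lemma val_in_lt: "val_in c e x y \<Longrightarrow> y \<sqsubset> c"
proof -
  assume "val_in c e x y"
  then have "pr e (pr x y) \<sqsubset> c" by (simp add: val_in_def mem_lt)
  then show ?thesis using le_pr(2)[of "pr x y" e] le_pr(2)[of y x] by order
qed

text \<open>The bounds in \<open>justified\<close> make it Delta_1; they hold automatically because
  the values recorded in a coded set are below its code.\<close>

lemma justified_iff:
  "justified c e x y \<longleftrightarrow>
    fs e = num 0 \<and> y = fs x \<or> fs e = num 1 \<and> y = sn x \<or> fs e = num 2 \<and> y = sn e \<or>
    fs e = num 3 \<and> (\<exists>a b. val_in c (fs (sn e)) x a \<and> val_in c (sn (sn e)) x b \<and> y = pr a b) \<or>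
    fs e = num 4 \<and> (\<exists>a. val_in c (sn (sn e)) x a \<and> val_in c (fs (sn e)) a y) \<or>
    fs e = num 5 \<and> y = fs x \<oplus> sn x \<or> fs e = num 6 \<and> y = fs x \<otimes> sn x \<or>
    fs e = num 7 \<and> y = \<e> (fs x) \<or> fs e = num 8 \<and> y = (if fs x \<sqsubset> sn x then \<one> else \<zero>) \<or>
    fs e = num 9 \<and> (\<exists>a. val_in c (fs (sn e)) x a \<and>
      (y = \<one> \<and> (\<exists>z. z \<sqsubset> a \<and> val_in c (sn (sn e)) (pr x z) \<one>) \<or>
       y = \<zero> \<and> (\<forall>z. z \<sqsubset> a \<longrightarrow> (\<exists>v. v \<noteq> \<one> \<and> val_in c (sn (sn e)) (pr x z) v))))"
proof -
  have *: "(\<exists>a. a \<sqsubset> c \<and> P a \<and> val_in c e' x' a) \<longleftrightarrow> (\<exists>a. P a \<and> val_in c e' x' a)"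
    "(\<exists>a. a \<sqsubset> c \<and> val_in c e' x' a \<and> P a) \<longleftrightarrow> (\<exists>a. val_in c e' x' a \<and> P a)"
    "(\<exists>b. b \<sqsubset> c \<and> R \<and> val_in c e' x' b \<and> P b) \<longleftrightarrow> (\<exists>b. R \<and> val_in c e' x' b \<and> P b)" for P R e' x'
    using val_in_lt by blast+
  have **: "(\<exists>a. a \<sqsubset> c \<and> (\<exists>b. val_in c e1 x a \<and> Q a b)) \<longleftrightarrow> (\<exists>a b. val_in c e1 x a \<and> Q a b)" for e1 Q
    using val_in_lt by blast
  show ?thesis unfolding justified_def * ** ..
qed

text \<open>\<open>val_in\<close> occurs only positively: a failed bounded search is witnessed by
  recorded values different from 1 and not by the absence of the value 1.\<close>

lemma justified_mono:
  assumes "justified c e x y" "\<And>z. z \<epsilon> c \<Longrightarrow> z \<epsilon> d"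
  shows "justified d e x y"
proof -
  have v: "val_in c e' x' y' \<longrightarrow> val_in d e' x' y'" for e' x' y' using assms(2) by (simp add: val_in_def)
  have "justified c e x y \<longrightarrow> justified d e x y" unfolding justified_iff
    by (rule imp_refl v disj_mono conj_mono ex_mono all_mono imp_mono)+
  then show ?thesis using assms(1) by blast
qed

lemma evaluation_D1: "D1 evaluation"
  unfolding evaluation_def justified_def val_in_def by (intro D1_intros Fn_intros)

lemma evaluation_sound:
  assumes "evaluation c"
  shows "val_in c (code p) x y \<Longrightarrow> y = run p x"
proof (induction p arbitrary: x y)
  case (PBex p q)
  have "justified c (code (PBex p q)) x y"
    using assms PBex.prems unfolding evaluation_def val_in_def by fastforce
  then show ?case using PBex.IH by (auto simp: justified_iff)
qed (use assms in \<open>(fastforce simp: evaluation_def val_in_def justified_iff)+\<close>)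

lemma evaluation_insert:
  assumes "evaluation c" "justified c e x y"
  shows "\<exists>d. evaluation d \<and> val_in d e x y"
proof -
  let ?d = "ins (pr e (pr x y)) c"
  have "evaluation ?d" unfolding evaluation_def
  proof (intro allI impI)
    fix z assume "z \<epsilon> ?d"
    then show "justified ?d (fs z) (fs (sn z)) (sn (sn z))"
      using assms justified_mono[of c _ _ _ ?d] unfolding evaluation_def by auto
  qed
  then show ?thesis unfolding val_in_def by (auto intro!: exI[of _ ?d])
qed

lemma evaluation_Union:
  assumes "S1 P" "\<And>c. P c \<Longrightarrow> evaluation c" "\<And>c. P c \<Longrightarrow> c \<sqsubset> b"
  shows "\<exists>d. evaluation d \<and> (\<forall>c z. P c \<longrightarrow> z \<epsilon> c \<longrightarrow> z \<epsilon> d)"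
proof -
  have "S1 (\<lambda>z. \<exists>c. P c \<and> z \<epsilon> c)" by (intro S1_ex S1_conj S1_comp[OF assms(1)] D1_S1[OF D1_mem] Fn_intros)
  then obtain d where d: "\<And>z. z \<epsilon> d \<longleftrightarrow> z \<sqsubset> b \<and> (\<exists>c. P c \<and> z \<epsilon> c)" by (rule comprehension[of _ b]) blast
  have sub: "z \<epsilon> d" if "P c" "z \<epsilon> c" for z c using d that assms(3) mem_lt lt_trans by blast
  have "evaluation d" unfolding evaluation_def
  proof (intro allI impI)
    fix z assume "z \<epsilon> d"
    then obtain c where c: "P c" "z \<epsilon> c" using d by blast
    then have "justified c (fs z) (fs (sn z)) (sn (sn z))" using assms(2) unfolding evaluation_def by blast
    then show "justified d (fs z) (fs (sn z)) (sn (sn z))" using sub[OF c(1)] justified_mono by blast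
  qed
  then show ?thesis using sub by blast
qed

lemma evaluation_Un:
  assumes "evaluation c" "evaluation d"
  shows "\<exists>u. evaluation u \<and> (\<forall>z. z \<epsilon> c \<or> z \<epsilon> d \<longrightarrow> z \<epsilon> u)"
proof -
  obtain b where "c \<sqsubset> b" "d \<sqsubset> b" using bound_two by blast
  moreover have "S1 (\<lambda>z. z = c \<or> z = d)" by (intro D1_S1 D1_intros Fn_intros)
  ultimately show ?thesis using evaluation_Union[of "\<lambda>z. z = c \<or> z = d" b] assms by blast
qed

lemma evaluation_complete: "\<exists>c. evaluation c \<and> val_in c (code p) x (run p x)"
proof (induction p arbitrary: x)
  case (PPair p q)
  obtain c d where "evaluation c" "val_in c (code p) x (run p x)" "evaluation d" "val_in d (code q) x (run q x)"
    using PPair by blast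
  moreover from this obtain u where "evaluation u" "\<forall>z. z \<epsilon> c \<or> z \<epsilon> d \<longrightarrow> z \<epsilon> u" using evaluation_Un by blast
  ultimately show ?case by (intro evaluation_insert[of u]) (auto simp: justified_iff val_in_def)
next
  case (PComp p q)
  obtain c d where "evaluation c" "val_in c (code p) (run q x) (run p (run q x))"
    "evaluation d" "val_in d (code q) x (run q x)" using PComp by blast
  moreover from this obtain u where "evaluation u" "\<forall>z. z \<epsilon> c \<or> z \<epsilon> d \<longrightarrow> z \<epsilon> u" using evaluation_Un by blast
  ultimately show ?case by (intro evaluation_insert[of u]) (auto simp: justified_iff val_in_def)
next
  case (PBex p q)
  obtain c where c: "evaluation c" "val_in c (code p) x (run p x)" using PBex by blast
  let ?P = "\<lambda>w d. evaluation d \<and> (\<exists>v. v \<sqsubset> d \<and> val_in d (code q) (pr x w) v)"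
  have "S1 (\<lambda>u. ?P (fs u) (sn u))" unfolding val_in_def
    by (intro D1_S1) (intro D1_intros D1_comp[OF evaluation_D1] Fn_intros)
  moreover have "\<exists>d. ?P w d" if "w \<sqsubset> run p x" for w using PBex(2) val_in_lt by blast
  \<comment> \<open>Each argument of the search has its own evaluation. Collection puts all of them
    below one b, and the union of all evaluations below b contains them; soundness then identifies
    the recorded values.\<close>
  ultimately obtain b where b: "\<And>w. w \<sqsubset> run p x \<Longrightarrow> \<exists>d. d \<sqsubset> b \<and> ?P w d" using collection_S1[of ?P "run p x"] by blast
  have "S1 (\<lambda>d. d \<sqsubset> b \<and> evaluation d)"
    by (intro D1_S1) (intro D1_intros D1_comp[OF evaluation_D1] Fn_intros)
  then obtain d where d: "evaluation d" "\<And>c z. c \<sqsubset> b \<Longrightarrow> evaluation c \<Longrightarrow> z \<epsilon> c \<Longrightarrow> z \<epsilon> d"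
    using evaluation_Union[of "\<lambda>d. d \<sqsubset> b \<and> evaluation d" b] by blast
  obtain u where u: "evaluation u" "\<forall>z. z \<epsilon> c \<or> z \<epsilon> d \<longrightarrow> z \<epsilon> u" using evaluation_Un c(1) d(1) by blast
  have q: "val_in u (code q) (pr x w) (run q (pr x w))" if w: "w \<sqsubset> run p x" for w
  proof -
    obtain e v where "e \<sqsubset> b" "evaluation e" "val_in e (code q) (pr x w) v" using b[OF w] by blast
    then show ?thesis using evaluation_sound[of e q "pr x w" v] u(2) d(2) unfolding val_in_def by blast
  qed
  have "val_in u (code p) x (run p x)" using c(2) u(2) by (simp add: val_in_def)
  then have "justified u (code (PBex p q)) x (run (PBex p q) x)" using q by (force simp: justified_iff)
  then show ?case using evaluation_insert u(1) by blast
qed (rule evaluation_insert[of \<zero>], simp add: evaluation_def, simp add: justified_iff)+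

definition eval_rel where "eval_rel e x y \<longleftrightarrow> (\<exists>c. evaluation c \<and> val_in c e x y)"

lemma eval_rel_code: "eval_rel (code p) x y \<longleftrightarrow> y = run p x"
  unfolding eval_rel_def using evaluation_sound evaluation_complete by blast

definition univ where "univ e x \<longleftrightarrow> (\<exists>y. eval_rel e (pr x y) \<one>)"

lemma univ_S1: "S1 (\<lambda>w. univ (fs w) (sn w))"
  unfolding univ_def eval_rel_def val_in_def
  by (intro S1_ex S1_conj D1_S1[OF D1_comp[OF evaluation_D1]] D1_S1[OF D1_mem] Fn_intros)

primrec tr_tm :: "(nat \<Rightarrow> 'a prog) \<Rightarrow> tm \<Rightarrow> 'a prog" where
  "tr_tm r (Var i) = r i"
| "tr_tm r Zero = PCst \<zero>"
| "tr_tm r One = PCst \<one>"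
| "tr_tm r (Plus s t) = PComp PAdd (PPair (tr_tm r s) (tr_tm r t))"
| "tr_tm r (Times s t) = PComp PMul (PPair (tr_tm r s) (tr_tm r t))"
| "tr_tm r (Expo t) = PComp PExp (PPair (tr_tm r t) (tr_tm r t))"

lemma run_tr_tm: "run (tr_tm r t) x = tm_val M (\<lambda>i. run (r i) x) t"
  by (induction t) auto

text \<open>Programs take a single argument, so \<open>r\<close> says how to compute each variable
  from it. Below a quantifier the argument becomes a pair whose second component is the new
  variable.\<close>

lemma Delta0_prog:
  "Delta0 p \<Longrightarrow> \<exists>q. \<forall>x. run q x = (if sat M (\<lambda>i. run (r i) x) p then \<one> else \<zero>)"
proof (induction arbitrary: r rule: Delta0.induct)
  case (1 s t)
  let ?n = "\<lambda>q. PComp PLt (PPair q (PCst \<one>))" and ?l = "\<lambda>s t. PComp PLt (PPair (tr_tm r s) (tr_tm r t))"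
  show ?case
    by (rule exI[of _ "PComp PMul (PPair (?n (?l s t)) (?n (?l t s)))"])
      (use lt_linear in \<open>auto simp: run_tr_tm zero_lt_one\<close>)
next
  case (2 s t)
  show ?case by (rule exI[of _ "PComp PLt (PPair (tr_tm r s) (tr_tm r t))"]) (simp add: run_tr_tm)
next
  case (3 p)
  then obtain q where "\<forall>x. run q x = (if sat M (\<lambda>i. run (r i) x) p then \<one> else \<zero>)" by blast
  then show ?case by (intro exI[of _ "PComp PLt (PPair q (PCst \<one>))"]) (simp add: zero_lt_one)
next
  case (4 p p')
  from "4.IH"(1)[of r] obtain q where "\<forall>x. run q x = (if sat M (\<lambda>i. run (r i) x) p then \<one> else \<zero>)"
    by blast
  moreover from "4.IH"(2)[of r] obtain q' where
    "\<forall>x. run q' x = (if sat M (\<lambda>i. run (r i) x) p' then \<one> else \<zero>)" by blast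
  ultimately show ?case by (intro exI[of _ "PComp PMul (PPair q q')"]) simp
next
  case (5 p t)
  let ?r = "\<lambda>i. case i of 0 \<Rightarrow> PSnd | Suc j \<Rightarrow> PComp (r j) PFst"
  have r: "(\<lambda>i. run (?r i) (pr x y)) = push [y] (\<lambda>i. run (r i) x)" for x y
    by (rule ext) (auto simp: push_one split: nat.split)
  obtain q where q: "\<And>x. run q x = (if sat M (\<lambda>i. run (?r i) x) p then \<one> else \<zero>)"
    using 5(2)[of ?r] by blast
  show ?case
    by (rule exI[of _ "PBex (tr_tm r t) q"]) (simp add: run_tr_tm q r tm_val_lift push_one, blast)
qed

lemma univ_universal:
  assumes "S1 P"
  shows "\<exists>e. \<forall>x. P x \<longleftrightarrow> univ e x"
proof -
  obtain Q where Q: "def_D0 M (\<lambda>v. Q (v 0) (v 1))" "\<And>x. P x \<longleftrightarrow> (\<exists>y. Q x y)"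
    using assms unfolding S1_def by blast
  obtain p e where p: "Delta0 p" "\<And>x y. sat M (push [x, y] e) p = Q x y"
    using def_D0_to_formula[OF Q(1)] by blast
  let ?r = "\<lambda>i. if i = 0 then PFst else if i = 1 then PSnd else PCst (e (i - 2))"
  have r: "(\<lambda>i. run (?r i) (pr x y)) = push [x, y] e" for x y
    by (rule ext) (auto simp: push_def nth_Cons numeral_2_eq_2 split: nat.split)
  obtain q where q: "\<And>x. run q x = (if sat M (\<lambda>i. run (?r i) x) p then \<one> else \<zero>)"
    using Delta0_prog[OF p(1), of ?r] by blast
  have "run q (pr x y) = \<one> \<longleftrightarrow> Q x y" for x y unfolding q r p(2) by simp
  then have "P x \<longleftrightarrow> univ (code q) x" for x unfolding univ_def eval_rel_code Q(2) by metis
  then show ?thesis by blast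
qed

lemma ex_enumeration:
  "\<exists>W. D1 (\<lambda>w. W (fs w) (fs (sn w)) (sn (sn w))) \<and> (\<forall>s e x. W s e x \<longrightarrow> x \<sqsubset> s) \<and>
     (\<forall>s t e x. s \<sqsubseteq> t \<longrightarrow> W s e x \<longrightarrow> W t e x) \<and> (\<forall>P. S1 P \<longrightarrow> (\<exists>e. \<forall>x. P x \<longleftrightarrow> (\<exists>s. W s e x)))"
proof -
  obtain T where T: "def_D0 M (\<lambda>v. T (v 0) (v 1))" "\<And>w. univ (fs w) (sn w) \<longleftrightarrow> (\<exists>y. T w y)"
    using univ_S1 unfolding S1_def by blast
  have U: "univ e x \<longleftrightarrow> (\<exists>y. T (pr e x) y)" for e x using T(2)[of "pr e x"] by simp
  let ?W = "\<lambda>s e x. x \<sqsubset> s \<and> (\<exists>y. y \<sqsubset> s \<and> T (pr e x) y)"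
  have "D1 (\<lambda>w. ?W (fs w) (fs (sn w)) (sn (sn w)))"
    by (intro D1_conj D1_lt D1_bex D1_comp2[OF D1_bin[OF T(1)]] Fn_intros)
  moreover have "\<exists>e. \<forall>x. P x \<longleftrightarrow> (\<exists>s. ?W s e x)" if "S1 P" for P
    using univ_universal[OF that] bound_two unfolding U by meson
  moreover have "\<forall>s e x. ?W s e x \<longrightarrow> x \<sqsubset> s" by blast
  moreover have "\<forall>s t e x. s \<sqsubseteq> t \<longrightarrow> ?W s e x \<longrightarrow> ?W t e x" using ord.order.strict_trans2 by blast
  ultimately show ?thesis by (intro exI[of _ ?W]) blast
qed

end

section \<open>The construction\<close>

locale enumeration = isigma1 +
  fixes W :: "'a \<Rightarrow> 'a \<Rightarrow> 'a \<Rightarrow> bool"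
  assumes W_D1: "D1 (\<lambda>w. W (fs w) (fs (sn w)) (sn (sn w)))"
    and W_lt: "W s e x \<Longrightarrow> x \<sqsubset> s"
    and W_mono: "s \<sqsubseteq> t \<Longrightarrow> W s e x \<Longrightarrow> W t e x"
    and W_univ: "S1 P \<Longrightarrow> \<exists>e. \<forall>x. P x \<longleftrightarrow> (\<exists>s. W s e x)"
begin

lemma D1_W: "Fn s \<Longrightarrow> Fn e \<Longrightarrow> Fn x \<Longrightarrow> D1 (\<lambda>w. W (s w) (e w) (x w))"
  using D1_comp[OF W_D1 Fn_pr[OF _ Fn_pr], of s e x] by simp

text \<open>An index \<open>e\<close> stands for the functional with index \<open>fs e\<close> and the set with index \<open>sn e\<close>.\<close>

definition comput where "comput s e p n p' n' \<longleftrightarrow> W s (fs e) (quad p n p' n')"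
definition wset where "wset s e x \<longleftrightarrow> W s (sn e) x"

text \<open>An action is \<open>pr kind (pr level data)\<close>. Kind 1 puts the witness \<open>data\<close> into \<open>D\<close>, kind 2
  records the failure \<open>data = pr number F\<close> of an isolation requirement, kind 3 removes the set
  coded by \<open>data\<close> from \<open>D\<close>; kind 0 does nothing.\<close>

definition kd where "kd a = fs a"
definition lv where "lv a = fs (sn a)"
definition dt where "dt a = sn (sn a)"

definition En where
  "En f s d \<longleftrightarrow> (\<exists>t. t \<sqsubset> s \<and> kd (f t) = num 1 \<and> dt (f t) = d)"

text \<open>The removed set may contain numbers that have not entered \<open>D\<close>. They do not
  count as removed, so \<open>Rm\<close> always implies an earlier entry.\<close>

definition Rm where
  "Rm f s d \<longleftrightarrow> (\<exists>t. t \<sqsubset> s \<and> kd (f t) = num 3 \<and> d \<epsilon> dt (f t) \<and> En f t d)"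

definition Dd where "Dd f s d \<longleftrightarrow> En f s d \<and> \<not> Rm f s d"

definition Aa where
  "Aa f s x \<longleftrightarrow> (\<exists>d. d \<sqsubset> x \<oplus> \<one> \<and> (\<exists>u. u \<sqsubset> s \<oplus> \<one> \<and> x = pr d u \<and> Dd f u d \<and> \<not> Dd f s d))"

definition clean where
  "clean f q t s \<longleftrightarrow> (\<forall>u. u \<sqsubset> s \<longrightarrow> t \<sqsubseteq> u \<longrightarrow> kd (f u) \<noteq> num 0 \<longrightarrow> \<not> lv (f u) \<sqsubset> q)"

text \<open>Within level q the witness (kind 1) ranks above the isolation requirement (kinds 2 and
  3), so an entry at level q itself also cancels the latter.\<close>

definition cleanI where
  "cleanI f q t s \<longleftrightarrow> (\<forall>u. u \<sqsubset> s \<longrightarrow> t \<sqsubseteq> u \<longrightarrow> kd (f u) \<noteq> num 0 \<longrightarrow>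
     \<not> lv (f u) \<sqsubset> q \<and> \<not> (lv (f u) = q \<and> kd (f u) = num 1))"

text \<open>The positive part is empty and the negative part is {d}: the computation from
  \<open>A\<close> says that d is not in \<open>D\<close>. The stage u in the name of d lies after
  every action of a smaller level, which makes witnesses fresh.\<close>

definition attN where
  "attN f s q d \<longleftrightarrow> (\<exists>u. u \<sqsubset> s \<oplus> \<one> \<and> d = pr q u \<and> clean f q u s) \<and>
     (\<forall>t. t \<sqsubset> s \<longrightarrow> kd (f t) = num 1 \<longrightarrow> lv (f t) = q \<longrightarrow> \<not> clean f q t s) \<and>
     (\<exists>p'. p' \<sqsubset> s \<and> (\<exists>n'. n' \<sqsubset> s \<and> comput s q \<zero> (\<e> d) p' n' \<and>
       (\<forall>x. x \<epsilon> p' \<longrightarrow> Aa f s x) \<and> (\<forall>x. x \<epsilon> n' \<longrightarrow> \<not> Aa f s x)))"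

definition won where
  "won f s q \<longleftrightarrow> (\<exists>t. t \<sqsubset> s \<and> kd (f t) = num 3 \<and> lv (f t) = q \<and> cleanI f q t s)"

definition fails where
  "fails f s q t \<longleftrightarrow> kd (f t) = num 2 \<and> lv (f t) = q \<and> cleanI f q t s"

text \<open>A computation from \<open>D\<close>, seen at s', said that \<open>n\<close> misses the
  c.e. set, and by s this is false. Its positive use is intact at s; whatever spoils its negative
  use \<open>F\<close> entered after s', so removing \<open>F\<close> restores it.\<close>

definition refuted where
  "refuted f q s' s F \<longleftrightarrow> (\<exists>n. n \<sqsubset> s' \<and> (\<exists>p'. p' \<sqsubset> s' \<and> comput s' q \<zero> n p' F \<and>
     (\<forall>x. x \<epsilon> p' \<longrightarrow> Dd f s' x \<and> Dd f s x) \<and> (\<forall>x. x \<epsilon> F \<longrightarrow> \<not> Dd f s' x) \<and>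
     (\<forall>x. x \<epsilon> n \<longrightarrow> \<not> wset s' q x) \<and> (\<exists>x. x \<epsilon> n \<and> wset s q x)))"

text \<open>Failures are numbered consecutively until cancelled, and r is the next number. The
  refuted computation has to be newer than the last failure of the level, so that different attempts
  are spoilt by entries from different periods.\<close>

definition attF where
  "attF f s q r F \<longleftrightarrow> r \<sqsubset> \<e> q \<and> \<not> won f s q \<and>
     (\<forall>r'. r' \<sqsubset> r \<longrightarrow> (\<exists>t. t \<sqsubset> s \<and> fails f s q t \<and> fs (dt (f t)) = r')) \<and>
     (\<forall>t. t \<sqsubset> s \<longrightarrow> fails f s q t \<longrightarrow> fs (dt (f t)) \<sqsubset> r) \<and>
     (\<exists>s'. s' \<sqsubset> s \<oplus> \<one> \<and> cleanI f q s' s \<and>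
       (\<forall>t. t \<sqsubset> s \<longrightarrow> s' \<sqsubseteq> t \<longrightarrow> lv (f t) = q \<longrightarrow> kd (f t) \<noteq> num 2) \<and> refuted f q s' s F)"

text \<open>A claim is a computation of \<open>D\<close> below \<open>m\<close> from the set with index \<open>i\<close>, with negative use \<open>n'\<close>,
  that does not contradict any older computation that is still valid. This consistency is what
  makes later failures independent of an \<open>i\<close> whose permission is still missing.\<close>

definition cm where
  "cm f i s m n' \<longleftrightarrow> m \<sqsubset> s \<and> (\<exists>p. p \<sqsubset> s \<and> (\<exists>n. n \<sqsubset> s \<and> (\<exists>p'. p' \<sqsubset> s \<and>
     (\<forall>x. x \<sqsubset> m \<longrightarrow> (Dd f s x \<longrightarrow> x \<epsilon> p) \<and> (\<not> Dd f s x \<longrightarrow> x \<epsilon> n)) \<and>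
     comput s i p n p' n' \<and> (\<forall>x. x \<epsilon> p' \<longrightarrow> wset s i x)))) \<and> (\<forall>x. x \<epsilon> n' \<longrightarrow> \<not> wset s i x)"

definition claim where
  "claim f i s m n' \<longleftrightarrow> cm f i s m n' \<and>
     (\<forall>s0. s0 \<sqsubset> s \<longrightarrow> (\<forall>m0. m0 \<sqsubset> s0 \<longrightarrow> (\<forall>n0. n0 \<sqsubset> s0 \<longrightarrow> cm f i s0 m0 n0 \<longrightarrow>
       (\<forall>x. x \<epsilon> n0 \<longrightarrow> \<not> wset s i x) \<longrightarrow>
       (\<forall>x. x \<sqsubset> m \<longrightarrow> x \<sqsubset> m0 \<longrightarrow> (Dd f s0 x \<longleftrightarrow> Dd f s x)))))"

text \<open>Removing \<open>F\<close> would return \<open>D\<close> to an earlier state. The index i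
  permits this if no claim of i that is still valid was made before an element of \<open>F\<close>
  in its range entered \<open>D\<close>; otherwise i would not notice that the element had been
  there.\<close>

definition permits where
  "permits f i F s \<longleftrightarrow> (\<forall>u. u \<sqsubset> s \<longrightarrow> (\<forall>m. m \<sqsubset> u \<longrightarrow> (\<forall>n'. n' \<sqsubset> u \<longrightarrow> claim f i u m n' \<longrightarrow>
     (\<forall>x. x \<epsilon> n' \<longrightarrow> \<not> wset s i x) \<longrightarrow>
     (\<forall>d. d \<epsilon> F \<longrightarrow> d \<sqsubset> m \<longrightarrow> Dd f s d \<longrightarrow> En f u d))))"

definition attW where
  "attW f s q F \<longleftrightarrow> \<not> won f s q \<and> (\<exists>t. t \<sqsubset> s \<and> fails f s q t \<and> sn (dt (f t)) = F) \<and>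
     (\<forall>i. i \<sqsubset> q \<longrightarrow> permits f i F s)"

definition att where
  "att f s a \<longleftrightarrow> kd a = num 1 \<and> attN f s (lv a) (dt a) \<or>
     kd a = num 2 \<and> attF f s (lv a) (fs (dt a)) (sn (dt a)) \<or> kd a = num 3 \<and> attW f s (lv a) (dt a)"

definition sel where
  "sel f s a \<longleftrightarrow> a \<sqsubset> s \<and> att f s a \<and> (\<forall>b. b \<sqsubset> s \<longrightarrow> att f s b \<longrightarrow> lv a \<sqsubseteq> lv b)"

section \<open>Definability of the construction, uniformly in the history\<close>

lemma Fn_kd: "Fn f \<Longrightarrow> Fn (\<lambda>w. kd (f w))" and Fn_lv: "Fn f \<Longrightarrow> Fn (\<lambda>w. lv (f w))"
  and Fn_dt: "Fn f \<Longrightarrow> Fn (\<lambda>w. dt (f w))"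
  unfolding kd_def lv_def dt_def by (auto intro!: Fn_fs Fn_sn)

lemma D1_comput: "Fn s \<Longrightarrow> Fn e \<Longrightarrow> Fn p \<Longrightarrow> Fn n \<Longrightarrow> Fn p' \<Longrightarrow> Fn n' \<Longrightarrow>
    D1 (\<lambda>w. comput (s w) (e w) (p w) (n w) (p' w) (n' w))"
  and D1_wset: "Fn s \<Longrightarrow> Fn e \<Longrightarrow> Fn p \<Longrightarrow> D1 (\<lambda>w. wset (s w) (e w) (p w))"
  unfolding comput_def wset_def quad_def by (auto intro!: D1_W Fn_fs Fn_sn Fn_pr)

text \<open>\<open>hf H t\<close> is the action at stage t of the history H. The instance
  \<open>look\<close>, for coded histories, serves to define the construction; the instance that
  ignores H and returns \<open>h\<close> serves to verify it.\<close>

context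
  fixes hf :: "'a \<Rightarrow> 'a \<Rightarrow> 'a"
  assumes hf: "Fn (\<lambda>u. hf (fs u) (sn u))"
begin

lemma Fn_hf: "Fn H \<Longrightarrow> Fn t \<Longrightarrow> Fn (\<lambda>w. hf (H w) (t w))"
  by (rule Fn_comp2[OF hf])

lemmas F_intros = Fn_hf Fn_kd Fn_lv Fn_dt Fn_intros

lemma D1_En: "Fn H \<Longrightarrow> Fn s \<Longrightarrow> Fn d \<Longrightarrow> D1 (\<lambda>w. En (hf (H w)) (s w) (d w))"
proof -
  have "D1 (\<lambda>w. En (hf (fs w)) (fs (sn w)) (sn (sn w)))"
    unfolding En_def by (intro D1_intros F_intros)
  then show "Fn H \<Longrightarrow> Fn s \<Longrightarrow> Fn d \<Longrightarrow> D1 (\<lambda>w. En (hf (H w)) (s w) (d w))"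
    using D1_comp[OF _ Fn_pr[OF _ Fn_pr], of "\<lambda>w. En (hf (fs w)) (fs (sn w)) (sn (sn w))" H s d] by simp
qed

lemma D1_Rm: "Fn H \<Longrightarrow> Fn s \<Longrightarrow> Fn d \<Longrightarrow> D1 (\<lambda>w. Rm (hf (H w)) (s w) (d w))"
proof -
  have "D1 (\<lambda>w. Rm (hf (fs w)) (fs (sn w)) (sn (sn w)))"
    unfolding Rm_def by (intro D1_intros D1_En F_intros)
  then show "Fn H \<Longrightarrow> Fn s \<Longrightarrow> Fn d \<Longrightarrow> D1 (\<lambda>w. Rm (hf (H w)) (s w) (d w))"
    using D1_comp[OF _ Fn_pr[OF _ Fn_pr], of "\<lambda>w. Rm (hf (fs w)) (fs (sn w)) (sn (sn w))" H s d] by simp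
qed

lemma D1_Dd: "Fn H \<Longrightarrow> Fn s \<Longrightarrow> Fn d \<Longrightarrow> D1 (\<lambda>w. Dd (hf (H w)) (s w) (d w))"
  unfolding Dd_def by (intro D1_intros D1_En D1_Rm)

lemma D1_Aa: "Fn H \<Longrightarrow> Fn s \<Longrightarrow> Fn d \<Longrightarrow> D1 (\<lambda>w. Aa (hf (H w)) (s w) (d w))"
proof -
  have "D1 (\<lambda>w. Aa (hf (fs w)) (fs (sn w)) (sn (sn w)))"
    unfolding Aa_def by (intro D1_intros D1_Dd F_intros)
  then show "Fn H \<Longrightarrow> Fn s \<Longrightarrow> Fn d \<Longrightarrow> D1 (\<lambda>w. Aa (hf (H w)) (s w) (d w))"
    using D1_comp[OF _ Fn_pr[OF _ Fn_pr], of "\<lambda>w. Aa (hf (fs w)) (fs (sn w)) (sn (sn w))" H s d] by simp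
qed

lemma D1_clean_aux: "D1 (\<lambda>w. clean (hf (fs w)) (fs (sn w)) (fs (sn (sn w))) (sn (sn (sn w))))"
  and D1_cleanI_aux: "D1 (\<lambda>w. cleanI (hf (fs w)) (fs (sn w)) (fs (sn (sn w))) (sn (sn (sn w))))"
  unfolding clean_def cleanI_def by (intro D1_intros F_intros)+

lemma D1_clean: "Fn H \<Longrightarrow> Fn q \<Longrightarrow> Fn t \<Longrightarrow> Fn s \<Longrightarrow> D1 (\<lambda>w. clean (hf (H w)) (q w) (t w) (s w))"
  and D1_cleanI: "Fn H \<Longrightarrow> Fn q \<Longrightarrow> Fn t \<Longrightarrow> Fn s \<Longrightarrow> D1 (\<lambda>w. cleanI (hf (H w)) (q w) (t w) (s w))"
  using D1_comp[OF D1_clean_aux Fn_pr[OF _ Fn_pr[OF _ Fn_pr]], of H q t s]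
    D1_comp[OF D1_cleanI_aux Fn_pr[OF _ Fn_pr[OF _ Fn_pr]], of H q t s] by simp_all

lemma D1_attN: "D1 (\<lambda>w. attN (hf (fs w)) (fs (sn w)) (fs (sn (sn w))) (sn (sn (sn w))))"
  unfolding attN_def by (intro D1_intros D1_clean D1_Aa D1_comput F_intros)

lemma D1_won_aux: "D1 (\<lambda>w. won (hf (fs w)) (fs (sn w)) (sn (sn w)))"
  unfolding won_def by (intro D1_intros D1_cleanI F_intros)

lemma D1_won: "Fn H \<Longrightarrow> Fn s \<Longrightarrow> Fn q \<Longrightarrow> D1 (\<lambda>w. won (hf (H w)) (s w) (q w))"
  using D1_comp[OF D1_won_aux Fn_pr[OF _ Fn_pr], of H s q] by simp

lemma D1_fails: "Fn H \<Longrightarrow> Fn s \<Longrightarrow> Fn q \<Longrightarrow> Fn t \<Longrightarrow> D1 (\<lambda>w. fails (hf (H w)) (s w) (q w) (t w))"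
  unfolding fails_def by (intro D1_intros D1_cleanI F_intros)

lemma D1_attF: "D1 (\<lambda>w. attF (hf (fs w)) (fs (sn w)) (fs (sn (sn w))) (fs (sn (sn (sn w)))) (sn (sn (sn (sn w)))))"
  unfolding attF_def refuted_def
  by (intro D1_intros D1_won D1_fails D1_cleanI D1_Dd D1_comput D1_wset F_intros)

lemma D1_cm_aux: "D1 (\<lambda>w. cm (hf (fs w)) (fs (sn w)) (fs (sn (sn w))) (fs (sn (sn (sn w)))) (sn (sn (sn (sn w)))))"
  unfolding cm_def by (intro D1_intros D1_Dd D1_comput D1_wset F_intros)

lemma D1_cm: "Fn H \<Longrightarrow> Fn i \<Longrightarrow> Fn s \<Longrightarrow> Fn m \<Longrightarrow> Fn n \<Longrightarrow> D1 (\<lambda>w. cm (hf (H w)) (i w) (s w) (m w) (n w))"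
  using D1_comp[OF D1_cm_aux Fn_pr[OF _ Fn_pr[OF _ Fn_pr[OF _ Fn_pr]]], of H i s m n] by simp

lemma D1_claim_aux: "D1 (\<lambda>w. claim (hf (fs w)) (fs (sn w)) (fs (sn (sn w))) (fs (sn (sn (sn w)))) (sn (sn (sn (sn w)))))"
  unfolding claim_def by (intro D1_intros D1_Dd D1_cm D1_wset F_intros)

lemma D1_claim: "Fn H \<Longrightarrow> Fn i \<Longrightarrow> Fn s \<Longrightarrow> Fn m \<Longrightarrow> Fn n \<Longrightarrow> D1 (\<lambda>w. claim (hf (H w)) (i w) (s w) (m w) (n w))"
  using D1_comp[OF D1_claim_aux Fn_pr[OF _ Fn_pr[OF _ Fn_pr[OF _ Fn_pr]]], of H i s m n] by simp

lemma D1_permits_aux: "D1 (\<lambda>w. permits (hf (fs w)) (fs (sn w)) (fs (sn (sn w))) (sn (sn (sn w))))"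
  unfolding permits_def by (intro D1_intros D1_Dd D1_En D1_claim D1_wset F_intros)

lemma D1_permits: "Fn H \<Longrightarrow> Fn q \<Longrightarrow> Fn t \<Longrightarrow> Fn s \<Longrightarrow> D1 (\<lambda>w. permits (hf (H w)) (q w) (t w) (s w))"
  using D1_comp[OF D1_permits_aux Fn_pr[OF _ Fn_pr[OF _ Fn_pr]], of H q t s] by simp

lemma D1_attW: "D1 (\<lambda>w. attW (hf (fs w)) (fs (sn w)) (fs (sn (sn w))) (sn (sn (sn w))))"
  unfolding attW_def by (intro D1_intros D1_won D1_fails D1_permits F_intros)

lemma D1_att: "Fn H \<Longrightarrow> Fn s \<Longrightarrow> Fn a \<Longrightarrow> D1 (\<lambda>w. att (hf (H w)) (s w) (a w))"
proof -
  assume F: "Fn H" "Fn s" "Fn a"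
  have "D1 (\<lambda>w. attN (hf (H w)) (s w) (lv (a w)) (dt (a w)))"
    using D1_comp[OF D1_attN Fn_pr[OF F(1) Fn_pr[OF F(2) Fn_pr[OF Fn_lv[OF F(3)] Fn_dt[OF F(3)]]]]] by simp
  moreover have "D1 (\<lambda>w. attW (hf (H w)) (s w) (lv (a w)) (dt (a w)))"
    using D1_comp[OF D1_attW Fn_pr[OF F(1) Fn_pr[OF F(2) Fn_pr[OF Fn_lv[OF F(3)] Fn_dt[OF F(3)]]]]] by simp
  moreover have "D1 (\<lambda>w. attF (hf (H w)) (s w) (lv (a w)) (fs (dt (a w))) (sn (dt (a w))))"
    using D1_comp[OF D1_attF Fn_pr[OF F(1) Fn_pr[OF F(2) Fn_pr[OF Fn_lv[OF F(3)]
        Fn_pr[OF Fn_fs[OF Fn_dt[OF F(3)]] Fn_sn[OF Fn_dt[OF F(3)]]]]]]] by simp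
  ultimately show ?thesis unfolding att_def by (intro D1_disj D1_conj D1_eq Fn_kd F Fn_const)
qed

lemma D1_sel: "D1 (\<lambda>w. sel (hf (fs (fs w))) (sn (fs w)) (sn w))"
  unfolding sel_def by (intro D1_intros D1_att F_intros)

end

section \<open>Attention at a stage depends only on earlier actions\<close>

context
  fixes f g :: "'a \<Rightarrow> 'a" and S :: 'a
  assumes agree: "\<And>t. t \<sqsubset> S \<Longrightarrow> f t = g t"
begin

lemma agree': "s \<sqsubseteq> S \<Longrightarrow> t \<sqsubset> s \<Longrightarrow> f t = g t"
  using agree ord.order.strict_trans2 by blast

lemma En_cong: "s \<sqsubseteq> S \<Longrightarrow> En f s = En g s"
  unfolding En_def using agree'[of s] by (intro ext) (simp cong: conj_cong)

lemma below: "s \<sqsubseteq> S \<Longrightarrow> t \<sqsubset> s \<Longrightarrow> t \<sqsubseteq> S" "s \<sqsubseteq> S \<Longrightarrow> t \<sqsubset> s \<oplus> \<one> \<Longrightarrow> t \<sqsubseteq> S"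
  unfolding le_suc_iff[symmetric] by order+

lemma Rm_cong:
  assumes s: "s \<sqsubseteq> S"
  shows "Rm f s = Rm g s"
  unfolding Rm_def using agree'[OF s] En_cong[OF below(1)[OF s]]
  by (intro ext) (simp add: s cong: conj_cong imp_cong)

lemma Dd_cong:
  assumes s: "s \<sqsubseteq> S"
  shows "Dd f s = Dd g s"
  unfolding Dd_def using En_cong[OF s] Rm_cong[OF s]
  by (intro ext) (simp add: s cong: conj_cong imp_cong)

lemma Aa_cong:
  assumes s: "s \<sqsubseteq> S"
  shows "Aa f s = Aa g s"
  unfolding Aa_def using Dd_cong[OF below(2)[OF s]] Dd_cong[OF s]
  by (intro ext) (simp add: s cong: conj_cong imp_cong)

lemma clean_cong:
  assumes s: "s \<sqsubseteq> S"
  shows "clean f q t s = clean g q t s"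
  unfolding clean_def using agree'[OF s]
  by (simp add: s cong: conj_cong imp_cong)

lemma cleanI_cong:
  assumes s: "s \<sqsubseteq> S"
  shows "cleanI f q t s = cleanI g q t s"
  unfolding cleanI_def using agree'[OF s]
  by (simp add: s cong: conj_cong imp_cong)

lemma won_cong:
  assumes s: "s \<sqsubseteq> S"
  shows "won f s q = won g s q"
  unfolding won_def using agree'[OF s] cleanI_cong[OF s]
  by (simp add: s cong: conj_cong imp_cong)

lemma attN_cong:
  assumes s: "s \<sqsubseteq> S"
  shows "attN f s q d = attN g s q d"
  unfolding attN_def using agree'[OF s] clean_cong[OF s] Aa_cong[OF s]
  by (simp add: s cong: conj_cong imp_cong)

lemma fails_cong:
  assumes s: "s \<sqsubseteq> S" and t: "t \<sqsubset> s"
  shows "fails f s q t = fails g s q t"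
  unfolding fails_def using agree'[OF s t] cleanI_cong[OF s]
  by (simp add: s cong: conj_cong imp_cong)

lemma refuted_cong:
  assumes s: "s \<sqsubseteq> S" and s': "s' \<sqsubseteq> S"
  shows "refuted f q s' s F = refuted g q s' s F"
  unfolding refuted_def using Dd_cong[OF s] Dd_cong[OF s']
  by (simp add: s cong: conj_cong imp_cong)

lemma attF_cong:
  assumes s: "s \<sqsubseteq> S"
  shows "attF f s q r F = attF g s q r F"
  unfolding attF_def using agree'[OF s] won_cong[OF s] fails_cong[OF s] cleanI_cong[OF s] refuted_cong[OF s below(2)[OF s]]
  by (simp add: s cong: conj_cong imp_cong)

lemma cm_cong:
  assumes s: "s \<sqsubseteq> S"
  shows "cm f i s m n' = cm g i s m n'"
  unfolding cm_def using Dd_cong[OF s]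
  by (simp add: s cong: conj_cong imp_cong)

lemma claim_cong:
  assumes s: "s \<sqsubseteq> S"
  shows "claim f i s m n' = claim g i s m n'"
  unfolding claim_def using cm_cong[OF s] cm_cong[OF below(1)[OF s]] Dd_cong[OF s] Dd_cong[OF below(1)[OF s]]
  by (simp add: s cong: conj_cong imp_cong)

lemma permits_cong:
  assumes s: "s \<sqsubseteq> S"
  shows "permits f i F s = permits g i F s"
  unfolding permits_def using claim_cong[OF below(1)[OF s]] Dd_cong[OF s] En_cong[OF below(1)[OF s]]
  by (simp add: s cong: conj_cong imp_cong)

lemma att_cong:
  assumes s: "s \<sqsubseteq> S"
  shows "att f s a = att g s a"
  unfolding att_def attW_def using agree'[OF s] won_cong[OF s] fails_cong[OF s] permits_cong[OF s] attN_cong[OF s] attF_cong[OF s]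
  by (simp add: s cong: conj_cong imp_cong)

end

definition look where
  "look H t = (if \<exists>a. a \<sqsubset> H \<and> pr t a \<epsilon> H then ord.Least (\<lambda>a. pr t a \<epsilon> H) else \<zero>)"

lemma Fn_look: "Fn (\<lambda>u. look (fs u) (sn u))"
  unfolding look_def by (rule Fn_least) (intro D1_intros Fn_intros)+

definition pick where
  "pick s H = (if \<exists>a. a \<sqsubset> s \<and> sel (look H) s a then ord.Least (sel (look H) s) else \<zero>)"

lemma Fn_pick: "Fn (\<lambda>u. pick (fs u) (sn u))"
proof -
  have "D1 (\<lambda>w. sel (look (sn (fs w))) (fs (fs w)) (sn w))"
    using D1_comp[OF D1_sel[OF Fn_look], of "\<lambda>w. pr (pr (sn (fs w)) (fs (fs w))) (sn w)"]
    by (simp add: Fn_intros)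
  then show ?thesis unfolding pick_def by (rule Fn_least) (intro Fn_intros)
qed

text \<open>Course-of-values recursion: \<open>st s\<close> codes the graph of \<open>h\<close>
  below s, and by the congruence lemmas this coded part determines which actions are selected at
  s.\<close>

lemma ex_history:
  "\<exists>h. Fn h \<and> (\<forall>s. h s = (if \<exists>a. sel h s a then ord.Least (sel h s) else \<zero>))"
proof -
  let ?G = "\<lambda>s H. ins (pr s (pick s H)) H"
  have "Fn (\<lambda>w. ?G (fs w) (sn w))" by (intro Fn_ins Fn_pr Fn_pick Fn_sn Fn_fs Fn_id)
  then obtain st where st: "Fn st" "st \<zero> = \<zero>" "\<And>t. st (t \<oplus> \<one>) = ?G t (st t)"
    using recursion[of ?G \<zero>] by blast
  define h where "h s = pick s (st s)" for s
  have Fn_h: "Fn h" unfolding h_def by (rule Fn_comp2[OF Fn_pick Fn_id st(1)])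
  have hist: "(\<forall>z. z \<epsilon> st s \<longrightarrow> (\<exists>t. t \<sqsubset> s \<and> z = pr t (h t))) \<and> (\<forall>t. t \<sqsubset> s \<longrightarrow> pr t (h t) \<epsilon> st s)" for s
  proof (induction s rule: ind_S1)
    case 1 show ?case by (intro D1_S1) (intro D1_intros Fn_comp[OF st(1)] Fn_comp[OF Fn_h] Fn_intros)
  next
    case (3 s)
    show ?case
    proof (intro conjI allI impI)
      fix z assume "z \<epsilon> st (s \<oplus> \<one>)"
      then have "z = pr s (h s) \<or> z \<epsilon> st s" by (simp add: st(3) h_def)
      then show "\<exists>t. t \<sqsubset> s \<oplus> \<one> \<and> z = pr t (h t)" using 3 lt_suc lt_trans by blast
    next
      fix t assume "t \<sqsubset> s \<oplus> \<one>"
      then show "pr t (h t) \<epsilon> st (s \<oplus> \<one>)" using 3 by (auto simp: st(3) h_def lt_suc_iff)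
    qed
  qed (simp add: st(2))
  have look: "look (st s) t = h t" if "t \<sqsubset> s" for s t
  proof -
    have iff: "pr t a \<epsilon> st s \<longleftrightarrow> a = h t" for a using hist[of s] that by auto
    then have "h t \<sqsubset> st s" using mem_lt le_pr(2) ord.order.strict_trans1 by metis
    moreover have "ord.Least (\<lambda>a. a = h t) = h t" by (rule ord.Least_equality) auto
    ultimately show ?thesis unfolding look_def iff by auto
  qed
  have "sel (look (st s)) s = sel h s" for s
  proof -
    have "att (look (st s)) s = att h s" by (rule ext, rule att_cong[where S = s]) (use look in auto)
    then show ?thesis unfolding sel_def by simp
  qed
  moreover have "(\<exists>a. a \<sqsubset> s \<and> sel h s a) \<longleftrightarrow> (\<exists>a. sel h s a)" for s unfolding sel_def by blast
  ultimately have "h s = (if \<exists>a. sel h s a then ord.Least (sel h s) else \<zero>)" for s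
    by (simp add: h_def[of s] pick_def)
  then show ?thesis using Fn_h by blast
qed

end

section \<open>Finite injury\<close>

context isigma1
begin

lemma Fn_mns: "Fn f \<Longrightarrow> Fn g \<Longrightarrow> Fn (\<lambda>w. f w \<ominus> g w)"
proof (rule Fn_graph)
  assume "Fn f" "Fn g"
  have *: "sn w = f (fs w) \<ominus> g (fs w) \<longleftrightarrow> (g (fs w) \<sqsubseteq> f (fs w) \<and> sn w \<oplus> g (fs w) = f (fs w)) \<or>
    (\<not> g (fs w) \<sqsubseteq> f (fs w) \<and> sn w = \<zero>)" for w
    using ar.add_implies_diff[of "sn w" "g (fs w)" "f (fs w)"] ar.le_add_diff_inverse2 mns_zero by metis
  show "S1 (\<lambda>w. sn w = f (fs w) \<ominus> g (fs w))" unfolding *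
    by (intro D1_S1) (intro D1_intros Fn_comp[OF \<open>Fn f\<close>] Fn_comp[OF \<open>Fn g\<close>] Fn_intros)
qed

lemma mns_less: "a \<sqsubset> b \<Longrightarrow> b \<sqsubseteq> c \<Longrightarrow> c \<ominus> b \<sqsubset> c \<ominus> a"
proof -
  assume ab: "a \<sqsubset> b" and bc: "b \<sqsubseteq> c"
  have "(c \<ominus> b) \<oplus> a \<sqsubset> (c \<ominus> b) \<oplus> b" using ab by simp
  also have "\<dots> = (c \<ominus> a) \<oplus> a" using ab bc by (simp add: ar.le_add_diff_inverse2 ord.less_imp_le)
  finally show ?thesis by simp
qed

text \<open>\<open>X s w\<close> says that weight w has acted before s with no heavier action after
  its last occurrence. An action of weight w sets digit w, which is 0 beforehand by
  \<open>between\<close>, and can clear only smaller digits. So the code of \<open>X s\<close>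
  grows, and no action occurs once it has its maximal value.\<close>

lemma finite_acts:
  assumes A: "D1 A" and wt: "Fn wt" and bound: "\<And>s. A s \<Longrightarrow> wt s \<sqsubset> N"
    and between: "\<And>s t. A s \<Longrightarrow> A t \<Longrightarrow> s \<sqsubset> t \<Longrightarrow> wt s = wt t \<Longrightarrow>
      \<exists>u. s \<sqsubset> u \<and> u \<sqsubset> t \<and> A u \<and> wt s \<sqsubset> wt u"
  shows "\<exists>S. \<forall>s. S \<sqsubseteq> s \<longrightarrow> \<not> A s"
proof -
  define X where "X s w \<longleftrightarrow> (\<exists>t. t \<sqsubset> s \<and> A t \<and> wt t = w \<and>
    (\<forall>u. u \<sqsubset> s \<longrightarrow> t \<sqsubset> u \<longrightarrow> A u \<longrightarrow> \<not> w \<sqsubset> wt u))" for s w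
  have X: "D1 (\<lambda>w. X (f w) (g w))" if "Fn f" "Fn g" for f g
  proof -
    have "D1 (\<lambda>w. X (fs w) (sn w))"
      unfolding X_def by (intro D1_intros D1_comp[OF A] Fn_comp[OF wt] Fn_intros)
    then show ?thesis using D1_comp2 that by blast
  qed
  let ?codes = "\<lambda>s c. \<forall>w. w \<sqsubset> N \<longrightarrow> (w \<epsilon> c \<longleftrightarrow> X s w)"
  let ?P = "\<lambda>c. c \<sqsubset> \<e> N \<and> (\<exists>s. ?codes s c)"
  have ex: "\<exists>c. c \<sqsubset> \<e> N \<and> ?codes s c" for s
  proof -
    have "S1 (X s)" using D1_S1[OF X[OF Fn_const Fn_id]] .
    then show ?thesis using comprehension[of "X s" N] by metis
  qed
  have "S1 (\<lambda>w. ?codes (sn w) (fs w))" by (intro D1_S1) (intro D1_intros X Fn_intros)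
  then have "S1 ?P" by (intro S1_conj D1_S1[OF D1_lt] S1_ex Fn_intros)
  moreover obtain c0 where "?P c0" using ex by blast
  ultimately obtain c where c: "?P c" "\<And>d. ?P d \<Longrightarrow> d \<sqsubseteq> c" using max_S1[of ?P c0 "\<e> N"] by blast
  then obtain S where S: "?codes S c" by blast
  have "\<not> A s" if Ss: "S \<sqsubseteq> s" for s
  proof
    assume "A s"
    let ?Q = "\<lambda>s. S \<sqsubseteq> s \<and> A s"
    have "S1 ?Q" by (intro D1_S1) (intro D1_intros D1_comp[OF A] Fn_intros)
    \<comment> \<open>For the first action after S the digits just before it are still those of
      S.\<close>
    then obtain s where s: "S \<sqsubseteq> s" "A s" "\<And>t. S \<sqsubseteq> t \<Longrightarrow> A t \<Longrightarrow> s \<sqsubseteq> t"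
      using least_S1[of ?Q s] Ss \<open>A s\<close> by blast
    have early: "t \<sqsubset> S" if "t \<sqsubset> s" "A t" for t using s(3)[of t] that ord.not_le by blast
    have XS: "X s w \<longleftrightarrow> X S w" for w
      unfolding X_def using early s(1) ord.order.strict_trans2 by blast
    obtain d where d: "d \<sqsubset> \<e> N" "?codes (s \<oplus> \<one>) d" using ex by blast
    have "c \<sqsubset> d"
    proof (rule code_lessI)
      have N: "wt s \<sqsubset> N" using bound s(2) by blast
      show "\<not> wt s \<epsilon> c"
      proof
        assume "wt s \<epsilon> c"
        then have "X s (wt s)" using S N XS by blast
        then obtain t where t: "t \<sqsubset> s" "A t" "wt t = wt s"
          "\<And>u. u \<sqsubset> s \<Longrightarrow> t \<sqsubset> u \<Longrightarrow> A u \<Longrightarrow> \<not> wt s \<sqsubset> wt u" unfolding X_def by blast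
        then show False using between[OF t(2) s(2) t(1,3)] by auto
      qed
      have "\<not> s \<sqsubset> u" if "u \<sqsubset> s \<oplus> \<one>" for u using that by (metis lt_suc_iff lt_trans lt_irrefl)
      then have "X (s \<oplus> \<one>) (wt s)" unfolding X_def using s(2) lt_suc[of s] by blast
      then show "wt s \<epsilon> d" using d(2) N by blast
      fix i assume i: "wt s \<sqsubset> i"
      have "X (s \<oplus> \<one>) i \<longleftrightarrow> X s i"
      proof
        assume "X (s \<oplus> \<one>) i"
        then obtain t where t: "t \<sqsubset> s \<or> t = s" "A t" "wt t = i"
          "\<And>u. u \<sqsubset> s \<or> u = s \<Longrightarrow> t \<sqsubset> u \<Longrightarrow> A u \<Longrightarrow> \<not> i \<sqsubset> wt u" unfolding X_def lt_suc_iff by blast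
        then have "t \<sqsubset> s" using i lt_irrefl by blast
        then show "X s i" unfolding X_def using t by blast
      next
        assume "X s i"
        moreover have "\<not> i \<sqsubset> wt s" using i by order
        ultimately show "X (s \<oplus> \<one>) i" unfolding X_def lt_suc_iff by blast
      qed
      then have "i \<epsilon> c \<longleftrightarrow> i \<epsilon> d" if "i \<sqsubset> N" using S d(2) XS that by blast
      moreover have "i \<sqsubset> N" if "i \<epsilon> c \<or> i \<epsilon> d" using that mem_lt_exp c(1) d(1) by blast
      ultimately show "i \<epsilon> c \<longleftrightarrow> i \<epsilon> d" by blast
    qed
    moreover have "d \<sqsubseteq> c" using c(2) d by blast
    ultimately show False by order
  qed
  then show ?thesis by blast
qed

text \<open>Comprehension codes the numbers below m that ever satisfy P, and collection bounds the
  stages at which they do.\<close>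

lemma settle:
  assumes P: "D1 (\<lambda>w. P (fs w) (sn w))" and mono: "\<And>s t x. s \<sqsubseteq> t \<Longrightarrow> P s x \<Longrightarrow> P t x"
  shows "\<exists>s. \<forall>t x. s \<sqsubseteq> t \<longrightarrow> x \<sqsubset> m \<longrightarrow> (P t x \<longleftrightarrow> (\<exists>u. P u x))"
proof -
  have P': "D1 (\<lambda>w. P (f w) (g w))" if "Fn f" "Fn g" for f g using D1_comp2[OF P] that by blast
  have "S1 (\<lambda>x. \<exists>u. P u x)" by (intro S1_ex D1_S1[OF P'] Fn_intros)
  then obtain c where c: "\<And>x. x \<epsilon> c \<longleftrightarrow> x \<sqsubset> m \<and> (\<exists>u. P u x)" by (rule comprehension[of _ m]) blast
  have "S1 (\<lambda>w. fs w \<epsilon> c \<longrightarrow> P (sn w) (fs w))" by (intro D1_S1) (intro D1_intros P' Fn_intros)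
  moreover have "\<exists>s. x \<epsilon> c \<longrightarrow> P s x" for x using c by blast
  ultimately obtain z where z: "\<And>x. x \<sqsubset> m \<Longrightarrow> \<exists>s. s \<sqsubset> z \<and> (x \<epsilon> c \<longrightarrow> P s x)"
    using collection_S1[of "\<lambda>x s. x \<epsilon> c \<longrightarrow> P s x" m] by blast
  have "P t x \<longleftrightarrow> (\<exists>u. P u x)" if zt: "z \<sqsubseteq> t" and xm: "x \<sqsubset> m" for t x
  proof
    assume "\<exists>u. P u x"
    then obtain s where "s \<sqsubset> z" "P s x" using z[OF xm] c xm by blast
    moreover from this have "s \<sqsubseteq> t" using zt by order
    ultimately show "P t x" using mono by blast
  qed blast
  then show ?thesis by blast
qed

end

section \<open>Verification\<close>

locale construction = enumeration +
  fixes h :: "'a \<Rightarrow> 'a"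
  assumes Fn_h: "Fn h" and h_eq: "h s = (if \<exists>a. sel h s a then ord.Least (sel h s) else \<zero>)"
begin

definition act where "act s \<longleftrightarrow> kd (h s) \<noteq> num 0"
definition enters where "enters t d \<longleftrightarrow> kd (h t) = num 1 \<and> dt (h t) = d"
definition removes where "removes t d \<longleftrightarrow> kd (h t) = num 3 \<and> d \<epsilon> dt (h t)"

abbreviation E where "E \<equiv> En h"
abbreviation R where "R \<equiv> Rm h"
abbreviation D where "D \<equiv> Dd h"

lemma hist: "Fn (\<lambda>u. (\<lambda>_. h) (fs u) (sn u))"
  using Fn_comp[OF Fn_h Fn_sn_base] .

lemma Fn_h_comp: "Fn t \<Longrightarrow> Fn (\<lambda>w. h (t w))"
  by (rule Fn_comp[OF Fn_h])

lemma D1_D: "Fn s \<Longrightarrow> Fn d \<Longrightarrow> D1 (\<lambda>w. D (s w) (d w))"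
  and D1_E: "Fn s \<Longrightarrow> Fn d \<Longrightarrow> D1 (\<lambda>w. E (s w) (d w))"
  and D1_R: "Fn s \<Longrightarrow> Fn d \<Longrightarrow> D1 (\<lambda>w. R (s w) (d w))"
  and D1_A: "Fn s \<Longrightarrow> Fn d \<Longrightarrow> D1 (\<lambda>w. Aa h (s w) (d w))"
  and D1_claim_h: "Fn i \<Longrightarrow> Fn s \<Longrightarrow> Fn m \<Longrightarrow> Fn n \<Longrightarrow> D1 (\<lambda>w. claim h (i w) (s w) (m w) (n w))"
  and D1_permits_h: "Fn i \<Longrightarrow> Fn s \<Longrightarrow> Fn m \<Longrightarrow> D1 (\<lambda>w. permits h (i w) (s w) (m w))"
  and D1_fails_h: "Fn i \<Longrightarrow> Fn s \<Longrightarrow> Fn m \<Longrightarrow> D1 (\<lambda>w. fails h (i w) (s w) (m w))"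
  and D1_att_h: "Fn s \<Longrightarrow> Fn a \<Longrightarrow> D1 (\<lambda>w. att h (s w) (a w))"
  by (rule D1_Dd[OF hist Fn_const] D1_En[OF hist Fn_const] D1_Rm[OF hist Fn_const]
      D1_Aa[OF hist Fn_const] D1_claim[OF hist Fn_const] D1_permits[OF hist Fn_const]
      D1_fails[OF hist Fn_const] D1_att[OF hist Fn_const]; assumption)+

lemma kd_zero: "kd \<zero> = num 0"
  using fs_le[of \<zero>] by (simp add: kd_def num.simps le_def)

lemma act_sel: "act s \<Longrightarrow> sel h s (h s)"
proof -
  assume "act s"
  then have "\<exists>a. sel h s a" using h_eq[of s] kd_zero unfolding act_def by metis
  moreover have "S1 (sel h s)" unfolding sel_def by (intro D1_S1) (intro D1_intros D1_att_h Fn_lv Fn_intros)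
  ultimately show ?thesis using least_holds h_eq[of s] by metis
qed

lemma act_att: "act s \<Longrightarrow> att h s (h s)" and act_lt: "act s \<Longrightarrow> h s \<sqsubset> s"
  using act_sel unfolding sel_def by blast+

lemma att_act:
  assumes "att h s a" "a \<sqsubset> s"
  shows "act s \<and> lv (h s) \<sqsubseteq> lv a"
proof -
  let ?P = "\<lambda>l. \<exists>b. b \<sqsubset> s \<and> att h s b \<and> lv b = l"
  have "S1 ?P" by (intro D1_S1) (intro D1_intros D1_att_h Fn_lv Fn_intros)
  then obtain l where "?P l" "\<And>l'. ?P l' \<Longrightarrow> l \<sqsubseteq> l'" using least_S1[of ?P "lv a"] assms by blast
  then have ex: "\<exists>b. sel h s b" unfolding sel_def by blast
  moreover have "S1 (sel h s)" unfolding sel_def by (intro D1_S1) (intro D1_intros D1_att_h Fn_lv Fn_intros)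
  ultimately have sel: "sel h s (h s)" using least_holds h_eq[of s] by metis
  then have "act s" unfolding sel_def att_def act_def by auto
  then show ?thesis using sel assms unfolding sel_def by blast
qed

lemma enters_act: "enters t d \<Longrightarrow> act t" and removes_act: "removes t d \<Longrightarrow> act t"
  unfolding enters_def removes_def act_def by auto

lemma enters_attN: "enters t d \<Longrightarrow> attN h t (lv (h t)) d"
  using act_att[of t] enters_act[of t d] unfolding att_def enters_def by auto

lemma removes_attW: "kd (h t) = num 3 \<Longrightarrow> attW h t (lv (h t)) (dt (h t))"
  using act_att[of t] unfolding att_def act_def by auto

lemma fail_attF: "kd (h t) = num 2 \<Longrightarrow> attF h t (lv (h t)) (fs (dt (h t))) (sn (dt (h t)))"
  using act_att[of t] unfolding att_def act_def by auto

lemma E_iff: "E s d \<longleftrightarrow> (\<exists>t. t \<sqsubset> s \<and> enters t d)"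
  and R_iff: "R s d \<longleftrightarrow> (\<exists>t. t \<sqsubset> s \<and> removes t d \<and> E t d)"
  unfolding En_def Rm_def enters_def removes_def by auto

lemma E_mono: "s \<sqsubseteq> t \<Longrightarrow> E s d \<Longrightarrow> E t d" and R_mono: "s \<sqsubseteq> t \<Longrightarrow> R s d \<Longrightarrow> R t d"
  unfolding E_iff R_iff using ord.order.strict_trans2 by blast+

lemma D_iff: "D s d \<longleftrightarrow> E s d \<and> \<not> R s d"
  by (simp add: Dd_def)

lemma D_back: "D t d \<Longrightarrow> E s d \<Longrightarrow> s \<sqsubseteq> t \<Longrightarrow> D s d"
  using R_mono by (auto simp: D_iff)

lemma R_imp_E: "R s d \<Longrightarrow> E s d"
  unfolding R_iff using E_mono by (auto intro: ord.less_imp_le)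

lemma clean_sub: "clean h q t s \<Longrightarrow> t \<sqsubseteq> t' \<Longrightarrow> s' \<sqsubseteq> s \<Longrightarrow> clean h q t' s'"
  and cleanI_sub: "cleanI h q t s \<Longrightarrow> t \<sqsubseteq> t' \<Longrightarrow> s' \<sqsubseteq> s \<Longrightarrow> cleanI h q t' s'"
  unfolding clean_def cleanI_def by (blast intro: ord.order.trans ord.order.strict_trans2)+

lemma cleanI_join: "cleanI h q t s \<Longrightarrow> cleanI h q s u \<Longrightarrow> cleanI h q t u"
  unfolding cleanI_def using ord.not_le by blast

lemma enters_form:
  assumes "enters t d"
  shows "lv (h t) = fs d" "sn d \<sqsubseteq> t" "clean h (fs d) (sn d) t"
proof -
  obtain u where "u \<sqsubset> t \<oplus> \<one>" "d = pr (lv (h t)) u" "clean h (lv (h t)) u t"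
    using enters_attN[OF assms] unfolding attN_def by blast
  then show "lv (h t) = fs d" "sn d \<sqsubseteq> t" "clean h (fs d) (sn d) t" by (simp_all add: le_suc_iff)
qed

text \<open>A witness fixes its level, and its second entry presupposes that no smaller level acted
  since the stage in its name. So the first entry would still be in force and block the
  second.\<close>

lemma enters_once: "enters t d \<Longrightarrow> enters t' d \<Longrightarrow> \<not> t \<sqsubset> t'"
proof
  assume *: "enters t d" "enters t' d" "t \<sqsubset> t'"
  have "\<not> clean h (lv (h t')) t t'"
    using enters_attN[OF *(2)] *(1,3) enters_form(1)[OF *(1)] enters_form(1)[OF *(2)]
    unfolding attN_def enters_def by simp
  moreover have "clean h (fs d) t t'"
    using clean_sub[OF enters_form(3)[OF *(2)] enters_form(2)[OF *(1)]] by simp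
  ultimately show False using enters_form(1)[OF *(2)] by simp
qed

lemma enters_fresh:
  assumes "enters t d" "v \<sqsubset> t" "act v" "lv (h v) \<sqsubset> lv (h t)"
  shows "v \<sqsubset> d"
proof -
  have "\<not> sn d \<sqsubseteq> v" using enters_form[OF assms(1)] assms(2-4) unfolding clean_def act_def by auto
  then have "v \<sqsubset> sn d" by (simp add: ord.not_le)
  then show ?thesis using sn_le[of d] by order
qed

lemma fail_facts:
  assumes "kd (h t) = num 2"
  obtains s' where "s' \<sqsubseteq> t" "cleanI h (lv (h t)) s' t"
    "\<And>u. u \<sqsubset> t \<Longrightarrow> s' \<sqsubseteq> u \<Longrightarrow> lv (h u) = lv (h t) \<Longrightarrow> kd (h u) \<noteq> num 2"
    "refuted h (lv (h t)) s' t (sn (dt (h t)))"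
  using fail_attF[OF assms] unfolding attF_def by (auto simp: le_suc_iff)

lemma comput_lt:
  assumes "comput s e p n p' n'"
  shows "p \<sqsubset> s" "n \<sqsubset> s" "p' \<sqsubset> s" "n' \<sqsubset> s"
proof -
  have q: "quad p n p' n' \<sqsubset> s" using assms W_lt by (simp add: comput_def)
  have "p \<sqsubseteq> pr p n" "n \<sqsubseteq> pr p n" "pr p n \<sqsubseteq> quad p n p' n'" "p' \<sqsubseteq> pr p' n'" "n' \<sqsubseteq> pr p' n'"
    "pr p' n' \<sqsubseteq> quad p n p' n'" unfolding quad_def by (rule le_pr)+
  then show "p \<sqsubset> s" "n \<sqsubset> s" "p' \<sqsubset> s" "n' \<sqsubset> s" using q by order+
qed

section \<open>Removals and preservation without restraints\<close>

lemma removal_clean: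
  assumes "removes u d" "D u d" "enters e d" "e \<sqsubset> u"
  shows "cleanI h (lv (h u)) e u"
proof -
  let ?q = "lv (h u)"
  obtain t where t: "t \<sqsubset> u" "fails h u ?q t" "sn (dt (h t)) = dt (h u)"
    using removes_attW[of u] assms(1) unfolding attW_def removes_def by blast
  have ft: "kd (h t) = num 2" "lv (h t) = ?q" "cleanI h ?q t u" using t(2) unfolding fails_def by auto
  obtain s' where s': "s' \<sqsubseteq> t" "cleanI h ?q s' t" "refuted h ?q s' t (dt (h u))"
    using fail_facts[OF ft(1)] unfolding ft(2) t(3) by blast
  \<comment> \<open>The element entered after the computation behind the failure was seen; from that
    stage on nothing of higher priority acted, or the failure would have been cancelled.\<close>
  have "\<not> D s' d" using s'(3) assms(1) unfolding refuted_def removes_def by blast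
  moreover have "D s' d" if "e \<sqsubset> s'"
  proof -
    have "E s' d" using assms(3) that E_iff by blast
    moreover have "s' \<sqsubseteq> u" using s'(1) t(1) by order
    ultimately show ?thesis using D_back assms(2) by blast
  qed
  ultimately have "s' \<sqsubseteq> e" using ord.not_le by blast
  then show ?thesis using cleanI_sub[OF cleanI_join[OF s'(2) ft(3)]] by simp
qed

text \<open>An action at t protects d from larger levels: by \<open>removal_clean\<close> nothing of
  higher priority lies between the entry and the removal of d, but t lies there. Hence only removals
  of level at most that of t have to be excluded separately.\<close>

lemma keep:
  assumes e: "enters e d" "e \<sqsubseteq> t" and t: "act t" "t \<sqsubset> s" "\<not> R (t \<oplus> \<one>) d"
    and no: "\<And>u. t \<sqsubset> u \<Longrightarrow> u \<sqsubset> s \<Longrightarrow> removes u d \<Longrightarrow> lv (h u) \<sqsubseteq> lv (h t) \<Longrightarrow>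
      (lv (h u) = lv (h t) \<Longrightarrow> kd (h t) \<noteq> num 1) \<Longrightarrow> False"
  shows "D s d"
proof -
  have es: "e \<sqsubset> s" using e(2) t(2) by order
  then have "E s d" using e(1) E_iff by blast
  moreover have "\<not> R s d"
  proof
    assume "R s d"
    let ?Q = "\<lambda>u. u \<sqsubset> s \<and> kd (h u) = num 3 \<and> d \<epsilon> dt (h u) \<and> E u d"
    have "S1 ?Q" by (intro D1_S1) (intro D1_intros D1_E Fn_kd Fn_dt Fn_h_comp Fn_intros)
    moreover have "\<exists>u. ?Q u" using \<open>R s d\<close> unfolding R_iff removes_def by blast
    \<comment> \<open>At the first removal d is still in \<open>D\<close>, as
      \<open>removal_clean\<close> requires.\<close>
    ultimately obtain u where u: "?Q u" "\<And>v. ?Q v \<Longrightarrow> u \<sqsubseteq> v" using least_S1[of ?Q] by blast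
    have r: "removes u d" using u(1) by (simp add: removes_def)
    have "\<not> R u d"
    proof
      assume "R u d"
      then obtain v where v: "v \<sqsubset> u" "removes v d" "E v d" unfolding R_iff by blast
      then have "?Q v" using u(1) lt_trans unfolding removes_def by blast
      then show False using u(2) v(1) ord.not_le by blast
    qed
    then have "D u d" using u(1) by (simp add: D_iff)
    have tu: "t \<sqsubset> u"
    proof (rule ccontr)
      assume "\<not> t \<sqsubset> u"
      then have "u \<sqsubset> t \<oplus> \<one>" by (simp add: le_suc_iff[symmetric])
      then show False using t(3) r u(1) R_iff by blast
    qed
    then have "e \<sqsubset> u" using e(2) by order
    have "cleanI h (lv (h u)) e u" using removal_clean[OF r \<open>D u d\<close> e(1) \<open>e \<sqsubset> u\<close>] .
    then have "\<not> lv (h t) \<sqsubset> lv (h u)" "\<not> (lv (h t) = lv (h u) \<and> kd (h t) = num 1)"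
      using tu e(2) t(1) unfolding cleanI_def act_def by blast+
    then show False using no[OF tu] u(1) r by (auto simp: ord.not_less)
  qed
  ultimately show ?thesis by (simp add: D_iff)
qed

text \<open>Positions are ordered by level, and within a level by witness, numbered failures,
  removal. An action remains in force until one at an earlier position occurs, and while in force it
  prevents a repetition; this is the hypothesis \<open>between\<close> of
  \<open>finite_acts\<close>.\<close>

lemma eventually_higher: "\<exists>S. \<forall>s. S \<sqsubseteq> s \<longrightarrow> act s \<longrightarrow> Q \<sqsubset> lv (h s)"
proof -
  \<comment> \<open>A level up to Q has at most 2^Q + 2 positions: 0 for the entry, r + 1 for
    failure number r < 2^Q, and 2^Q + 1 for the removal. Weights are counted down from
    \<open>N\<close> because higher priority must weigh more.\<close>
  define K where "K = \<e> Q \<oplus> \<one> \<oplus> \<one>"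
  define idx where "idx a = (if kd a = num 1 then \<zero> else if kd a = num 2 then fs (dt a) \<oplus> \<one> else \<e> Q \<oplus> \<one>)" for a
  define pos where "pos s = lv (h s) \<otimes> K \<oplus> idx (h s)" for s
  define N where "N = Q \<otimes> K \<oplus> K"
  define A where "A s \<longleftrightarrow> act s \<and> lv (h s) \<sqsubseteq> Q" for s
  have kinds: "kd (h s) = num 1 \<or> kd (h s) = num 2 \<or> kd (h s) = num 3" if "act s" for s
    using act_att[OF that] unfolding att_def by blast
  have r: "fs (dt (h s)) \<sqsubset> \<e> Q" if "A s" "kd (h s) = num 2" for s
  proof -
    have "fs (dt (h s)) \<sqsubset> \<e> (lv (h s))" using fail_attF[OF that(2)] unfolding attF_def by blast
    moreover have "\<e> (lv (h s)) \<sqsubseteq> \<e> Q" using that(1) exp_mono unfolding A_def by blast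
    ultimately show ?thesis by order
  qed
  have idx: "idx (h s) \<sqsubset> K" if "A s" for s
    using r[OF that] unfolding idx_def K_def by (auto intro: lt_trans[OF _ lt_suc])
  have pos_lt: "pos s \<sqsubset> pos t" if "A s" "lv (h s) \<sqsubset> lv (h t)" for s t
  proof -
    have "pos s \<sqsubset> lv (h s) \<otimes> K \<oplus> K" using idx[OF that(1)] by (simp add: pos_def)
    also have "\<dots> = (lv (h s) \<oplus> \<one>) \<otimes> K" by (simp add: ar.distrib_right)
    also have "\<dots> \<sqsubseteq> lv (h t) \<otimes> K" using that(2) by (simp add: ar.mult_right_mono suc_le_iff)
    also have "\<dots> \<sqsubseteq> pos t" by (simp add: pos_def)
    finally show ?thesis .
  qed
  have pos_N: "pos s \<sqsubset> N" if "A s" for s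
  proof -
    have "lv (h s) \<otimes> K \<sqsubseteq> Q \<otimes> K" using that by (simp add: A_def ar.mult_right_mono)
    then show ?thesis using idx[OF that] unfolding pos_def N_def by (simp add: ar.add_le_less_mono)
  qed
  have "\<exists>S. \<forall>s. S \<sqsubseteq> s \<longrightarrow> \<not> A s"
  proof (rule finite_acts[where wt = "\<lambda>s. N \<ominus> pos s"])
    show "D1 A" unfolding A_def act_def by (intro D1_intros Fn_kd Fn_lv Fn_h_comp Fn_intros)
    show "Fn (\<lambda>s. N \<ominus> pos s)" unfolding pos_def idx_def
      by (intro Fn_mns D1_intros Fn_kd Fn_lv Fn_dt Fn_h_comp Fn_intros)
    show "N \<ominus> pos s \<sqsubset> N \<oplus> \<one>" if "A s" for s
    proof -
      have "N \<ominus> pos s \<sqsubseteq> N" using pos_N[OF that] ar.le_add_diff_inverse2[of "pos s" N] le_add1[of "N \<ominus> pos s" "pos s"]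
        by (simp add: ord.less_imp_le)
      then show ?thesis by (simp add: le_suc_iff[symmetric])
    qed
    fix s t assume s: "A s" and t: "A t" and st: "s \<sqsubset> t" and eq: "N \<ominus> pos s = N \<ominus> pos t"
    have "pos s = pos t"
      using pos_N[OF s] pos_N[OF t] eq ar.le_add_diff_inverse2 ord.less_imp_le by (metis add_cancel')
    then have lv: "lv (h s) = lv (h t)" and ix: "idx (h s) = idx (h t)"
      using division_unique[OF _ idx[OF s] idx[OF t]] unfolding pos_def by blast+
    have kd: "kd (h s) = kd (h t)"
      using ix kinds[of s] kinds[of t] s t r[OF s] r[OF t] lt_irrefl
      unfolding idx_def A_def
      by (auto split: if_splits simp: lt_suc_iff suc_not_zero suc_not_zero[symmetric])
    have "\<exists>u. s \<sqsubset> u \<and> u \<sqsubset> t \<and> A u \<and> pos u \<sqsubset> pos s"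
    proof (cases "kd (h t) = num 1")
      case True
      then have "\<not> clean h (lv (h t)) s t"
        using enters_attN[of t "dt (h t)"] st kd lv unfolding attN_def enters_def by simp
      then obtain u where u: "u \<sqsubset> t" "s \<sqsubseteq> u" "act u" "lv (h u) \<sqsubset> lv (h s)"
        unfolding clean_def act_def lv by blast
      then have "s \<sqsubset> u" "A u" using s lt_irrefl unfolding A_def by (auto simp: le_def intro: lt_trans)
      then show ?thesis using u pos_lt by blast
    next
      case False
      have "\<not> cleanI h (lv (h t)) s t"
      proof
        assume c: "cleanI h (lv (h t)) s t"
        show False
        proof (cases "kd (h t) = num 2")
          case True
          have "fails h t (lv (h t)) s" using c kd lv True unfolding fails_def by simp
          then have "fs (dt (h s)) \<sqsubset> fs (dt (h t))" using fail_attF[OF True] st unfolding attF_def by blast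
          then show False using ix True kd lt_irrefl unfolding idx_def by simp
        next
          case F: False
          then have "kd (h t) = num 3" using kinds[of t] t False unfolding A_def by blast
          then show False using removes_attW[of t] c kd lv st unfolding attW_def won_def by metis
        qed
      qed
      then obtain u where u: "u \<sqsubset> t" "s \<sqsubseteq> u" "act u"
        "lv (h u) \<sqsubset> lv (h s) \<or> (lv (h u) = lv (h s) \<and> kd (h u) = num 1)"
        unfolding cleanI_def act_def lv by blast
      have us: "u \<noteq> s" using u(4) False kd lt_irrefl by metis
      then have "s \<sqsubset> u" using u(2) by (simp add: le_def)
      have Au: "A u" using u(3,4) s unfolding A_def by (auto intro: lt_trans simp: le_def)
      have "pos u \<sqsubset> pos s" if "lv (h u) = lv (h s)" "kd (h u) = num 1"
        using that False kd unfolding pos_def idx_def by simp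
      then show ?thesis using u pos_lt[OF Au] Au \<open>s \<sqsubset> u\<close> by blast
    qed
    then obtain u where u: "s \<sqsubset> u" "u \<sqsubset> t" "A u" "pos u \<sqsubset> pos s" by blast
    then have "N \<ominus> pos s \<sqsubset> N \<ominus> pos u" using mns_less pos_N[OF s] ord.less_imp_le by blast
    then show "\<exists>u. s \<sqsubset> u \<and> u \<sqsubset> t \<and> A u \<and> N \<ominus> pos s \<sqsubset> N \<ominus> pos u" using u by blast
  qed
  then show ?thesis unfolding A_def using ord.not_le by blast
qed

end

section \<open>Reducibilities\<close>

context isigma1
begin

lemma info_iff: "info_about M X p n \<longleftrightarrow> (\<forall>x. x \<epsilon> p \<longrightarrow> x \<in> X) \<and> (\<forall>x. x \<epsilon> n \<longrightarrow> x \<notin> X)"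
  unfolding info_about_def by blast

definition q1 where "q1 w = fs (fs w)"
definition q2 where "q2 w = sn (fs w)"
definition q3 where "q3 w = fs (sn w)"
definition q4 where "q4 w = sn (sn w)"

lemma proj_quad [simp]: "q1 (quad p n p' n') = p" "q2 (quad p n p' n') = n"
  "q3 (quad p n p' n') = p'" "q4 (quad p n p' n') = n'"
  by (simp_all add: q1_def q2_def q3_def q4_def quad_def)

lemma Fn_q1: "Fn f \<Longrightarrow> Fn (\<lambda>w. q1 (f w))" and Fn_q2: "Fn f \<Longrightarrow> Fn (\<lambda>w. q2 (f w))"
  and Fn_q3: "Fn f \<Longrightarrow> Fn (\<lambda>w. q3 (f w))" and Fn_q4: "Fn f \<Longrightarrow> Fn (\<lambda>w. q4 (f w))"
  unfolding q1_def q2_def q3_def q4_def by (auto intro!: Fn_fs Fn_sn)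

lemma Fn_quad: "Fn f \<Longrightarrow> Fn g \<Longrightarrow> Fn k \<Longrightarrow> Fn l \<Longrightarrow> Fn (\<lambda>w. quad (f w) (g w) (k w) (l w))"
  unfolding quad_def by (intro Fn_pr)

lemmas Q_intros = Fn_q1 Fn_q2 Fn_q3 Fn_q4 Fn_quad Fn_intros

lemma turing_leI:
  assumes "S1 P"
    and "\<And>p n. info_about M X p n \<longleftrightarrow> (\<exists>p' n'. P (quad p n p' n') \<and> info_about M Y p' n')"
  shows "turing_le M X Y"
  unfolding turing_le_def
  by (rule exI[of _ "{[p, n, p', n'] | p n p' n'. P (quad p n p' n')}"])
    (simp add: Sigma1_definable_4I[OF assms(1)] assms(2))

lemma turing_leE:
  assumes "turing_le M X Y"
  obtains P where "S1 P"
    "\<And>p n. info_about M X p n \<longleftrightarrow> (\<exists>p' n'. P (quad p n p' n') \<and> info_about M Y p' n')"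
  using assms Sigma1_definable_4D unfolding turing_le_def by metis

lemma turing_le_refl: "turing_le M X X"
proof (rule turing_leI)
  show "S1 (\<lambda>w. q1 w = q3 w \<and> q2 w = q4 w)" by (intro D1_S1) (intro D1_intros Q_intros)
qed auto

lemma turing_le_trans:
  assumes "turing_le M X Y" "turing_le M Y Z"
  shows "turing_le M X Z"
proof -
  obtain P where P: "S1 P"
    "\<And>p n. info_about M X p n \<longleftrightarrow> (\<exists>p' n'. P (quad p n p' n') \<and> info_about M Y p' n')"
    using turing_leE[OF assms(1)] by blast
  obtain Q where Q: "S1 Q"
    "\<And>p n. info_about M Y p n \<longleftrightarrow> (\<exists>p' n'. Q (quad p n p' n') \<and> info_about M Z p' n')"
    using turing_leE[OF assms(2)] by blast
  show ?thesis
  proof (rule turing_leI)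
    show "S1 (\<lambda>w. \<exists>a b. P (quad (q1 w) (q2 w) a b) \<and> Q (quad a b (q3 w) (q4 w)))"
      by (intro S1_ex S1_conj S1_comp[OF P(1)] S1_comp[OF Q(1)] Q_intros)
  qed (simp add: P(2) Q(2), blast)
qed

lemma deg_le_class:
  "deg_le M (turing_eq M `` {X}) (turing_eq M `` {Y}) \<longleftrightarrow> turing_le M X Y"
  unfolding deg_le_def turing_eq_def using turing_le_refl turing_le_trans by blast

lemma equiv_turing_eq: "equiv UNIV (turing_eq M)"
  unfolding equiv_def refl_on_def sym_def trans_def turing_eq_def
  using turing_le_refl turing_le_trans by blast

lemma class_degree: "turing_eq M `` {X} \<in> degrees M" "X \<in> turing_eq M `` {X}"
  using quotientI[of X UNIV "turing_eq M"] turing_le_refl by (simp_all add: degrees_def turing_eq_def)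

lemma degree_class: "c \<in> degrees M \<Longrightarrow> X \<in> c \<Longrightarrow> c = turing_eq M `` {X}"
  unfolding degrees_def using equiv_turing_eq by (metis Image_singleton_iff equiv_class_eq quotientE)

end

context construction
begin

section \<open>The sets D, A and B as limits of their stages\<close>

definition DL where "DL = {d. (\<exists>s. E s d) \<and> \<not> (\<exists>s. R s d)}"
definition AL where "AL = {x. \<exists>s. Aa h s x}"
definition BL where "BL = {x. \<exists>t. x = pr (fs x) (sn x) \<and> sn x \<sqsubseteq> t \<and> D t (fs x) \<noteq> D (sn x) (fs x)}"

lemma dce_DL: "dce M DL"
proof -
  have "S1 (\<lambda>d. \<exists>s. E s d)" "S1 (\<lambda>d. \<exists>s. R s d)"
    by (intro S1_ex D1_S1[OF D1_E] D1_S1[OF D1_R] Fn_intros)+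
  then have "ce M {d. \<exists>s. E s d}" "ce M {d. \<exists>s. R s d}" by (simp_all add: ce_iff)
  moreover have "DL = {d. \<exists>s. E s d} - {d. \<exists>s. R s d}" by (auto simp: DL_def)
  ultimately show ?thesis unfolding dce_def by blast
qed

lemma S1_AL: "Fn f \<Longrightarrow> S1 (\<lambda>w. f w \<in> AL)"
proof -
  have "S1 (\<lambda>x. x \<in> AL)" unfolding AL_def mem_Collect_eq by (intro S1_ex D1_S1[OF D1_A] Fn_intros)
  then show "Fn f \<Longrightarrow> S1 (\<lambda>w. f w \<in> AL)" using S1_comp[of "\<lambda>x. x \<in> AL"] by blast
qed

lemma S1_BL: "Fn f \<Longrightarrow> S1 (\<lambda>w. f w \<in> BL)"
proof -
  have "S1 (\<lambda>x. x \<in> BL)" unfolding BL_def mem_Collect_eq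
    by (intro S1_ex D1_S1) (intro D1_intros D1_D Fn_intros)
  then show "Fn f \<Longrightarrow> S1 (\<lambda>w. f w \<in> BL)" using S1_comp[of "\<lambda>x. x \<in> BL"] by blast
qed

lemma AL_pr: "pr d u \<in> AL \<longleftrightarrow> D u d \<and> (\<exists>s. u \<sqsubseteq> s \<and> \<not> D s d)"
  unfolding AL_def Aa_def by (auto simp: le_suc_iff[symmetric])

lemma AL_cases: "x \<in> AL \<Longrightarrow> \<exists>d u. x = pr d u"
  unfolding AL_def Aa_def by blast

lemma BL_pr: "pr d u \<in> BL \<longleftrightarrow> (\<exists>t. u \<sqsubseteq> t \<and> D t d \<noteq> D u d)"
  unfolding BL_def by simp

lemma BL_cases: "x \<in> BL \<Longrightarrow> \<exists>d u. x = pr d u"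
  unfolding BL_def by blast

lemma D_keep: "D u d \<Longrightarrow> u \<sqsubseteq> s \<Longrightarrow> d \<in> DL \<Longrightarrow> D s d"
  using E_mono by (auto simp: D_iff DL_def)

lemma DL_I:
  assumes "\<And>s. u \<sqsubseteq> s \<Longrightarrow> D s d"
  shows "d \<in> DL"
proof -
  have "E u d" using assms[of u] by (simp add: D_iff)
  moreover have "\<not> R s d" for s
  proof
    assume "R s d"
    then have "R (u \<oplus> s) d" using R_mono le_add2 by blast
    then show False using assms[of "u \<oplus> s"] by (simp add: D_iff)
  qed
  ultimately show ?thesis unfolding DL_def by blast
qed

lemma not_DL_I:
  assumes "\<And>s. u \<sqsubseteq> s \<Longrightarrow> \<not> D s d"
  shows "d \<notin> DL"
proof
  assume d: "d \<in> DL"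
  then obtain s where "E s d" unfolding DL_def by blast
  then have "E (u \<oplus> s) d" using E_mono le_add2 by blast
  then show False using assms[of "u \<oplus> s"] d by (auto simp: D_iff DL_def)
qed

lemma D_settle: "\<exists>s. \<forall>t x. s \<sqsubseteq> t \<longrightarrow> x \<sqsubset> m \<longrightarrow> (D t x \<longleftrightarrow> x \<in> DL)"
proof -
  obtain a where a: "\<And>t x. a \<sqsubseteq> t \<Longrightarrow> x \<sqsubset> m \<Longrightarrow> E t x \<longleftrightarrow> (\<exists>u. E u x)"
    using settle[of E m] D1_E[OF Fn_fs_base Fn_sn_base] E_mono by blast
  obtain b where b: "\<And>t x. b \<sqsubseteq> t \<Longrightarrow> x \<sqsubset> m \<Longrightarrow> R t x \<longleftrightarrow> (\<exists>u. R u x)"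
    using settle[of R m] D1_R[OF Fn_fs_base Fn_sn_base] R_mono by blast
  have "D t x \<longleftrightarrow> x \<in> DL" if "a \<oplus> b \<sqsubseteq> t" "x \<sqsubset> m" for t x
  proof -
    have "a \<sqsubseteq> t" "b \<sqsubseteq> t" using that(1) le_add1[of a b] le_add2[of b a] by order+
    then show ?thesis using a b that(2) by (simp add: D_iff DL_def)
  qed
  then show ?thesis by blast
qed

lemma comput_mono: "s \<sqsubseteq> t \<Longrightarrow> comput s e p n p' n' \<Longrightarrow> comput t e p n p' n'"
  and wset_mono: "s \<sqsubseteq> t \<Longrightarrow> wset s e x \<Longrightarrow> wset t e x"
  unfolding comput_def wset_def using W_mono by blast+

lemma wset_settle: "\<exists>s. \<forall>t x. s \<sqsubseteq> t \<longrightarrow> x \<sqsubset> m \<longrightarrow> (wset t i x \<longleftrightarrow> (\<exists>u. wset u i x))"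
  using settle[of "\<lambda>s x. wset s i x" m] D1_wset[OF Fn_fs_base Fn_const Fn_sn_base, of i] wset_mono by blast

lemma ex_index:
  assumes "S1 P" "S1 (\<lambda>x. x \<in> X)"
  shows "\<exists>q. (\<forall>p n p' n'. P (quad p n p' n') = (\<exists>s. comput s q p n p' n')) \<and> (\<forall>x. (x \<in> X) = (\<exists>s. wset s q x))"
proof -
  from W_univ[OF assms(1)] obtain a where "\<forall>x. P x \<longleftrightarrow> (\<exists>s. W s a x)" ..
  moreover from W_univ[OF assms(2)] obtain b where "\<forall>x. x \<in> X \<longleftrightarrow> (\<exists>s. W s b x)" ..
  ultimately show ?thesis by (intro exI[of _ "pr a b"]) (simp add: comput_def wset_def)
qed

text \<open>Positive facts about \<open>AL\<close> are enumerated. As elements never return after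
  removal, a pair (d, u) with d in \<open>D\<close> at stage u is outside \<open>AL\<close> exactly
  if d is in \<open>DL\<close>; all other numbers are outside anyway.\<close>

lemma A_le_D: "turing_le M AL DL"
proof (rule turing_leI)
  let ?c = "\<lambda>n p'. \<forall>z. z \<epsilon> n \<longrightarrow> z = pr (fs z) (sn z) \<and> D (sn z) (fs z) \<longrightarrow> fs z \<epsilon> p'"
  show "S1 (\<lambda>w. (\<forall>x. x \<epsilon> q1 w \<longrightarrow> x \<in> AL) \<and> ?c (q2 w) (q3 w))"
    by (intro S1_conj S1_ball_mem S1_AL D1_S1[OF D1_ball_mem] D1_imp D1_conj D1_eq D1_mem D1_D Q_intros)
  fix p n
  show "info_about M AL p n \<longleftrightarrow> (\<exists>p' n'. ((\<forall>x. x \<epsilon> q1 (quad p n p' n') \<longrightarrow> x \<in> AL) \<and>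
     ?c (q2 (quad p n p' n')) (q3 (quad p n p' n'))) \<and> info_about M DL p' n')"
  proof (unfold proj_quad, rule iffI)
    assume info: "info_about M AL p n"
    have "S1 (\<lambda>d. \<exists>z. z \<epsilon> n \<and> z = pr (fs z) (sn z) \<and> D (sn z) (fs z) \<and> fs z = d)"
      by (intro D1_S1) (intro D1_intros D1_D Fn_intros)
    then obtain p' where p': "\<And>d. d \<epsilon> p' \<longleftrightarrow> d \<sqsubset> n \<and>
        (\<exists>z. z \<epsilon> n \<and> z = pr (fs z) (sn z) \<and> D (sn z) (fs z) \<and> fs z = d)"
      by (rule comprehension[of _ n]) blast
    have "fs z \<sqsubset> n" if "z \<epsilon> n" for z using mem_lt[OF that] fs_le[of z] by order
    then have "?c n p'" using p' by blast
    moreover have "d \<in> DL" if "d \<epsilon> p'" for d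
    proof -
      from p'[THEN iffD1, OF \<open>d \<epsilon> p'\<close>] obtain z where z: "z \<epsilon> n" "z = pr (fs z) (sn z)" "D (sn z) (fs z)" "fs z = d"
        by (elim conjE exE)
      note z = z[unfolded z(4)]
      have "z \<notin> AL" using info z(1) unfolding info_iff by blast
      then have "pr d (sn z) \<notin> AL" unfolding z(2)[symmetric] .
      then show ?thesis using z(3) AL_pr by (intro DL_I[of "sn z"]) blast
    qed
    then have "info_about M DL p' \<zero>" by (simp add: info_iff)
    ultimately show "\<exists>p' n'. ((\<forall>x. x \<epsilon> p \<longrightarrow> x \<in> AL) \<and> ?c n p') \<and> info_about M DL p' n'"
      using info unfolding info_iff by blast
  next
    assume "\<exists>p' n'. ((\<forall>x. x \<epsilon> p \<longrightarrow> x \<in> AL) \<and> ?c n p') \<and> info_about M DL p' n'"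
    then obtain p' where p': "\<forall>x. x \<epsilon> p \<longrightarrow> x \<in> AL" "?c n p'" "\<forall>x. x \<epsilon> p' \<longrightarrow> x \<in> DL"
      unfolding info_iff by blast
    have "z \<notin> AL" if "z \<epsilon> n" for z
    proof
      assume "z \<in> AL"
      then obtain d u where z: "z = pr d u" using AL_cases by blast
      then have du: "D u d" "\<exists>s. u \<sqsubseteq> s \<and> \<not> D s d" using \<open>z \<in> AL\<close> AL_pr by blast+
      have "d \<epsilon> p'" using p'(2)[rule_format, OF \<open>z \<epsilon> n\<close>] z du(1) by simp
      then show False using p'(3) du D_keep by blast
    qed
    then show "info_about M AL p n" using p'(1) unfolding info_iff by blast
  qed
qed

text \<open>One stage s serves a whole M-finite set: if no (d, s) is in \<open>BL\<close>, then
  stage s already decides all d. Such an s exists by \<open>D_settle\<close>.\<close>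

lemma D_le_B: "turing_le M DL BL"
proof (rule turing_leI)
  let ?c = "\<lambda>p n n' s. (\<forall>d. d \<epsilon> p \<longrightarrow> D s d \<and> pr d s \<epsilon> n') \<and> (\<forall>d. d \<epsilon> n \<longrightarrow> \<not> D s d \<and> pr d s \<epsilon> n')"
  show "S1 (\<lambda>w. \<exists>s. ?c (q1 w) (q2 w) (q4 w) s)"
    by (intro S1_ex D1_S1) (intro D1_intros D1_D Q_intros)
  fix p n
  show "info_about M DL p n \<longleftrightarrow> (\<exists>p' n'. (\<exists>s. ?c (q1 (quad p n p' n')) (q2 (quad p n p' n')) (q4 (quad p n p' n')) s)
     \<and> info_about M BL p' n')"
  proof (unfold proj_quad, rule iffI)
    assume info: "info_about M DL p n"
    obtain s where s: "\<And>t x. s \<sqsubseteq> t \<Longrightarrow> x \<sqsubset> p \<oplus> n \<Longrightarrow> D t x \<longleftrightarrow> x \<in> DL" using D_settle[of "p \<oplus> n"] by blast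
    have lt: "d \<sqsubset> p \<oplus> n" if "d \<epsilon> p \<or> d \<epsilon> n" for d
      using that mem_lt[of d p] mem_lt[of d n] le_add1[of p n] le_add2[of n p]
      by (meson ord.order.strict_trans2)
    have "S1 (\<lambda>z. \<exists>d. d \<sqsubset> p \<oplus> n \<and> (d \<epsilon> p \<or> d \<epsilon> n) \<and> z = pr d s)" by (intro D1_S1) (intro D1_intros Fn_intros)
    then obtain n' where n': "\<And>z. z \<epsilon> n' \<longleftrightarrow> z \<sqsubset> pr (p \<oplus> n) s \<oplus> \<one> \<and> (\<exists>d. d \<sqsubset> p \<oplus> n \<and> (d \<epsilon> p \<or> d \<epsilon> n) \<and> z = pr d s)"
      by (rule comprehension[of _ "pr (p \<oplus> n) s \<oplus> \<one>"]) blast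
    have in': "pr d s \<epsilon> n'" if "d \<epsilon> p \<or> d \<epsilon> n" for d
    proof -
      have "pr d s \<sqsubseteq> pr (p \<oplus> n) s" using pr_mono lt[OF that] by (simp add: ord.less_imp_le)
      then show ?thesis using n' lt[OF that] that by (auto simp: le_suc_iff)
    qed
    have "?c p n n' s" using in' s[of s] lt info unfolding info_iff by simp
    moreover have "z \<notin> BL" if "z \<epsilon> n'" for z
    proof -
      obtain d where "d \<sqsubset> p \<oplus> n" "z = pr d s" using n' \<open>z \<epsilon> n'\<close> by blast
      then show ?thesis using s BL_pr by simp
    qed
    then have "info_about M BL \<zero> n'" by (simp add: info_iff)
    ultimately show "\<exists>p' n'. (\<exists>s. ?c p n n' s) \<and> info_about M BL p' n'" by blast
  next
    assume "\<exists>p' n'. (\<exists>s. ?c p n n' s) \<and> info_about M BL p' n'"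
    then obtain n' s where s: "?c p n n' s" "\<forall>z. z \<epsilon> n' \<longrightarrow> z \<notin> BL" unfolding info_iff by blast
    have const: "D t d \<longleftrightarrow> D s d" if "pr d s \<epsilon> n'" "s \<sqsubseteq> t" for t d using s(2) that BL_pr by blast
    have "d \<in> DL" if "d \<epsilon> p" for d using s(1) const \<open>d \<epsilon> p\<close> by (intro DL_I[of s]) blast
    moreover have "d \<notin> DL" if "d \<epsilon> n" for d using s(1) const \<open>d \<epsilon> n\<close> by (intro not_DL_I[of s]) blast
    ultimately show "info_about M DL p n" unfolding info_iff by blast
  qed
qed

lemma D_not_le_A: "\<not> turing_le M DL AL"
proof
  assume "turing_le M DL AL"
  then obtain P where P: "S1 P"
    "\<And>p n. info_about M DL p n \<longleftrightarrow> (\<exists>p' n'. P (quad p n p' n') \<and> info_about M AL p' n')"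
    using turing_leE by blast
  from ex_index[OF P(1) S1_AL[OF Fn_id]] obtain q
    where q: "\<forall>p n p' n'. P (quad p n p' n') = (\<exists>s. comput s q p n p' n')" by (elim exE conjE)
  obtain S where S: "\<And>s. S \<sqsubseteq> s \<Longrightarrow> act s \<Longrightarrow> q \<sqsubset> lv (h s)" using eventually_higher by blast
  show False
  proof (cases "\<exists>t. t \<sqsubset> S \<and> kd (h t) = num 1 \<and> lv (h t) = q \<and> clean h q t S")
    case True
    then obtain t where t: "t \<sqsubset> S" "kd (h t) = num 1" "lv (h t) = q" "clean h q t S" by blast
    define d where "d = dt (h t)"
    have ent: "enters t d" using t(2) by (simp add: enters_def d_def)
    then obtain p' n' where c: "comput t q \<zero> (\<e> d) p' n'" "\<And>x. x \<epsilon> p' \<Longrightarrow> Aa h t x" "\<And>x. x \<epsilon> n' \<Longrightarrow> \<not> Aa h t x"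
      using enters_attN[OF ent] unfolding attN_def t(3) by blast
    \<comment> \<open>What is in \<open>D\<close> at stage t stays there. The witness ranks above
      all removals of its own level, and smaller levels do not act after t: up to S by cleanness,
      later by the choice of S.\<close>
    have kept: "D s x" if x: "enters e x" "e \<sqsubseteq> t" "\<not> R t x" and s: "t \<sqsubset> s" for e x s
    proof (rule keep[OF x(1,2) enters_act[OF ent] s])
      show "\<not> R (t \<oplus> \<one>) x" using x(3) t(2) unfolding R_iff lt_suc_iff removes_def by auto
      fix u assume u: "t \<sqsubset> u" "removes u x" "lv (h u) \<sqsubseteq> lv (h t)" "lv (h u) = lv (h t) \<Longrightarrow> kd (h t) \<noteq> num 1"
      then have "lv (h u) \<sqsubset> q" using t(2,3) by (auto simp: le_def)
      then show False
        using t(4) S[of u] removes_act[OF u(2)] u(1) ord.less_imp_le[OF u(1)] ord.not_le[of S u] lt_trans lt_irrefl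
        unfolding clean_def act_def by blast
    qed
    have "\<not> R t d" using R_imp_E[of t d] E_iff enters_once[OF _ ent] by blast
    then have "D s d" if "t \<oplus> \<one> \<sqsubseteq> s" for s using kept[OF ent, of s] that by (simp add: suc_le_iff)
    then have "d \<in> DL" by (rule DL_I)
    moreover have "info_about M AL p' n'"
    proof -
      have "x \<notin> AL" if "x \<epsilon> n'" for x
      proof
        assume "x \<in> AL"
        then obtain y u where x: "x = pr y u" using AL_cases by blast
        then obtain s where s: "D u y" "u \<sqsubseteq> s" "\<not> D s y" using \<open>x \<in> AL\<close> AL_pr by blast
        \<comment> \<open>Codes in a computation found by stage t are below t. So if y had left
          \<open>D\<close> by stage t, then x would already be in the approximation of
          \<open>A\<close> at t.\<close>
        have "u \<sqsubset> t" using mem_lt[OF \<open>x \<epsilon> n'\<close>] comput_lt(4)[OF c(1)] x le_pr(2)[of u y]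
          by (metis ord.order.strict_trans1 lt_trans)
        then have "y \<sqsubset> x \<oplus> \<one>" "u \<sqsubset> t \<oplus> \<one>" unfolding le_suc_iff[symmetric] x by (simp_all add: ord.less_imp_le)
        then have "D t y" using c(3)[OF \<open>x \<epsilon> n'\<close>] s(1) x unfolding Aa_def by blast
        then have nR: "\<not> R t y" by (simp add: D_iff)
        obtain e where e: "enters e y" "e \<sqsubset> u" using s(1) unfolding D_iff E_iff by blast
        have "t \<sqsubset> s"
        proof (rule ccontr)
          assume "\<not> t \<sqsubset> s"
          then have "s \<sqsubseteq> t" by simp
          moreover have "E s y" using E_mono[OF s(2)] s(1) by (simp add: D_iff)
          ultimately show False using D_back[OF \<open>D t y\<close>] s(3) by blast
        qed
        moreover have "e \<sqsubseteq> t" using e(2) \<open>u \<sqsubset> t\<close> by order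
        ultimately show False using kept[OF e(1) _ nR] s(3) by blast
      qed
      then show ?thesis using c(2) unfolding info_iff AL_def by blast
    qed
    moreover have "P (quad \<zero> (\<e> d) p' n')" using q c(1) by blast
    ultimately have "info_about M DL \<zero> (\<e> d)" using P(2) by blast
    then show False using \<open>d \<in> DL\<close> unfolding info_iff by simp
  next
    case False
    \<comment> \<open>This witness remains available at all stages after S but never enters. Since d
      is outside \<open>DL\<close>, a true computation from \<open>A\<close> says so, and once it is
      seen, level q would have to act.\<close>
    define d where "d = pr q S"
    have "\<not> enters t d" for t
    proof
      assume t: "enters t d"
      have "S \<sqsubseteq> t" "lv (h t) = q" using enters_form[OF t] by (simp_all add: d_def)
      then show False using S[OF _ enters_act[OF t]] lt_irrefl by metis
    qed
    then have "d \<notin> DL" unfolding DL_def E_iff by blast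
    then have "info_about M DL \<zero> (\<e> d)" by (simp add: info_iff)
    then obtain p' n' where c: "P (quad \<zero> (\<e> d) p' n')" "info_about M AL p' n'" using P(2) by blast
    then obtain v where v: "comput v q \<zero> (\<e> d) p' n'" using q by blast
    have Amono: "Aa h t x" if "Aa h s x" "s \<sqsubseteq> t" for s t x
    proof -
      obtain y u where yu: "y \<sqsubset> x \<oplus> \<one>" "u \<sqsubseteq> s" "x = pr y u" "D u y" "\<not> D s y"
        using \<open>Aa h s x\<close> unfolding Aa_def le_suc_iff by blast
      moreover have "E s y" using yu(2,4) E_mono by (auto simp: D_iff)
      then have "\<not> D t y" using D_back yu(5) \<open>s \<sqsubseteq> t\<close> by blast
      moreover have "u \<sqsubseteq> t" using yu(2) \<open>s \<sqsubseteq> t\<close> by order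
      ultimately show ?thesis unfolding Aa_def le_suc_iff[symmetric] by blast
    qed
    obtain a where a: "\<And>t x. a \<sqsubseteq> t \<Longrightarrow> x \<sqsubset> p' \<Longrightarrow> Aa h t x \<longleftrightarrow> (\<exists>u. Aa h u x)"
      using settle[of "Aa h" p'] D1_A[OF Fn_fs_base Fn_sn_base] Amono by blast
    define b where "b = pr (num 1) (pr q d)"
    define s where "s = S \<oplus> v \<oplus> a \<oplus> b \<oplus> \<one>"
    have "v \<sqsubseteq> S \<oplus> v" "S \<sqsubseteq> S \<oplus> v" "S \<oplus> v \<sqsubseteq> S \<oplus> v \<oplus> a" "a \<sqsubseteq> S \<oplus> v \<oplus> a" "S \<oplus> v \<oplus> a \<sqsubseteq> S \<oplus> v \<oplus> a \<oplus> b"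
      "b \<sqsubseteq> S \<oplus> v \<oplus> a \<oplus> b" "S \<oplus> v \<oplus> a \<oplus> b \<sqsubset> s" by (simp_all add: s_def)
    then have le: "S \<sqsubseteq> s" "v \<sqsubseteq> s" "a \<sqsubseteq> s" "b \<sqsubset> s" by order+
    have comp: "comput s q \<zero> (\<e> d) p' n'" using comput_mono[OF le(2) v] .
    have "attN h s q d" unfolding attN_def
    proof (intro conjI)
      show "\<exists>u. u \<sqsubset> s \<oplus> \<one> \<and> d = pr q u \<and> clean h q u s"
      proof (intro exI conjI)
        show "clean h q S s" unfolding clean_def using S lt_trans lt_irrefl unfolding act_def by blast
      qed (use le in \<open>simp_all add: d_def le_suc_iff[symmetric]\<close>)
      show "\<forall>t. t \<sqsubset> s \<longrightarrow> kd (h t) = num 1 \<longrightarrow> lv (h t) = q \<longrightarrow> \<not> clean h q t s"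
      proof (intro allI impI notI)
        fix t assume t: "t \<sqsubset> s" "kd (h t) = num 1" "lv (h t) = q" "clean h q t s"
        then have "act t" by (simp add: act_def)
        then have "t \<sqsubset> S" using S[of t] t(3) lt_irrefl ord.not_le by blast
        then show False using False t clean_sub[OF t(4) _ le(1), of t] by simp
      qed
      have "\<forall>x. x \<epsilon> p' \<longrightarrow> Aa h s x" using c(2) a[OF le(3)] mem_lt unfolding info_iff AL_def by blast
      moreover have "\<forall>x. x \<epsilon> n' \<longrightarrow> \<not> Aa h s x" using c(2) unfolding info_iff AL_def by blast
      ultimately show "\<exists>p'. p' \<sqsubset> s \<and> (\<exists>n'. n' \<sqsubset> s \<and> comput s q \<zero> (\<e> d) p' n' \<and>
         (\<forall>x. x \<epsilon> p' \<longrightarrow> Aa h s x) \<and> (\<forall>x. x \<epsilon> n' \<longrightarrow> \<not> Aa h s x))"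
        using comp comput_lt[OF comp] by blast
    qed
    then have "att h s b" by (simp add: att_def b_def kd_def lv_def dt_def)
    then have "act s \<and> lv (h s) \<sqsubseteq> q" using att_act[OF _ le(4)] by (simp add: b_def lv_def)
    then show False using S[OF le(1)] ord.not_le by blast
  qed
qed

lemma fail_set_lt:
  assumes "kd (h t) = num 2"
  shows "sn (dt (h t)) \<sqsubset> t"
proof -
  obtain s' n p' where "s' \<sqsubseteq> t" "comput s' (lv (h t)) \<zero> n p' (sn (dt (h t)))"
    using fail_facts[OF assms] unfolding refuted_def by metis
  then show ?thesis using comput_lt(4) ord.order.strict_trans2 by blast
qed

text \<open>Two pending failures of the same requirement cannot both wait for permission from the same
  \<open>i\<close>: a claim made after the first failure already refers to its elements.\<close>

lemma permits_disjoint: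
  assumes f1: "kd (h t1) = num 2" "lv (h t1) = q" and f2: "kd (h t2) = num 2" "lv (h t2) = q"
    and t: "t1 \<sqsubset> t2" "t2 \<sqsubset> s" and c: "cleanI h q t1 s"
    and n1: "\<not> permits h i (sn (dt (h t1))) s" and n2: "\<not> permits h i (sn (dt (h t2))) s"
  shows False
proof -
  obtain u1 m1 n1 d1 where 1: "u1 \<sqsubset> s" "m1 \<sqsubset> u1" "n1 \<sqsubset> u1" "claim h i u1 m1 n1" "\<forall>x. x \<epsilon> n1 \<longrightarrow> \<not> wset s i x"
    "d1 \<epsilon> sn (dt (h t1))" "d1 \<sqsubset> m1" "D s d1" "\<not> E u1 d1" using n1 unfolding permits_def by blast
  obtain u2 m2 n2 d2 where 2: "u2 \<sqsubset> s" "m2 \<sqsubset> u2" "claim h i u2 m2 n2"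
    "d2 \<epsilon> sn (dt (h t2))" "d2 \<sqsubset> m2" "D s d2" using n2 unfolding permits_def by blast
  \<comment> \<open>Entries at levels up to q would cancel the first failure, so a later entry has a
    larger level than the action at t1 and hence exceeds t1.\<close>
  have fresh: "t1 \<sqsubset> d" if e: "enters e d" "t1 \<sqsubseteq> e" "e \<sqsubset> s" for e d
  proof -
    have k: "kd (h e) = num 1" using e(1) by (simp add: enters_def)
    then have "e \<noteq> t1" using f1 by auto
    then have "t1 \<sqsubset> e" using e(2) by (simp add: le_def)
    moreover have "\<not> lv (h e) \<sqsubset> q" "lv (h e) \<noteq> q" using c e k unfolding cleanI_def by auto
    then have "lv (h t1) \<sqsubset> lv (h e)" using f1(2) lt_linear by metis
    ultimately show ?thesis using enters_fresh[OF e(1)] f1(1) by (simp add: act_def)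
  qed
  have d1: "d1 \<sqsubset> t1" using mem_lt[OF 1(6)] fail_set_lt[OF f1(1)] by order
  obtain e1 where e1: "enters e1 d1" "e1 \<sqsubset> s" using 1(8) unfolding D_iff E_iff by blast
  have "e1 \<sqsubset> t1" using fresh[OF e1(1) _ e1(2)] d1 ord.not_le[of t1 e1] by (metis lt_trans lt_irrefl)
  obtain s' where s': "s' \<sqsubseteq> t2" "\<And>u. u \<sqsubset> t2 \<Longrightarrow> s' \<sqsubseteq> u \<Longrightarrow> lv (h u) = lv (h t2) \<Longrightarrow> kd (h u) \<noteq> num 2"
    "refuted h (lv (h t2)) s' t2 (sn (dt (h t2)))" using fail_facts[OF f2(1)] by blast
  \<comment> \<open>The second computation is newer than the first failure, so d2 entered after t1
    and is fresh. A claim covering d2 then also covers d1 and is made when d1 is already in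
    \<open>D\<close>.\<close>
  have "t1 \<sqsubset> s'" using s'(2)[OF t(1)] f1 f2 ord.not_le by auto
  obtain e2 where e2: "enters e2 d2" "e2 \<sqsubset> s" using 2(6) unfolding D_iff E_iff by blast
  have "\<not> D s' d2" using s'(3) 2(4) unfolding refuted_def by blast
  moreover have "s' \<sqsubseteq> s" using s'(1) t(2) by order
  ultimately have "\<not> E s' d2" using D_back[OF 2(6)] by blast
  then have "\<not> e2 \<sqsubset> s'" using e2(1) E_iff by blast
  then have "t1 \<sqsubseteq> e2" using \<open>t1 \<sqsubset> s'\<close> by order
  then have "t1 \<sqsubset> d2" using fresh[OF e2(1) _ e2(2)] by blast
  then have "t1 \<sqsubset> u2" "d1 \<sqsubset> m2" using 2(2,5) d1 by order+
  then have "e1 \<sqsubset> u2" using \<open>e1 \<sqsubset> t1\<close> by order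
  then have "E u2 d1" using e1(1) E_iff by blast
  then have D2: "D u2 d1" using D_back[OF 1(8)] 2(1) ord.less_imp_le by blast
  have "\<not> e1 \<sqsubset> u1" using 1(9) e1(1) E_iff by blast
  \<comment> \<open>The claim at u1 was made before d1 entered and is still valid at u2; the claim
    at u2 sees d1 in \<open>D\<close>. Consistency of claims excludes this.\<close>
  then have "u1 \<sqsubset> u2" using \<open>e1 \<sqsubset> u2\<close> by order
  moreover have "\<forall>x. x \<epsilon> n1 \<longrightarrow> \<not> wset u2 i x" using 1(5) wset_mono 2(1) ord.less_imp_le by blast
  moreover have "cm h i u1 m1 n1" using 1(4) unfolding claim_def by blast
  ultimately have "D u1 d1 \<longleftrightarrow> D u2 d1" using 2(3) 1(2,3,7) \<open>d1 \<sqsubset> m2\<close> unfolding claim_def by blast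
  then show False using D2 1(9) by (simp add: D_iff)
qed

lemma isolation:
  assumes X: "S1 (\<lambda>x. x \<in> X)" and le: "turing_le M X DL"
  shows "turing_le M X AL"
proof -
  obtain P where P: "S1 P"
    "\<And>p n. info_about M X p n \<longleftrightarrow> (\<exists>p' n'. P (quad p n p' n') \<and> info_about M DL p' n')"
    using turing_leE[OF le] by blast
  from ex_index[OF P(1) X] obtain q where q: "\<forall>p n p' n'. P (quad p n p' n') = (\<exists>s. comput s q p n p' n')"
    and w: "\<forall>x. (x \<in> X) = (\<exists>s. wset s q x)" by (elim exE conjE)
  obtain S where S: "\<And>s. S \<sqsubseteq> s \<Longrightarrow> act s \<Longrightarrow> q \<sqsubset> lv (h s)" using eventually_higher by blast
  have S': "cleanI h q S s" for s unfolding cleanI_def using S lt_irrefl lt_trans unfolding act_def by metis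
  have true_comp: "\<forall>x. x \<epsilon> n \<longrightarrow> x \<notin> X" if "comput s q \<zero> n p' n'" "info_about M DL p' n'" for s n p' n'
    using that P(2) q unfolding info_iff by blast
  \<comment> \<open>A removal that is never cancelled restores its computation for good: the
    positive use is protected by \<open>keep\<close>, and later entries are too large to meet
    \<open>F\<close>. So a true computation from \<open>D\<close> would be wrong about X.\<close>
  have not_won: "\<not> won h s q" if Ss: "S \<sqsubseteq> s" for s
  proof
    assume "won h s q"
    then obtain t where t: "t \<sqsubset> s" "kd (h t) = num 3" "lv (h t) = q" "cleanI h q t s" unfolding won_def by blast
    have clean: "cleanI h q t v" for v
    proof (cases "v \<sqsubseteq> s")
      case True then show ?thesis using cleanI_sub[OF t(4)] by simp
    next
      case False
      then have "S \<sqsubseteq> s" "s \<sqsubseteq> v" using Ss by order+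
      then show ?thesis using cleanI_join[OF t(4)] cleanI_sub[OF S'[of v]] by blast
    qed
    have actt: "act t" using t(2) by (simp add: act_def)
    have attW: "attW h t q (dt (h t))" using removes_attW[OF t(2)] t(3) by simp
    then obtain t0 where t0: "t0 \<sqsubset> t" "fails h t q t0" "sn (dt (h t0)) = dt (h t)" unfolding attW_def by blast
    have f0: "kd (h t0) = num 2" "lv (h t0) = q" "cleanI h q t0 t" using t0(2) unfolding fails_def by blast+
    obtain s' where s': "s' \<sqsubseteq> t0" "refuted h q s' t0 (dt (h t))"
      using fail_facts[OF f0(1)] unfolding f0(2) t0(3) by blast
    obtain n p' where np: "comput s' q \<zero> n p' (dt (h t))" "\<forall>x. x \<epsilon> p' \<longrightarrow> D s' x \<and> D t0 x"
      "\<forall>x. x \<epsilon> dt (h t) \<longrightarrow> \<not> D s' x" "\<exists>x. x \<epsilon> n \<and> wset t0 q x" using s'(2) unfolding refuted_def by blast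
    \<comment> \<open>After the failure at t0, smaller levels would cancel it, and at level q a
      standing removal blocks a second one.\<close>
    have nowin: False if u: "t0 \<sqsubset> u" "kd (h u) = num 3" "lv (h u) \<sqsubseteq> q" "u \<noteq> t" for u
    proof -
      have c0: "cleanI h q t0 v" for v using cleanI_join[OF f0(3) clean] .
      have "act u" using u(2) by (simp add: act_def)
      then have "\<not> lv (h u) \<sqsubset> q" using c0[of "u \<oplus> \<one>"] ord.less_imp_le[OF u(1)] lt_suc[of u] unfolding cleanI_def act_def by blast
      then have lvu: "lv (h u) = q" using u(3) by (simp add: le_def)
      have nw: "\<not> won h u q" using removes_attW[OF u(2)] lvu unfolding attW_def by simp
      show False
      proof (cases "u \<sqsubset> t")
        case True
        have "cleanI h q u t" using cleanI_sub[OF f0(3), of u t] u(1) by (simp add: ord.less_imp_le)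
        then have "won h t q" unfolding won_def using True u(2) lvu by blast
        then show False using attW unfolding attW_def by blast
      next
        case False
        then have "t \<sqsubset> u" using u(4) lt_linear by blast
        then have "won h u q" unfolding won_def using t(2,3) clean by blast
        then show False using nw by blast
      qed
    qed
    have "x \<in> DL" if x: "x \<epsilon> p'" for x
    proof (rule DL_I)
      fix v assume "t0 \<oplus> \<one> \<sqsubseteq> v"
      then have v: "t0 \<sqsubset> v" by (simp add: suc_le_iff)
      have Dx: "D s' x" "D t0 x" using np(2) x by blast+
      then obtain e where e: "enters e x" "e \<sqsubset> t0" unfolding D_iff E_iff by blast
      show "D v x"
      proof (rule keep[OF e(1) ord.less_imp_le[OF e(2)] _ v])
        show "act t0" using f0(1) by (simp add: act_def)
        show "\<not> R (t0 \<oplus> \<one>) x" using Dx(2) f0(1) unfolding D_iff R_iff lt_suc_iff removes_def by auto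
        fix u assume u: "t0 \<sqsubset> u" "removes u x" "lv (h u) \<sqsubseteq> lv (h t0)"
        have "u = t" using nowin[OF u(1)] u(2,3) f0(2) unfolding removes_def by blast
        then show False using u(2) np(3) Dx(1) unfolding removes_def by blast
      qed
    qed
    moreover have "x \<notin> DL" if x: "x \<epsilon> dt (h t)" for x
    proof
      assume "x \<in> DL"
      then obtain e where e: "enters e x" "\<And>s. \<not> R s x" unfolding DL_def E_iff by blast
      have "\<not> e \<sqsubset> t"
      proof
        assume "e \<sqsubset> t"
        then have "E t x" using e(1) E_iff by blast
        then have "R (t \<oplus> \<one>) x" using x t(2) lt_suc unfolding R_iff removes_def by blast
        then show False using e(2) by blast
      qed
      moreover have k: "kd (h e) = num 1" using e(1) by (simp add: enters_def)
      then have "e \<noteq> t" using t(2) by auto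
      ultimately have te: "t \<sqsubset> e" using lt_linear by blast
      have "\<not> lv (h e) \<sqsubset> q" "lv (h e) \<noteq> q"
        using clean[of "e \<oplus> \<one>", unfolded cleanI_def, rule_format, OF lt_suc ord.less_imp_le[OF te]] k
        by simp_all
      then have "lv (h t) \<sqsubset> lv (h e)" using t(3) lt_linear by metis
      then have "t \<sqsubset> x" using enters_fresh[OF e(1) te actt] by blast
      moreover have "x \<sqsubset> t" using mem_lt[OF x] comput_lt(4)[OF np(1)] s'(1) t0(1) by order
      ultimately show False by order
    qed
    ultimately have "info_about M DL p' (dt (h t))" unfolding info_iff by blast
    then show False using true_comp[OF np(1)] np(4) w by blast
  qed
  \<comment> \<open>The numbers spent on failures that are never cancelled.\<close>
  define Fl where "Fl r \<longleftrightarrow> (\<exists>t. t \<sqsubset> S \<and> fails h S q t \<and> fs (dt (h t)) = r)" for r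
  have fails_ext: "fails h s q t \<longleftrightarrow> fails h S q t" if "S \<sqsubseteq> s" "t \<sqsubset> S" for s t
  proof -
    have "cleanI h q t s \<longleftrightarrow> cleanI h q t S"
      using cleanI_join[OF _ S', of t s] cleanI_sub[OF _ ord.order.refl that(1), of q t] by (rule iffI[rotated])
    then show ?thesis unfolding fails_def by simp
  qed
  have fails_early: "t \<sqsubset> S" if "fails h s q t" for s t
  proof -
    have "act t" "lv (h t) = q" using that by (auto simp: fails_def act_def)
    then show ?thesis using S[of t] lt_irrefl ord.not_le by blast
  qed
  show ?thesis
  proof (cases "\<exists>r. r \<sqsubset> \<e> q \<and> \<not> Fl r")
    case True
    have "D1 (\<lambda>r. \<not> Fl r)" unfolding Fl_def by (intro D1_intros D1_fails_h Fn_dt Fn_h_comp Fn_intros)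
    then obtain r where r: "\<not> Fl r" "\<And>r'. \<not> Fl r' \<Longrightarrow> r \<sqsubseteq> r'" using least_S1[OF D1_S1] True by blast
    have re: "r \<sqsubset> \<e> q" using True r(2) ord.order.strict_trans1 by blast
    have Fl_lt: "r' \<sqsubset> r" if fl: "Fl r'" for r'
    proof (rule ccontr)
      assume "\<not> r' \<sqsubset> r"
      then have "r \<sqsubset> r'" using r(1) fl lt_linear by blast
      obtain t where t: "t \<sqsubset> S" "fails h S q t" "fs (dt (h t)) = r'" using fl unfolding Fl_def by blast
      have k: "kd (h t) = num 2" "lv (h t) = q" "cleanI h q t S" using t(2) unfolding fails_def by blast+
      obtain t' where t': "t' \<sqsubset> t" "fails h t q t'" "fs (dt (h t')) = r"
        using fail_attF[OF k(1)] \<open>r \<sqsubset> r'\<close> unfolding attF_def t(3) k(2) by blast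
      then have "fails h S q t'" using cleanI_join k(3) unfolding fails_def by blast
      then show False using r(1) t'(1,3) t(1) lt_trans unfolding Fl_def by blast
    qed
    \<comment> \<open>While the number r is free, any refutation of a computation seen after S would
      make level q act.\<close>
    have no_refute: "\<not> refuted h q s' s F" if "S \<sqsubseteq> s'" "s' \<sqsubseteq> s" "pr (num 2) (pr q (pr r F)) \<sqsubset> s" for s' s F
    proof
      assume ref: "refuted h q s' s F"
      have Ss: "S \<sqsubseteq> s" using that(1,2) by order
      have "attF h s q r F" unfolding attF_def
      proof (intro conjI)
        show "\<not> won h s q" by (rule not_won[OF Ss])
        show "\<forall>r'. r' \<sqsubset> r \<longrightarrow> (\<exists>t. t \<sqsubset> s \<and> fails h s q t \<and> fs (dt (h t)) = r')"
        proof (intro allI impI)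
          fix r' assume "r' \<sqsubset> r"
          then have "Fl r'" using r(2) ord.not_le by blast
          then obtain t where "t \<sqsubset> S" "fails h S q t" "fs (dt (h t)) = r'" unfolding Fl_def by blast
          moreover from this have "t \<sqsubset> s" using Ss by order
          ultimately show "\<exists>t. t \<sqsubset> s \<and> fails h s q t \<and> fs (dt (h t)) = r'" using fails_ext[OF Ss] by blast
        qed
        show "\<forall>t. t \<sqsubset> s \<longrightarrow> fails h s q t \<longrightarrow> fs (dt (h t)) \<sqsubset> r"
          using Fl_lt fails_early fails_ext[OF Ss] unfolding Fl_def by blast
        have "cleanI h q s' s" using cleanI_sub[OF S' that(1) ord.order.refl] .
        moreover have "kd (h t) \<noteq> num 2" if "s' \<sqsubseteq> t" "lv (h t) = q" for t
        proof
          assume "kd (h t) = num 2"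
          then have "act t" by (simp add: act_def)
          moreover have "S \<sqsubseteq> t" using \<open>S \<sqsubseteq> s'\<close> \<open>s' \<sqsubseteq> t\<close> by order
          ultimately show False using S \<open>lv (h t) = q\<close> lt_irrefl by metis
        qed
        ultimately show "\<exists>s'. s' \<sqsubset> s \<oplus> \<one> \<and> cleanI h q s' s \<and>
          (\<forall>t. t \<sqsubset> s \<longrightarrow> s' \<sqsubseteq> t \<longrightarrow> lv (h t) = q \<longrightarrow> kd (h t) \<noteq> num 2) \<and> refuted h q s' s F"
          using ref that(2) unfolding le_suc_iff[symmetric] by blast
      qed (rule re)
      then have "att h s (pr (num 2) (pr q (pr r F)))" by (simp add: att_def kd_def lv_def dt_def)
      then have "act s \<and> lv (h s) \<sqsubseteq> q" using att_act[OF _ that(3)] by (simp add: lv_def)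
      then show False using S[OF Ss] ord.not_le by blast
    qed
    \<comment> \<open>The oracle \<open>A\<close> certifies, through the pairs (x, s), that the
      positive use stays in \<open>D\<close>. Nothing is asked about F after stage s: if a number of
      n entered X, the computation would be refuted, against \<open>no_refute\<close>.\<close>
    let ?c = "\<lambda>n n' s P F. S \<sqsubseteq> s \<and> comput s q \<zero> n P F \<and> (\<forall>x. x \<epsilon> P \<longrightarrow> D s x \<and> pr x s \<epsilon> n') \<and>
      (\<forall>x. x \<epsilon> F \<longrightarrow> \<not> D s x) \<and> (\<forall>x. x \<epsilon> n \<longrightarrow> \<not> wset s q x)"
    show ?thesis
    proof (rule turing_leI)
      have "D1 (\<lambda>w. ?c (q2 (fs (fs (fs w)))) (q4 (fs (fs (fs w)))) (sn (fs (fs w))) (sn (fs w)) (sn w))"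
        by (intro D1_intros D1_comput D1_wset D1_D Q_intros)
      then show "S1 (\<lambda>w. (\<forall>x. x \<epsilon> q1 w \<longrightarrow> x \<in> X) \<and> (\<exists>s P F. ?c (q2 w) (q4 w) s P F))"
        by (intro S1_conj S1_ball_mem S1_ex S1_comp[OF X] Q_intros D1_S1)
      fix p n
      show "info_about M X p n \<longleftrightarrow> (\<exists>p' n'. ((\<forall>x. x \<epsilon> q1 (quad p n p' n') \<longrightarrow> x \<in> X) \<and>
        (\<exists>s P F. ?c (q2 (quad p n p' n')) (q4 (quad p n p' n')) s P F)) \<and> info_about M AL p' n')"
      proof (unfold proj_quad, rule iffI)
        assume info: "info_about M X p n"
        then have "info_about M X \<zero> n" unfolding info_iff by simp
        then obtain P' F where PF: "P (quad \<zero> n P' F)" "info_about M DL P' F" using P(2) by blast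
        then obtain v where v: "comput v q \<zero> n P' F" using q by blast
        obtain a where a: "\<And>t x. a \<sqsubseteq> t \<Longrightarrow> x \<sqsubset> P' \<oplus> F \<Longrightarrow> D t x \<longleftrightarrow> x \<in> DL" using D_settle[of "P' \<oplus> F"] by blast
        define s where "s = S \<oplus> v \<oplus> a"
        have "v \<sqsubseteq> S \<oplus> v" "S \<sqsubseteq> S \<oplus> v" "S \<oplus> v \<sqsubseteq> s" "a \<sqsubseteq> s" by (simp_all add: s_def)
        then have les: "S \<sqsubseteq> s" "v \<sqsubseteq> s" "a \<sqsubseteq> s" by order+
        have lt: "x \<sqsubset> P' \<oplus> F" if "x \<epsilon> P' \<or> x \<epsilon> F" for x
          using that mem_lt[of x P'] mem_lt[of x F] le_add1[of P' F] le_add2[of F P'] by (meson ord.order.strict_trans2)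
        have "S1 (\<lambda>z. \<exists>x. x \<epsilon> P' \<and> z = pr x s)" by (intro D1_S1) (intro D1_intros Fn_intros)
        then obtain n' where n': "\<And>z. z \<epsilon> n' \<longleftrightarrow> z \<sqsubset> pr P' s \<oplus> \<one> \<and> (\<exists>x. x \<epsilon> P' \<and> z = pr x s)"
          by (rule comprehension[of _ "pr P' s \<oplus> \<one>"]) blast
        have in': "pr x s \<epsilon> n'" if "x \<epsilon> P'" for x
        proof -
          have "pr x s \<sqsubseteq> pr P' s" using pr_mono mem_lt[OF that] by (simp add: ord.less_imp_le)
          then show ?thesis using n' that by (auto simp: le_suc_iff)
        qed
        have "?c n n' s P' F"
          using les(1) comput_mono[OF les(2) v] in' a[OF les(3)] lt PF(2) info w unfolding info_iff by auto
        moreover have "z \<notin> AL" if "z \<epsilon> n'" for z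
        proof -
          obtain x where x: "x \<epsilon> P'" "z = pr x s" using n' \<open>z \<epsilon> n'\<close> by blast
          have "D t x" if "s \<sqsubseteq> t" for t
          proof -
            have "a \<sqsubseteq> t" using les(3) that by order
            then show ?thesis using a lt x(1) PF(2) unfolding info_iff by blast
          qed
          then show ?thesis using x(2) AL_pr by blast
        qed
        then have "info_about M AL \<zero> n'" by (simp add: info_iff)
        ultimately show "\<exists>p' n'. ((\<forall>x. x \<epsilon> p \<longrightarrow> x \<in> X) \<and> (\<exists>s P F. ?c n n' s P F)) \<and> info_about M AL p' n'"
          using info unfolding info_iff by blast
      next
        assume "\<exists>p' n'. ((\<forall>x. x \<epsilon> p \<longrightarrow> x \<in> X) \<and> (\<exists>s P F. ?c n n' s P F)) \<and> info_about M AL p' n'"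
        then obtain n' s P' F where p: "\<forall>x. x \<epsilon> p \<longrightarrow> x \<in> X" and c: "?c n n' s P' F"
          and nA: "\<forall>z. z \<epsilon> n' \<longrightarrow> z \<notin> AL" unfolding info_iff by blast
        have "y \<notin> X" if y: "y \<epsilon> n" for y
        proof
          assume "y \<in> X"
          then obtain v where v: "wset v q y" using w by blast
          define b where "b = pr (num 2) (pr q (pr r F))"
          define t where "t = s \<oplus> v \<oplus> b \<oplus> \<one>"
          have "v \<sqsubseteq> s \<oplus> v" "s \<sqsubseteq> s \<oplus> v" "s \<oplus> v \<sqsubseteq> s \<oplus> v \<oplus> b" "b \<sqsubseteq> s \<oplus> v \<oplus> b" "s \<oplus> v \<oplus> b \<sqsubset> t"
            by (simp_all add: t_def)
          then have les: "s \<sqsubseteq> t" "v \<sqsubseteq> t" "b \<sqsubset> t" by order+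
          have "D t x" if "x \<epsilon> P'" for x
            using c that nA AL_pr les(1) by blast
          then have "refuted h q s t F" unfolding refuted_def
            using c comput_lt[of s q \<zero> n P' F] y wset_mono[OF les(2) v] by blast
          then show False using no_refute[OF _ les(1)] c les(3) unfolding b_def by blast
        qed
        then show "info_about M X p n" using p unfolding info_iff by blast
      qed
    qed
  next
    case False
    then have all: "Fl r" if "r \<sqsubset> \<e> q" for r using that by blast
    \<comment> \<open>Recorded removal sets are below S by \<open>fail_set_lt\<close>, so at this
      stage all actions that remove one of them are among the candidates.\<close>
    define s where "s = S \<oplus> pr (num 3) (pr q S) \<oplus> \<one>"
    have "S \<sqsubseteq> S \<oplus> pr (num 3) (pr q S)" "pr (num 3) (pr q S) \<sqsubseteq> S \<oplus> pr (num 3) (pr q S)"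
      "S \<oplus> pr (num 3) (pr q S) \<sqsubset> s" by (simp_all add: s_def)
    then have les: "S \<sqsubset> s" "pr (num 3) (pr q S) \<sqsubset> s" by order+
    then have Ss: "S \<sqsubseteq> s" by order
    \<comment> \<open>Attempt r lacks the permission of i. Every attempt is blocked by some i < q,
      as otherwise it would be carried out, and by \<open>permits_disjoint\<close> no i blocks two
      of them.\<close>
    define np where "np r i \<longleftrightarrow> (\<exists>t. t \<sqsubset> S \<and> fails h S q t \<and> fs (dt (h t)) = r \<and> \<not> permits h i (sn (dt (h t))) s)" for r i
    have np_ex: "\<exists>i. i \<sqsubset> q \<and> np r i" if rq: "r \<sqsubset> \<e> q" for r
    proof -
      obtain t where t: "t \<sqsubset> S" "fails h S q t" "fs (dt (h t)) = r" using all[OF rq] unfolding Fl_def by blast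
      define F where "F = sn (dt (h t))"
      have "kd (h t) = num 2" using t(2) by (simp add: fails_def)
      then have "F \<sqsubset> t" using fail_set_lt by (simp add: F_def)
      then have "F \<sqsubseteq> S" using t(1) by order
      then have "pr (num 3) (pr q F) \<sqsubseteq> pr (num 3) (pr q S)" by (simp add: pr_mono)
      then have lt: "pr (num 3) (pr q F) \<sqsubset> s" using les(2) by order
      have "\<exists>i. i \<sqsubset> q \<and> \<not> permits h i F s"
      proof (rule ccontr)
        assume "\<not> ?thesis"
        moreover have "t \<sqsubset> s" using t(1) les(1) by order
        moreover have "fails h s q t" using fails_ext[OF Ss t(1)] t(2) by blast
        ultimately have "attW h s q F" using not_won[OF Ss] unfolding attW_def F_def by blast
        then have "att h s (pr (num 3) (pr q F))" by (simp add: att_def kd_def lv_def dt_def)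
        then have "act s \<and> lv (h s) \<sqsubseteq> q" using att_act[OF _ lt] by (simp add: lv_def)
        then show False using S[OF Ss] ord.not_le by blast
      qed
      then show ?thesis using t unfolding np_def F_def by blast
    qed
    have np_disjoint: "r = r'" if "np r i" "np r' i" for r r' i
    proof -
      obtain t where t: "t \<sqsubset> S" "fails h S q t" "fs (dt (h t)) = r" "\<not> permits h i (sn (dt (h t))) s"
        using \<open>np r i\<close> unfolding np_def by blast
      obtain t' where t': "t' \<sqsubset> S" "fails h S q t'" "fs (dt (h t')) = r'" "\<not> permits h i (sn (dt (h t'))) s"
        using \<open>np r' i\<close> unfolding np_def by blast
      have dis: False if "v \<sqsubset> v'" "v' \<sqsubset> S" "v \<sqsubset> S" "fails h S q v" "fails h S q v'" "\<not> permits h i (sn (dt (h v))) s"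
        "\<not> permits h i (sn (dt (h v'))) s" for v v'
      proof -
        have "v' \<sqsubset> s" using that(2) les(1) by order
        moreover have "cleanI h q v s" using fails_ext[OF Ss that(3)] that(4) unfolding fails_def by blast
        ultimately show False using permits_disjoint[of v q v' s i] that unfolding fails_def by blast
      qed
      have "t = t'" using dis[of t t'] dis[of t' t] t t' lt_linear by blast
      then show ?thesis using t(3) t'(3) by simp
    qed
    \<comment> \<open>The pigeonhole principle in Sigma_1 form: u codes indices that block attempts
      below k. Attempt k contributes a new index, which increases u, while u stays below 2^q; k =
      2^q is the contradiction.\<close>
    have "k \<sqsubseteq> \<e> q \<longrightarrow> (\<exists>u. u \<sqsubset> \<e> q \<and> k \<sqsubseteq> u \<and> (\<forall>i. i \<epsilon> u \<longrightarrow> (\<exists>r. r \<sqsubset> k \<and> np r i)))" for k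
    proof (induction k rule: ind_S1)
      case 1
      have npD: "D1 (\<lambda>w. np (fs w) (sn w))" unfolding np_def
        by (intro D1_intros D1_fails_h D1_permits_h Fn_dt Fn_h_comp Fn_intros)
      have np: "D1 (\<lambda>w. np (f w) (g w))" if "Fn f" "Fn g" for f g using D1_comp2[OF npD that] .
      show ?case by (intro D1_S1) (intro D1_intros np Fn_intros)
    next
      case 2 show ?case by (intro impI exI[of _ \<zero>]) simp
    next
      case (3 k)
      show ?case
      proof
        assume "k \<oplus> \<one> \<sqsubseteq> \<e> q"
        then have k: "k \<sqsubset> \<e> q" by (simp add: suc_le_iff)
        then obtain u where u: "u \<sqsubset> \<e> q" "k \<sqsubseteq> u" "\<forall>i. i \<epsilon> u \<longrightarrow> (\<exists>r. r \<sqsubset> k \<and> np r i)"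
          using 3 ord.less_imp_le by blast
        obtain i where i: "i \<sqsubset> q" "np k i" using np_ex[OF k] by blast
        have "\<not> i \<epsilon> u" using u(3) np_disjoint i(2) lt_irrefl by blast
        then have "u \<sqsubset> ins i u" by (rule lt_ins)
        then have "k \<oplus> \<one> \<sqsubseteq> ins i u" using u(2) unfolding suc_le_iff by order
        moreover have "ins i u \<sqsubset> \<e> q" using ins_lt_exp u(1) i(1) by blast
        moreover have "\<forall>j. j \<epsilon> ins i u \<longrightarrow> (\<exists>r. r \<sqsubset> k \<oplus> \<one> \<and> np r j)" using u(3) i(2) by (auto simp: lt_suc_iff)
        ultimately show "\<exists>u. u \<sqsubset> \<e> q \<and> k \<oplus> \<one> \<sqsubseteq> u \<and> (\<forall>i. i \<epsilon> u \<longrightarrow> (\<exists>r. r \<sqsubset> k \<oplus> \<one> \<and> np r i))" by blast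
      qed
    qed
    from this[of "\<e> q"] show ?thesis using ord.not_le by auto
  qed
qed

section \<open>Isolation from above\<close>

lemma claim_lt:
  assumes "claim h i s m n'"
  shows "m \<sqsubset> s" "n' \<sqsubset> s"
proof -
  have cm: "cm h i s m n'" using assms unfolding claim_def by (rule conjunct1)
  then show "m \<sqsubset> s" unfolding cm_def by (rule conjunct1)
  from cm obtain p n p' where "comput s i p n p' n'" unfolding cm_def by (elim conjE exE)
  then show "n' \<sqsubset> s" by (rule comput_lt)
qed

text \<open>A number below m that enters after a true claim is not in the final set, so it would be
  removed later. Its first removal belongs to a level above q and so has the permission of q, which
  the claim, valid forever, denies.\<close>

lemma claim_frozen:
  assumes S: "\<And>s. S \<sqsubseteq> s \<Longrightarrow> act s \<Longrightarrow> q \<sqsubset> lv (h s)" and "S \<sqsubseteq> s" and cl: "claim h q s m n'"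
    and valid: "\<And>v x. x \<epsilon> n' \<Longrightarrow> \<not> wset v q x"
    and true: "\<And>x. x \<sqsubset> m \<Longrightarrow> D s x \<longleftrightarrow> x \<in> DL" and "s \<sqsubseteq> t" "x \<sqsubset> m"
  shows "D t x \<longleftrightarrow> D s x"
proof (cases "D s x")
  case True
  then have "x \<in> DL" using true assms by blast
  then show ?thesis using D_keep[OF True \<open>s \<sqsubseteq> t\<close>] True by blast
next
  case False
  have "\<not> D t x"
  proof
    assume Dt: "D t x"
    have nE: "\<not> E s x" using D_back[OF Dt _ \<open>s \<sqsubseteq> t\<close>] False by blast
    have "x \<notin> DL" using False true assms by blast
    moreover have "\<exists>v. E v x" using Dt by (auto simp: D_iff)
    ultimately obtain v where "R v x" unfolding DL_def by blast
    let ?Q = "\<lambda>u. kd (h u) = num 3 \<and> x \<epsilon> dt (h u) \<and> E u x"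
    have "S1 ?Q" by (intro D1_S1) (intro D1_intros D1_E Fn_kd Fn_dt Fn_h_comp Fn_intros)
    moreover have "\<exists>u. ?Q u" using \<open>R v x\<close> unfolding R_iff removes_def by blast
    ultimately obtain u where u: "?Q u" "\<And>v. ?Q v \<Longrightarrow> u \<sqsubseteq> v" using least_S1[of ?Q] by blast
    have "\<not> R u x" using u(2) ord.not_le unfolding R_iff removes_def by blast
    then have Du: "D u x" using u(1) by (simp add: D_iff)
    have su: "s \<sqsubset> u" using nE u(1) E_mono[of u s] ord.not_le by blast
    then have "S \<sqsubseteq> u" using \<open>S \<sqsubseteq> s\<close> by order
    moreover have "act u" using u(1) by (simp add: act_def)
    ultimately have "q \<sqsubset> lv (h u)" using S by blast
    then have "permits h q (dt (h u)) u" using removes_attW[of u] u(1) unfolding attW_def by blast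
    then have "E s x" using su claim_lt[OF cl] cl valid u(1) \<open>x \<sqsubset> m\<close> Du unfolding permits_def by blast
    then show False using nE by blast
  qed
  then show ?thesis using False by blast
qed

lemma upper_isolation:
  assumes X: "S1 (\<lambda>x. x \<in> X)" and le: "turing_le M DL X"
  shows "turing_le M BL X"
proof -
  obtain P where P: "S1 P"
    "\<And>p n. info_about M DL p n \<longleftrightarrow> (\<exists>p' n'. P (quad p n p' n') \<and> info_about M X p' n')"
    using turing_leE[OF le] by blast
  from ex_index[OF P(1) X] obtain q where q: "\<forall>p n p' n'. P (quad p n p' n') = (\<exists>s. comput s q p n p' n')"
    and w: "\<forall>x. (x \<in> X) = (\<exists>s. wset s q x)" by (elim exE conjE)
  obtain S where S: "\<And>s. S \<sqsubseteq> s \<Longrightarrow> act s \<Longrightarrow> q \<sqsubset> lv (h s)" using eventually_higher by blast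
  have true: "D s x \<longleftrightarrow> x \<in> DL" if cm: "cm h q s m n'" and nX: "\<forall>x. x \<epsilon> n' \<longrightarrow> x \<notin> X" and x: "x \<sqsubset> m" for s m n' x
  proof -
    obtain p n p' where c: "\<forall>x. x \<sqsubset> m \<longrightarrow> (D s x \<longrightarrow> x \<epsilon> p) \<and> (\<not> D s x \<longrightarrow> x \<epsilon> n)"
      "comput s q p n p' n'" "\<forall>x. x \<epsilon> p' \<longrightarrow> wset s q x" using cm unfolding cm_def by blast
    have "info_about M X p' n'" using c(3) w nX unfolding info_iff by blast
    then have "info_about M DL p n" using P(2) q c(2) by blast
    then show ?thesis using c(1) x unfolding info_iff by blast
  qed
  have frozen: "D t x \<longleftrightarrow> D s x"
    if "S \<sqsubseteq> s" and cl: "claim h q s m n'" and nX: "\<forall>x. x \<epsilon> n' \<longrightarrow> x \<notin> X" and "s \<sqsubseteq> t" "x \<sqsubset> m" for s t m n' x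
  proof (rule claim_frozen[OF S \<open>S \<sqsubseteq> s\<close> cl _ _ \<open>s \<sqsubseteq> t\<close> \<open>x \<sqsubset> m\<close>])
    show "\<not> wset v q x" if "x \<epsilon> n'" for v x using nX that w by blast
    show "D s x \<longleftrightarrow> x \<in> DL" if "x \<sqsubset> m" for x using true cl nX that unfolding claim_def by blast
  qed
  have ex_claim: "\<exists>s n'. S \<sqsubseteq> s \<and> claim h q s m n' \<and> (\<forall>x. x \<epsilon> n' \<longrightarrow> x \<notin> X) \<and>
      (\<forall>t x. s \<sqsubseteq> t \<longrightarrow> x \<sqsubset> m \<longrightarrow> (D t x \<longleftrightarrow> x \<in> DL))" for m
  proof -
    obtain a where a: "\<And>t x. a \<sqsubseteq> t \<Longrightarrow> x \<sqsubset> m \<Longrightarrow> D t x \<longleftrightarrow> x \<in> DL" using D_settle[of m] by blast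
    have "S1 (D a)" "S1 (\<lambda>x. \<not> D a x)" by (intro D1_S1 D1_not D1_D Fn_intros)+
    then obtain p n where p: "\<And>x. x \<epsilon> p \<longleftrightarrow> x \<sqsubset> m \<and> D a x" and n: "\<And>x. x \<epsilon> n \<longleftrightarrow> x \<sqsubset> m \<and> \<not> D a x"
      using comprehension[of "D a" m] comprehension[of "\<lambda>x. \<not> D a x" m] by metis
    have "info_about M DL p n" using p n a[of a] unfolding info_iff by auto
    then obtain p' n' where pn: "P (quad p n p' n')" "info_about M X p' n'" using P(2) by blast
    then obtain v where v: "comput v q p n p' n'" using q by blast
    \<comment> \<open>Below a lie all negative uses of claims made before \<open>D\<close> settled
      below m. After b the c.e. set is final there, so an old computation that still looks valid is
      true and agrees with \<open>DL\<close>; this gives the consistency demanded by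
      \<open>claim\<close>.\<close>
    obtain b where b: "\<And>t x. b \<sqsubseteq> t \<Longrightarrow> x \<sqsubset> a \<oplus> p' \<Longrightarrow> wset t q x \<longleftrightarrow> (\<exists>u. wset u q x)"
      using wset_settle[of "a \<oplus> p'" q] by blast
    define s where "s = S \<oplus> a \<oplus> v \<oplus> b \<oplus> m \<oplus> \<one>"
    have "S \<sqsubseteq> S \<oplus> a" "a \<sqsubseteq> S \<oplus> a" "S \<oplus> a \<sqsubseteq> S \<oplus> a \<oplus> v" "v \<sqsubseteq> S \<oplus> a \<oplus> v" "S \<oplus> a \<oplus> v \<sqsubseteq> S \<oplus> a \<oplus> v \<oplus> b"
      "b \<sqsubseteq> S \<oplus> a \<oplus> v \<oplus> b" "S \<oplus> a \<oplus> v \<oplus> b \<sqsubseteq> S \<oplus> a \<oplus> v \<oplus> b \<oplus> m" "m \<sqsubseteq> S \<oplus> a \<oplus> v \<oplus> b \<oplus> m"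
      "S \<oplus> a \<oplus> v \<oplus> b \<oplus> m \<sqsubset> s" by (simp_all add: s_def)
    then have les: "S \<sqsubseteq> s" "a \<sqsubseteq> s" "v \<sqsubseteq> s" "b \<sqsubseteq> s" "m \<sqsubset> s" by order+
    have Ds: "D t x \<longleftrightarrow> D a x" if "a \<sqsubseteq> t" "x \<sqsubset> m" for t x using a[OF that] a[of a x] that(2) by simp
    have comp: "comput s q p n p' n'" using comput_mono[OF les(3) v] .
    have lt: "x \<sqsubset> a \<oplus> p'" if "x \<sqsubset> a \<or> x \<sqsubset> p'" for x
      using that le_add1[of a p'] le_add2[of p' a] by (meson ord.order.strict_trans2)
    have "wset s q x" if "x \<epsilon> p'" for x
      using b[OF les(4)] lt mem_lt[OF that] pn(2) that w unfolding info_iff by blast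
    moreover have "\<not> wset s q x" if "x \<epsilon> n'" for x using pn(2) that w unfolding info_iff by blast
    moreover have "\<forall>x. x \<sqsubset> m \<longrightarrow> (D s x \<longrightarrow> x \<epsilon> p) \<and> (\<not> D s x \<longrightarrow> x \<epsilon> n)" using Ds[OF les(2)] p n by blast
    ultimately have "cm h q s m n'" unfolding cm_def using comp comput_lt[OF comp] les(5) by blast
    moreover have "D s0 x \<longleftrightarrow> D s x"
      if s0: "s0 \<sqsubset> s" "n0 \<sqsubset> s0" "cm h q s0 m0 n0" "\<forall>x. x \<epsilon> n0 \<longrightarrow> \<not> wset s q x" "x \<sqsubset> m" "x \<sqsubset> m0" for s0 m0 n0 x
    proof (cases "a \<sqsubseteq> s0")
      case True then show ?thesis using Ds les(2) s0(5) by blast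
    next
      case False
      have "y \<notin> X" if "y \<epsilon> n0" for y
      proof -
        have "y \<sqsubset> a" using mem_lt[OF that] s0(2) False by order
        then show ?thesis using b[OF les(4)] lt s0(4) that w by blast
      qed
      then show ?thesis using true[OF s0(3) _ s0(6)] a[OF les(2) s0(5)] by blast
    qed
    ultimately have "claim h q s m n'" unfolding claim_def by blast
    moreover have "\<forall>x. x \<epsilon> n' \<longrightarrow> x \<notin> X" using pn(2) unfolding info_iff by blast
    moreover have "D t x \<longleftrightarrow> x \<in> DL" if "s \<sqsubseteq> t" "x \<sqsubset> m" for t x
      using a[of t x] les(2) that ord.order.trans by blast
    ultimately show ?thesis using les(1) by blast
  qed
  \<comment> \<open>Negative information about X confirms a claim that covers all the d in question.
    Membership of d is inspected up to stage s, and after s it is frozen by the claim.\<close>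
  let ?c = "\<lambda>n n' s m. S \<sqsubseteq> s \<and> claim h q s m n' \<and> (\<forall>z. z \<epsilon> n \<longrightarrow> z = pr (fs z) (sn z) \<longrightarrow>
      fs z \<sqsubset> m \<and> (\<forall>t. t \<sqsubset> s \<oplus> \<one> \<longrightarrow> sn z \<sqsubseteq> t \<longrightarrow> (D t (fs z) \<longleftrightarrow> D (sn z) (fs z))))"
  show ?thesis
  proof (rule turing_leI)
    have "D1 (\<lambda>w. ?c (q2 (fs (fs w))) (q4 (fs (fs w))) (sn (fs w)) (sn w))"
      by (intro D1_intros D1_claim_h D1_D Q_intros)
    then show "S1 (\<lambda>w. (\<forall>x. x \<epsilon> q1 w \<longrightarrow> x \<in> BL) \<and> (\<exists>s m. ?c (q2 w) (q4 w) s m))"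
      by (intro S1_conj S1_ball_mem S1_ex S1_BL Q_intros D1_S1)
    fix p n
    show "info_about M BL p n \<longleftrightarrow> (\<exists>p' n'. ((\<forall>x. x \<epsilon> q1 (quad p n p' n') \<longrightarrow> x \<in> BL) \<and>
      (\<exists>s m. ?c (q2 (quad p n p' n')) (q4 (quad p n p' n')) s m)) \<and> info_about M X p' n')"
    proof (unfold proj_quad, rule iffI)
      assume info: "info_about M BL p n"
      obtain s n' where s: "S \<sqsubseteq> s" "claim h q s n n'" "\<forall>x. x \<epsilon> n' \<longrightarrow> x \<notin> X" using ex_claim[of n] by blast
      have "fs z \<sqsubset> n" if "z \<epsilon> n" for z using mem_lt[OF that] fs_le[of z] by order
      moreover have "D t (fs z) \<longleftrightarrow> D (sn z) (fs z)" if "z \<epsilon> n" "z = pr (fs z) (sn z)" "sn z \<sqsubseteq> t" for z t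
      proof -
        have "z \<notin> BL" using info that(1) unfolding info_iff by blast
        then have "pr (fs z) (sn z) \<notin> BL" unfolding that(2)[symmetric] .
        then show ?thesis using BL_pr that(3) by blast
      qed
      ultimately have "?c n n' s n" using s by blast
      moreover have "info_about M X \<zero> n'" using s(3) by (simp add: info_iff)
      ultimately show "\<exists>p' n'. ((\<forall>x. x \<epsilon> p \<longrightarrow> x \<in> BL) \<and> (\<exists>s m. ?c n n' s m)) \<and> info_about M X p' n'"
        using info unfolding info_iff by blast
    next
      assume "\<exists>p' n'. ((\<forall>x. x \<epsilon> p \<longrightarrow> x \<in> BL) \<and> (\<exists>s m. ?c n n' s m)) \<and> info_about M X p' n'"
      then obtain n' s m where p: "\<forall>x. x \<epsilon> p \<longrightarrow> x \<in> BL" and c: "?c n n' s m" and nX: "\<forall>x. x \<epsilon> n' \<longrightarrow> x \<notin> X"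
        unfolding info_iff by blast
      have "z \<notin> BL" if z: "z \<epsilon> n" for z
      proof
        assume "z \<in> BL"
        then obtain d u where zz: "z = pr d u" using BL_cases by blast
        then obtain t where t: "u \<sqsubseteq> t" "D t d \<noteq> D u d" using \<open>z \<in> BL\<close> BL_pr by blast
        have "fs z \<sqsubset> m \<and> (\<forall>t. t \<sqsubset> s \<oplus> \<one> \<longrightarrow> sn z \<sqsubseteq> t \<longrightarrow> (D t (fs z) \<longleftrightarrow> D (sn z) (fs z)))"
          by (rule c[THEN conjunct2, THEN conjunct2, THEN spec, THEN mp, OF z, THEN mp]) (simp add: zz)
        note this[unfolded zz fs_pr sn_pr]
        then have cz: "d \<sqsubset> m" "\<And>t. t \<sqsubset> s \<oplus> \<one> \<Longrightarrow> u \<sqsubseteq> t \<Longrightarrow> D t d \<longleftrightarrow> D u d" by blast+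
        have fr: "D v d \<longleftrightarrow> D s d" if "s \<sqsubseteq> v" for v by (rule frozen[OF c[THEN conjunct1] c[THEN conjunct2, THEN conjunct1] nX that cz(1)])
        have "\<not> t \<sqsubseteq> s" using cz(2)[OF _ t(1)] t(2) unfolding le_suc_iff by blast
        then have "s \<sqsubseteq> t" by order
        have "D u d \<longleftrightarrow> D s d"
        proof (cases "u \<sqsubseteq> s")
          case True then show ?thesis using cz(2)[of s] lt_suc by blast
        next
          case False then show ?thesis using fr[of u] by (meson ord.linear)
        qed
        then show False using fr[OF \<open>s \<sqsubseteq> t\<close>] t(2) by blast
      qed
      then show "info_about M BL p n" using p unfolding info_iff by blast
    qed
  qed
qed

lemma bi_isolated_degree: "\<exists>d. dce_degree M d \<and> bi_isolated M d"
proof -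
  let ?cl = "\<lambda>X. turing_eq M `` {X}"
  have ce: "ce M AL" "ce M BL" using S1_AL[OF Fn_id] S1_BL[OF Fn_id] by (simp_all add: ce_iff)
  \<comment> \<open>If \<open>BL\<close> were reducible to \<open>DL\<close>, isolation would reduce
    it to \<open>AL\<close>, and with it \<open>DL\<close>.\<close>
  have not_BD: "\<not> turing_le M BL DL"
    using isolation[OF S1_BL[OF Fn_id]] D_le_B D_not_le_A turing_le_trans by blast
  have dce: "dce_degree M (?cl DL)" unfolding dce_degree_def using class_degree dce_DL by blast
  have neq: "?cl X \<noteq> ?cl Y" if "\<not> turing_le M X Y" for X Y
    using that deg_le_class[of X X] deg_le_class[of X Y] turing_le_refl by metis
  have "isolated M (?cl DL)" unfolding isolated_def
  proof (intro conjI exI[of _ "?cl AL"] allI impI)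
    show "ce_degree M (?cl AL)" unfolding ce_degree_def using class_degree ce(1) by blast
    show "deg_less M (?cl AL) (?cl DL)"
      unfolding deg_less_def deg_le_class using A_le_D neq[OF D_not_le_A] by metis
    fix c assume c: "ce_degree M c \<and> deg_le M c (?cl DL)"
    then obtain X where X: "c = ?cl X" "ce M X" unfolding ce_degree_def using degree_class by blast
    then show "deg_le M c (?cl AL)" using c isolation[of X] by (simp add: deg_le_class ce_iff)
  qed (rule dce)
  moreover have "upper_isolated M (?cl DL)" unfolding upper_isolated_def
  proof (intro conjI exI[of _ "?cl BL"] allI impI)
    show "ce_degree M (?cl BL)" unfolding ce_degree_def using class_degree ce(2) by blast
    show "deg_less M (?cl DL) (?cl BL)"
      unfolding deg_less_def deg_le_class using D_le_B neq[OF not_BD] by metis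
    fix c assume c: "ce_degree M c \<and> deg_le M (?cl DL) c"
    then obtain X where X: "c = ?cl X" "ce M X" unfolding ce_degree_def using degree_class by blast
    then show "deg_le M (?cl BL) c" using c upper_isolation[of X] by (simp add: deg_le_class ce_iff)
  qed (rule dce)
  ultimately show ?thesis unfolding bi_isolated_def using dce by blast
qed

end

theorem theorem1p3:
  fixes M :: "'a arith_structure"
  assumes "model_ISigma1 M"
  shows "\<exists>d. dce_degree M d \<and> bi_isolated M d"
proof -
  interpret isigma1 M by unfold_locales (rule assms)
  obtain W where "enumeration M W"
    using ex_enumeration isigma1_axioms unfolding enumeration_def enumeration_axioms_def by blast
  then interpret enumeration M W .
  obtain h where "construction M W h"
    using ex_history enumeration_axioms unfolding construction_def construction_axioms_def by blast
  then interpret construction M W h .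
  show ?thesis by (rule bi_isolated_degree)
qed

end
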